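(* Let $d\ge1$ be an integer and $r\ge2$. For every $\beta>0$, every integer $\ell\ge2$ and every $A\in GL_d(\mathbb R)$ with $\rho(A)<1$, there exist a finite family of functions $\psi_1,\dots,\psi_m\in C^\infty(\mathbb S^1,\mathbb R^d)$ and $D_0>0$ such that, for every $\kappa>D_0$ and every $\phi\in\mathcal U_{\kappa-D_0}$, $$\mathrm{Leb}\Big(\Big\{(t_1,\dots,t_m)\in[-1,1]^m:\ \phi+\sum_{i=1}^mt_i\psi_i\in\mathcal E(\beta,\kappa,A)\Big\}\Big)=0.$$
   Context: $\mathbb S^1=\mathbb R/\mathbb Z$; $\tau(x)=\ell x\pmod1$; $\|\cdot\|$ is the Euclidean or operator norm; $A^T$ is the transpose. For $\kappa>0$, $\mathcal U_\kappa=\{\phi\in C^r(\mathbb S^1,\mathbb R^d):\max_{0\le k\le r}\sup_x\|\phi^{(k)}(x)\|\le\kappa\}$ and $\alpha=\kappa\sum_{i\ge0}\|A^i\|$. Words. $\mathcal A=\{1,\dots,\ell\}$; $\mathcal A^n$ is the set of words of length $n$. $\mathcal P(k)=[(k-1)/\ell,k/\ell)$ for $1\le k\le\ell$, $\mathcal P(\mathbf a)=\bigcap_{j=0}^{n-1}\tau^{-j}(\mathcal P(a_{n-j}))$ for $\mathbf a=(a_1,\dots,a_n)$; $[\mathbf a]_j$ is the prefix of length $j$; $\tau_{\mathbf a}^{-j}(x)$ is the unique point of $\mathcal P([\mathbf a]_j)$ mapped to $x$ by $\tau^j$. For $\phi\in\mathcal U_\kappa$ and $\mathbf a\in\mathcal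 A^n$, $S(x,\mathbf a)=\sum_{j=1}^nA^{j-1}\phi(\tau_{\mathbf a}^{-j}(x))$. Concentration multiplicity (for $\phi\in\mathcal U_\kappa$, with $\alpha=\alpha(\kappa)=\kappa\sum_{i\ge0}\|A^i\|$). For $\mathbf c\in\mathcal A^p$, $\mathcal P_*(\mathbf c)$ is the union of $\mathcal P(\mathbf c)$ and the two adjacent intervals of the same generation; $S_{\mathbf c}(\cdot,\mathbf a):\mathcal P_*(\mathbf c)\to\mathbb R^d$ is the natural $C^r$ extension of $S(\cdot,\mathbf a)|_{\mathcal P(\mathbf c)}$, obtained by continuing each inverse branch $\tau_{\mathbf a}^{-j}$ continuously (affinely) from $\mathcal P(\mathbf c)$ to $\mathcal P_*(\mathbf c)$; $S'_{\mathbf c}$ is its $x$-derivative. For $(\xi,\eta)\in\mathbb Z\times\mathbb R^d$, $B^q_{\mathbf c}(\xi,\eta)=\{\mathbf a\in\mathcal A^q:\exists x\in\mathcal P_*(\mathbf c),\ |\xi+\eta\cdot S'_{\mathbf c}(x,\mathbf a)|<2\alpha\ell^{-q}\|(A^q)^T\eta\|\}$; $M(p,q)=\max_{\mathbf c\in\mathcal A^p}\sup_{(\xi,\eta)}\#B^q_{\mathbf c}(\xi,\eta)$; $M(q)=\lim_{p\to\infty}M(p,q)=\inf_{p\ge1}M(p,q)$. Exceptional set. $\mathcal E(\beta,\kappa,A)=\{\phi\in\mathcal U_\kappa:\limsup_{q\to\infty}\frac1q\log M(q)\ge\beta\}$. *)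

theory Defs
  imports "HOL-Analysis.Analysis"
begin

section \<open>Functions on the circle\<close>

text \<open>
  A function on the circle \<open>\<real>/\<int>\<close> is a 1-periodic function on \<open>\<real>\<close>; a point of the circle is
  represented by its representative in \<open>[0,1)\<close>.
\<close>

definition nth_vderiv :: "nat \<Rightarrow> (real \<Rightarrow> 'a::real_normed_vector) \<Rightarrow> real \<Rightarrow> 'a" where
  "nth_vderiv k = (\<lambda>f x. vector_derivative f (at x)) ^^ k"

definition Cr_circle :: "nat \<Rightarrow> (real \<Rightarrow> 'a::real_normed_vector) set" where
  "Cr_circle r = {f. (\<forall>x. f (x + 1) = f x) \<and>
     (\<forall>k<r. \<forall>x. nth_vderiv k f differentiable (at x)) \<and>
     (\<forall>k\<le>r. continuous_on UNIV (nth_vderiv k f))}"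

definition Cinf_circle :: "(real \<Rightarrow> 'a::real_normed_vector) set" where
  "Cinf_circle = (\<Inter>r. Cr_circle r)"

definition Cr_norm :: "nat \<Rightarrow> (real \<Rightarrow> 'a::real_normed_vector) \<Rightarrow> real" where
  "Cr_norm r f = Max ((\<lambda>k. SUP x. norm (nth_vderiv k f x)) ` {0..r})"

definition Ukappa :: "nat \<Rightarrow> real \<Rightarrow> (real \<Rightarrow> 'a::real_normed_vector) set" where
  "Ukappa r \<kappa> = {\<phi> \<in> Cr_circle r. Cr_norm r \<phi> \<le> \<kappa>}"


section \<open>Matrices\<close>

text \<open>
  The overloaded power \<open>A ^ i\<close> on \<open>real ^ 'n ^ 'n\<close> is the entrywise one, hence the
  separate definition of the power with respect to the matrix product.
\<close>

definition matpow :: "'a::semiring_1 ^ 'n ^ 'n \<Rightarrow> nat \<Rightarrow> 'a ^ 'n ^ 'n" where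
  "matpow A i = ((\<lambda>B. A ** B) ^^ i) (mat 1)"

definition complex_eigenvalues :: "real ^ 'n ^ 'n \<Rightarrow> complex set" where
  "complex_eigenvalues A =
     {z. \<exists>v :: complex ^ 'n. v \<noteq> 0 \<and> (\<chi> i j. complex_of_real (A $ i $ j)) *v v = z *s v}"

definition spectral_radius :: "real ^ 'n ^ 'n \<Rightarrow> real" where
  "spectral_radius A = (SUP z\<in>complex_eigenvalues A. cmod z)"

definition alpha :: "real \<Rightarrow> real ^ 'n ^ 'n \<Rightarrow> real" where
  "alpha \<kappa> A = \<kappa> * (\<Sum>i. onorm (\<lambda>v. matpow A i *v v))"


section \<open>Words, cylinders and inverse branches\<close>

definition tau :: "nat \<Rightarrow> real \<Rightarrow> real" where
  "tau l x = frac (real l * x)"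

definition words :: "nat \<Rightarrow> nat \<Rightarrow> nat list set" where
  "words l n = {a. length a = n \<and> set a \<subseteq> {1..l}}"

definition letter_interval :: "nat \<Rightarrow> nat \<Rightarrow> real set" where
  "letter_interval l k = {(real k - 1) / real l ..< real k / real l}"

text \<open>
  Lists are indexed from 0, so the letter written \<open>a\<^sub>i\<close> with \<open>1 \<le> i \<le> n\<close> is \<open>a ! (i - 1)\<close>;
  the \<open>j\<close>-th iterate of a point is constrained by the letter \<open>a\<^sub>n\<^sub>-\<^sub>j\<close>.
\<close>

definition cylinder :: "nat \<Rightarrow> nat list \<Rightarrow> real set" where
  "cylinder l a = {x \<in> {0..<1}. \<forall>j<length a.
     (tau l ^^ j) x \<in> letter_interval l (a ! (length a - j - 1))}"

text \<open>
  The cylinder of \<open>c\<close> together with its two neighbours of the same generation, as an interval of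
  \<open>\<real>\<close>. It is not reduced modulo 1: for a cylinder with endpoint 0 or 1 it leaves \<open>[0,1)\<close>, so that
  the affine continuation of the inverse branches is single-valued on it.
\<close>

definition cylinder_star :: "nat \<Rightarrow> nat list \<Rightarrow> real set" where
  "cylinder_star l c =
     (\<Union>s\<in>{-1, 0, 1}. (\<lambda>x. x + s / real l ^ length c) ` cylinder l c)"

definition inv_branch :: "nat \<Rightarrow> nat list \<Rightarrow> nat \<Rightarrow> real \<Rightarrow> real" where
  "inv_branch l a j x = (THE y. y \<in> cylinder l (take j a) \<and> (tau l ^^ j) y = x)"

definition inv_branch_ext :: "nat \<Rightarrow> nat list \<Rightarrow> nat list \<Rightarrow> nat \<Rightarrow> real \<Rightarrow> real" where
  "inv_branch_ext l c a j =
     (THE g. (\<exists>u v. \<forall>x. g x = u * x + v) \<and> (\<forall>x\<in>cylinder l c. g x = inv_branch l a j x))"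

definition S_ext ::
  "nat \<Rightarrow> real ^ 'n ^ 'n \<Rightarrow> (real \<Rightarrow> real ^ 'n) \<Rightarrow> nat list \<Rightarrow> nat list \<Rightarrow> real \<Rightarrow> real ^ 'n" where
  "S_ext l A \<phi> c a x =
     (\<Sum>j = 1..length a. matpow A (j - 1) *v \<phi> (inv_branch_ext l c a j x))"


section \<open>Concentration multiplicity and the exceptional set\<close>

definition conc_words ::
  "nat \<Rightarrow> real \<Rightarrow> real ^ 'n ^ 'n \<Rightarrow> (real \<Rightarrow> real ^ 'n) \<Rightarrow> nat list \<Rightarrow> nat \<Rightarrow> int \<Rightarrow> real ^ 'n
     \<Rightarrow> nat list set" where
  "conc_words l \<kappa> A \<phi> c q \<xi> \<eta> = {a \<in> words l q. \<exists>x\<in>cylinder_star l c.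
     \<bar>real_of_int \<xi> + \<eta> \<bullet> vector_derivative (S_ext l A \<phi> c a) (at x)\<bar>
       < 2 * alpha \<kappa> A / real l ^ q * norm (transpose (matpow A q) *v \<eta>)}"

text \<open>
  All suprema, maxima and infima here are of bounded sets of natural numbers, as \<open>conc_words\<close>
  has at most \<open>l ^ q\<close> elements. Since \<open>conc_mult2\<close> is nonincreasing in \<open>p\<close>, the infimum over
  \<open>p\<close> is also the limit as \<open>p\<close> tends to infinity.
\<close>

definition conc_mult2 ::
  "nat \<Rightarrow> real \<Rightarrow> real ^ 'n ^ 'n \<Rightarrow> (real \<Rightarrow> real ^ 'n) \<Rightarrow> nat \<Rightarrow> nat \<Rightarrow> nat" where
  "conc_mult2 l \<kappa> A \<phi> p q =
     Max ((\<lambda>c. SUP (\<xi>, \<eta>). card (conc_words l \<kappa> A \<phi> c q \<xi> \<eta>)) ` words l p)"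

definition conc_mult ::
  "nat \<Rightarrow> real \<Rightarrow> real ^ 'n ^ 'n \<Rightarrow> (real \<Rightarrow> real ^ 'n) \<Rightarrow> nat \<Rightarrow> nat" where
  "conc_mult l \<kappa> A \<phi> q = (INF p\<in>{1..}. conc_mult2 l \<kappa> A \<phi> p q)"

definition exceptional ::
  "nat \<Rightarrow> nat \<Rightarrow> real \<Rightarrow> real \<Rightarrow> real ^ 'n ^ 'n \<Rightarrow> (real \<Rightarrow> real ^ 'n) set" where
  "exceptional r l \<beta> \<kappa> A = {\<phi> \<in> Ukappa r \<kappa>.
     limsup (\<lambda>q. ereal (1 / real q * ln (real (conc_mult l \<kappa> A \<phi> q)))) \<ge> ereal \<beta>}"

end

theory Submission
  imports Defs "HOL-Computational_Algebra.Fundamental_Theorem_Algebra"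
begin

text \<open>
  Write \<open>f = \<phi>'\<close>. The derivative \<open>S'(x,a)\<close> is the sum of \<open>l^(-j) A^(j-1) f\<close> over the points of the backward orbit of \<open>x\<close> along the
  word \<open>a\<close> (\<open>dS\<close>, \<open>vector_derivative_S_ext\<close>), and it is affine in the parameters \<open>t\<close>. The condition that
  defines the multiplicity is homogeneous in \<open>(\<xi>, \<eta>)\<close>, so \<open>\<eta>\<close> may be taken of norm 1 and \<open>\<xi>\<close> real and bounded, and it confines
  \<open>\<xi> + \<eta> \<bullet> S'(x,a)\<close> to an interval of length about \<open>\<delta> = (\<rho>/l)\<^sup>n\<close> for words of length \<open>n\<close>, because the powers of \<open>A\<close> decay like
  \<open>\<rho>\<^sup>n\<close> for some \<open>\<rho> < 1\<close> (\<open>matpow_exponential_decay\<close>).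

  Suppose that for \<open>k\<close> words the values \<open>\<eta> \<bullet> S'(x,a)\<close> can be moved independently by changing \<open>t\<close>. Then all \<open>k\<close>
  conditions hold at once with probability about \<open>\<delta>\<^sup>k\<close>. There are \<open>l^(nk)\<close> choices of words, and \<open>\<delta>^(-d-2)\<close> choices of \<open>(x, \<xi>, \<eta>)\<close>
  up to an error of size \<open>\<delta>\<close>. The total is \<open>(\<rho>^(k-d-2) l^(d+2))\<^sup>n\<close>, which is summable over \<open>n\<close> once \<open>k\<close> is large, precisely because
  \<open>\<rho> < 1\<close> (\<open>measure_bad_cells_le\<close>). By the Borel-Cantelli lemma, for almost every \<open>t\<close> no such coincidence
  occurs for words of large length.

  Independence is obtained from bumps. Fix a depth \<open>N\<close>, and consider words with different prefixes of length \<open>N\<close>.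
  Their backward orbits are at different, well separated points at time \<open>N\<close>. A bump at one of these points
  moves the corresponding word, and moves the others only if their orbits come close to that point at some
  other time. Near periodic points this does happen, but out of \<open>K\<close> words one can select \<open>k\<close> that do not interfere, with
  \<open>K\<close> growing only linearly in \<open>N\<close> (\<open>exists_noninterfering_words\<close>). For the selected words the matrix of derivatives with
  respect to the parameters is diagonally dominant, uniformly in all data (\<open>transversal_bump_family\<close>).

  Consequently, for almost every \<open>t\<close>, the concentrated words form a tree that branches at most \<open>K\<close>-fold every \<open>N\<close> steps, up to a
  bounded number of last letters: the suffixes below any node are again concentrated words for a transported
  pair \<open>(\<xi>, \<eta>)\<close> (\<open>card_near_words_le\<close>). The growth rate of the multiplicity is therefore at most \<open>ln K / N\<close>, which is below \<open>\<beta>\<close>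
  for \<open>N\<close> large, as \<open>K\<close> is linear in \<open>N\<close>.
\<close>

section \<open>Powers of a matrix of spectral radius less than one\<close>

lemma matpow_0 [simp]: "matpow A 0 = mat 1"
  by (simp add: matpow_def)

lemma matpow_Suc: "matpow A (Suc n) = A ** matpow A n"
  by (simp add: matpow_def)

lemma matpow_add: "matpow A (m + n) = matpow A m ** matpow A n"
  by (induction m) (simp_all add: matpow_Suc matrix_mul_assoc)

lemma matpow_Suc_right: "matpow A (Suc n) = matpow A n ** A"
  using matpow_add[of A n 1] by (simp add: matpow_Suc)

lemma transpose_matpow:
  "transpose (matpow (A :: 'a::comm_semiring_1 ^ 'n ^ 'n) n) = matpow (transpose A) n"
  by (induction n) (simp_all add: matpow_Suc[of A] matpow_Suc_right[of "transpose A"] matrix_transpose_mul)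

text \<open>
  The value at \<open>v\<close> of the matrix polynomial \<open>p(M)\<close>.
\<close>

definition poly_act :: "complex ^ 'n ^ 'n \<Rightarrow> complex poly \<Rightarrow> complex ^ 'n \<Rightarrow> complex ^ 'n" where
  "poly_act M p v = (\<Sum>i\<le>degree p. coeff p i *s (matpow M i *v v))"

lemma poly_act_pCons: "poly_act M (pCons a p) v = a *s v + poly_act M p (M *v v)"
proof (cases "p = 0")
  case False
  then show ?thesis
    by (simp add: poly_act_def sum.atMost_Suc_shift matpow_Suc_right matrix_vector_mul_assoc
        del: sum.atMost_Suc)
qed (simp add: poly_act_def)

lemma poly_act_0 [simp]: "poly_act M 0 v = 0"
  by (simp add: poly_act_def)

lemma poly_act_add: "poly_act M (p + q) v = poly_act M p v + poly_act M q v"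
  by (induction p q arbitrary: v rule: poly_induct2) (simp_all add: poly_act_pCons algebra_simps)

lemma poly_act_smult: "poly_act M (smult c p) v = c *s poly_act M p v"
  by (induction p arbitrary: v) (simp_all add: poly_act_pCons algebra_simps)

lemma poly_act_linear:
  "poly_act M p (a *s v + w) = a *s poly_act M p v + poly_act M p w"
  by (induction p arbitrary: v w)
     (simp_all add: poly_act_pCons matrix_vector_right_distrib vector_scalar_commute algebra_simps)

lemma poly_act_commute: "poly_act M p (M *v v) = M *v poly_act M p v"
  by (induction p arbitrary: v)
     (simp_all add: poly_act_pCons matrix_vector_right_distrib vector_scalar_commute)

text \<open>
  Among the vectors \<open>v, M v, ..., M\<^sup>d v\<close> of a \<open>d\<close>-dimensional space there is a linear relation.
  Working with one vector at a time is enough for the decay of the powers and replaces the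
  Cayley-Hamilton theorem.
\<close>

lemma exists_annihilating_poly:
  fixes M :: "complex ^ 'n ^ 'n"
  shows "\<exists>p. p \<noteq> 0 \<and> poly_act M p v = 0"
proof -
  define D where "D = CARD('n)"
  define f where "f = (\<lambda>i. matpow M i *v v)"
  have "\<exists>c. (\<exists>i\<le>D. c i \<noteq> 0) \<and> (\<Sum>i\<le>D. c i *s f i) = 0"
  proof (cases "inj_on f {..D}")
    case True
    have "vec.dependent (f ` {..D})"
      by (intro vec.dependent_biggerset_general)
         (use vec.dim_subset_UNIV[of "f ` {..D}"] in \<open>simp add: card_image[OF True[unfolded D_def]] D_def vec.dimension_def card_cart_basis\<close>)
    then obtain u where u: "\<exists>w\<in>f ` {..D}. u w \<noteq> 0" "(\<Sum>w\<in>f ` {..D}. u w *s w) = 0"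
      by (subst (asm) vec.dependent_finite) auto
    from u(2) have "(\<Sum>i\<le>D. u (f i) *s f i) = 0"
      by (subst (asm) sum.reindex[OF True]) simp
    with u(1) show ?thesis by (intro exI[of _ "\<lambda>i. u (f i)"]) auto
  next
    case False
    then obtain i j where ij: "i \<le> D" "j \<le> D" "i \<noteq> j" "f i = f j"
      by (auto simp: inj_on_def)
    define c :: "nat \<Rightarrow> complex" where "c = (\<lambda>k. (if k = i then 1 else 0) + (if k = j then -1 else 0))"
    have "(\<Sum>k\<le>D. c k *s f k) = f i - f j"
      using ij by (simp add: c_def vector_sadd_rdistrib sum.distrib if_distrib[of "\<lambda>c. c *s _"] cong: if_cong)
    then show ?thesis using ij by (intro exI[of _ c]) (auto simp: c_def)
  qed
  then obtain c i where c: "i \<le> D" "c i \<noteq> 0" "(\<Sum>i\<le>D. c i *s f i) = 0" by blast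
  define p where "p = (\<Sum>i\<le>D. monom (c i) i)"
  have cp: "coeff p k = (if k \<le> D then c k else 0)" for k
    by (simp add: p_def coeff_sum)
  have "degree p \<le> D"
    by (intro degree_le) (simp add: cp)
  then have "poly_act M p v = (\<Sum>i\<le>D. coeff p i *s f i)"
    unfolding poly_act_def f_def by (intro sum.mono_neutral_left) (auto simp: coeff_eq_0)
  then have "poly_act M p v = 0" using c by (simp add: cp)
  moreover have "p \<noteq> 0" using c cp[of i] by auto
  ultimately show ?thesis by blast
qed

text \<open>
  Induction on the degree. Split off a root \<open>z\<close>, so that \<open>p = (X - z) q\<close>. Either \<open>q(M) v\<close> already vanishes,
  or \<open>q(M) v\<close> is an eigenvector for \<open>z\<close> and then \<open>\<bar>z\<bar> \<le> r\<close>. In the second case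
  \<open>u = (M - z) v\<close> is annihilated by \<open>q\<close>, hence decays like \<open>\<rho>\<^sup>n\<close>, and so does the solution of the
  scalar recursion \<open>M^(n+1) v = z M\<^sup>n v + M\<^sup>n u\<close>, as \<open>\<bar>z\<bar> < \<rho>\<close>.
\<close>

lemma poly_annihilated_decay:
  fixes M :: "complex ^ 'n ^ 'n"
  assumes eig: "\<And>z w. w \<noteq> 0 \<Longrightarrow> M *v w = z *s w \<Longrightarrow> cmod z \<le> r"
    and r: "0 \<le> r" "r < \<rho>"
    and p: "p \<noteq> 0" "poly_act M p v = 0"
  shows "\<exists>C. \<forall>n. norm (matpow M n *v v) \<le> C * \<rho> ^ n"
  using p
proof (induction "degree p" arbitrary: p v)
  case 0
  then obtain c where "p = [:c:]" "c \<noteq> 0" by (metis degree_eq_zeroE pCons_0_0)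
  then have "v = 0" using 0 by (simp add: poly_act_pCons)
  then show ?case by (intro exI[of _ 0]) simp
next
  case (Suc k)
  then have "\<not> constant (poly p)" by (simp add: constant_degree)
  then obtain z where "poly p z = 0" using fundamental_theorem_of_algebra by blast
  then obtain q where q: "p = [:-z, 1:] * q" by (metis dvdE poly_eq_0_iff_dvd)
  have q0: "q \<noteq> 0" using Suc q by auto
  have dq: "k = degree q" using q0 Suc(2) degree_mult_eq[of "[:-z, 1:]" q] unfolding q by simp
  define u where "u = (-z) *s v + M *v v"
  have qu: "poly_act M q u = 0"
  proof -
    have "p = smult (-z) q + pCons 0 q" by (simp add: q)
    then have "poly_act M p v = (-z) *s poly_act M q v + poly_act M q (M *v v)"
      by (simp only: poly_act_add poly_act_smult poly_act_pCons) simp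
    then show ?thesis using Suc(4) unfolding u_def poly_act_linear by simp
  qed
  have comm: "poly_act M q u = (-z) *s poly_act M q v + M *v poly_act M q v"
    unfolding u_def poly_act_linear poly_act_commute ..
  show ?case
  proof (cases "poly_act M q v = 0")
    case True
    with Suc(1)[OF dq q0] show ?thesis by blast
  next
    case False
    have "M *v poly_act M q v = z *s poly_act M q v"
      using qu comm by (simp add: add_eq_0_iff)
    then have zr: "cmod z \<le> r" using eig False by blast
    obtain C where C: "\<And>n. norm (matpow M n *v u) \<le> C * \<rho> ^ n"
      using Suc(1)[OF dq q0 qu] by blast
    define C' where "C' = max (norm v) (C / (\<rho> - r))"
    have C': "C \<le> C' * (\<rho> - r)" "norm v \<le> C'"
      using r by (auto simp: C'_def field_simps max_def)
    have C'0: "0 \<le> C'" using C'(2) norm_ge_zero order_trans by blast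
    have "norm (matpow M n *v v) \<le> C' * \<rho> ^ n" for n
    proof (induction n)
      case 0
      show ?case using C' by simp
    next
      case (Suc n)
      have "matpow M (Suc n) *v v = matpow M n *v (M *v v)"
        by (simp add: matpow_Suc_right matrix_vector_mul_assoc)
      also have "M *v v = z *s v + u" by (simp add: u_def)
      also have "matpow M n *v \<dots> = z *s (matpow M n *v v) + matpow M n *v u"
        by (simp add: matrix_vector_right_distrib vector_scalar_commute)
      also have "norm \<dots> \<le> cmod z * norm (matpow M n *v v) + norm (matpow M n *v u)"
      proof -
        have "norm (z *s w) = cmod z * norm w" for w :: "complex ^ 'n"
          by (simp add: norm_vec_def norm_mult L2_set_right_distrib)
        then show ?thesis by (metis norm_triangle_ineq)
      qed
      also have "\<dots> \<le> r * (C' * \<rho> ^ n) + C * \<rho> ^ n"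
        using zr Suc C[of n] C'0 r by (intro add_mono mult_mono) auto
      also have "\<dots> \<le> r * (C' * \<rho> ^ n) + C' * (\<rho> - r) * \<rho> ^ n"
        using C' r by (intro add_left_mono mult_right_mono) auto
      also have "\<dots> = C' * \<rho> ^ Suc n" by (simp add: algebra_simps)
      finally show ?case .
    qed
    then show ?thesis by blast
  qed
qed

text \<open>
  The point is that the supremum defining the spectral radius is over a bounded set: comparing the
  largest entry of an eigenvector bounds every eigenvalue by the sum of the absolute values of the
  matrix entries.
\<close>

lemma complex_eigenvalue_le_spectral_radius:
  fixes A :: "real ^ 'n ^ 'n"
  assumes "z \<in> complex_eigenvalues A"
  shows "cmod z \<le> spectral_radius A"
proof -
  have "cmod z \<le> (\<Sum>i\<in>UNIV. \<Sum>j\<in>UNIV. \<bar>A $ i $ j\<bar>)" if z: "z \<in> complex_eigenvalues A" for z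
  proof -
    obtain v :: "complex ^ 'n" where v: "v \<noteq> 0" "(\<chi> i j. complex_of_real (A $ i $ j)) *v v = z *s v"
      using z by (auto simp: complex_eigenvalues_def)
    obtain i where i: "\<And>j. cmod (v $ j) \<le> cmod (v $ i)"
    proof -
      have "Max (range (\<lambda>j. cmod (v $ j))) \<in> range (\<lambda>j. cmod (v $ j))" by (intro Max_in) auto
      then obtain i where i: "Max (range (\<lambda>j. cmod (v $ j))) = cmod (v $ i)" by blast
      have "cmod (v $ j) \<le> cmod (v $ i)" for j
        unfolding i[symmetric] by (intro Max_ge) auto
      then show ?thesis using that by blast
    qed
    have pos: "cmod (v $ i) > 0"
    proof (rule ccontr)
      assume "\<not> ?thesis"
      then have "cmod (v $ j) \<le> 0" for j using i[of j] by linarith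
      then have "v = 0" by (simp add: vec_eq_iff)
      with v show False by simp
    qed
    have "z * v $ i = (\<Sum>j\<in>UNIV. complex_of_real (A $ i $ j) * v $ j)"
      using arg_cong[OF v(2), of "\<lambda>w. w $ i"] by (simp add: matrix_vector_mult_def)
    then have "cmod z * cmod (v $ i) = cmod (\<Sum>j\<in>UNIV. complex_of_real (A $ i $ j) * v $ j)"
      by (metis norm_mult)
    also have "\<dots> \<le> (\<Sum>j\<in>UNIV. \<bar>A $ i $ j\<bar> * cmod (v $ i))"
      by (intro sum_norm_le) (auto simp: norm_mult intro!: mult_left_mono i)
    also have "\<dots> = (\<Sum>j\<in>UNIV. \<bar>A $ i $ j\<bar>) * cmod (v $ i)" by (simp add: sum_distrib_right)
    finally have "cmod z \<le> (\<Sum>j\<in>UNIV. \<bar>A $ i $ j\<bar>)" using pos by simp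
    also have "\<dots> \<le> (\<Sum>i\<in>UNIV. \<Sum>j\<in>UNIV. \<bar>A $ i $ j\<bar>)"
      by (intro member_le_sum[of i UNIV "\<lambda>i. \<Sum>j\<in>UNIV. \<bar>A $ i $ j\<bar>"]) (auto intro: sum_nonneg)
    finally show ?thesis .
  qed
  then show ?thesis unfolding spectral_radius_def
    using assms by (intro cSUP_upper) (auto simp: bdd_above_def)
qed

text \<open>
  A real vector and its complexification have the same norm, so the decay on each standard basis
  vector passes from the complexified matrix to \<open>A\<close>.
\<close>

lemma matpow_exponential_decay:
  fixes A :: "real ^ 'n ^ 'n"
  assumes "spectral_radius A < 1"
  obtains C \<rho> where "C \<ge> 1" "0 < \<rho>" "\<rho> < 1"
    "\<And>n v. norm (matpow A n *v v) \<le> C * \<rho> ^ n * norm v"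
proof -
  define r where "r = max 0 (spectral_radius A)"
  obtain \<rho> where \<rho>: "r < \<rho>" "\<rho> < 1" using dense[of r 1] assms by (auto simp: r_def)
  have r0: "r \<ge> 0" by (simp add: r_def)
  define M where "M = (\<chi> i j. complex_of_real (A $ i $ j))"
  define cv :: "real ^ 'n \<Rightarrow> complex ^ 'n" where "cv = (\<lambda>x. \<chi> i. complex_of_real (x $ i))"
  have Mcv: "M *v cv x = cv (A *v x)" for x
    by (simp add: M_def cv_def vec_eq_iff matrix_vector_mult_def)
  have pcv: "matpow M n *v cv x = cv (matpow A n *v x)" for n x
    by (induction n) (simp_all add: matpow_Suc matrix_vector_mul_assoc[symmetric] Mcv)
  have ncv: "norm (cv x) = norm x" for x
    by (simp add: cv_def norm_vec_def)
  have eig: "cmod z \<le> r" if "w \<noteq> 0" "M *v w = z *s w" for z w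
  proof -
    have "z \<in> complex_eigenvalues A" using that by (auto simp: complex_eigenvalues_def M_def)
    then show ?thesis using complex_eigenvalue_le_spectral_radius by (fastforce simp: r_def)
  qed
  have "\<exists>C. \<forall>n. norm (matpow A n *v x) \<le> C * \<rho> ^ n" for x
  proof -
    obtain p where p: "p \<noteq> 0" "poly_act M p (cv x) = 0" using exists_annihilating_poly by blast
    show ?thesis
      using poly_annihilated_decay[OF eig r0 \<rho>(1) p] by (simp add: pcv ncv)
  qed
  then obtain C where C: "\<And>x n. norm (matpow A n *v x) \<le> C x * \<rho> ^ n" by metis
  define K where "K = (\<Sum>j\<in>UNIV. \<bar>C (axis j 1)\<bar>)"
  have "norm (matpow A n *v v) \<le> (1 + K) * \<rho> ^ n * norm v" for n v
  proof -
    have "matpow A n *v v = (\<Sum>j\<in>UNIV. (v $ j) *s (matpow A n *v axis j 1))"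
    proof -
      have "v = (\<Sum>j\<in>UNIV. (v $ j) *s axis j 1)" by (simp add: basis_expansion)
      then have "matpow A n *v v = matpow A n *v (\<Sum>j\<in>UNIV. (v $ j) *s axis j 1)" by metis
      also have "\<dots> = (\<Sum>j\<in>UNIV. (v $ j) *s (matpow A n *v axis j 1))"
        by (simp add: vec.linear_sum[OF matrix_vector_mul_linear_gen] vector_scalar_commute)
      finally show ?thesis .
    qed
    also have "norm \<dots> \<le> (\<Sum>j\<in>UNIV. norm v * (\<bar>C (axis j 1)\<bar> * \<rho> ^ n))"
    proof (intro sum_norm_le)
      fix j
      have "norm (matpow A n *v axis j 1) \<le> \<bar>C (axis j 1)\<bar> * \<rho> ^ n"
        using C[of n "axis j 1"] \<rho> r0
        by (smt (verit) mult_right_mono zero_le_power)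
      then show "norm ((v $ j) *s (matpow A n *v axis j 1)) \<le> norm v * (\<bar>C (axis j 1)\<bar> * \<rho> ^ n)"
        using component_le_norm_cart[of v j]
        by (simp add: scalar_mult_eq_scaleR mult_mono)
    qed
    also have "\<dots> = K * \<rho> ^ n * norm v" 
      by (simp add: K_def sum_distrib_left sum_distrib_right mult_ac)
    also have "\<dots> \<le> (1 + K) * \<rho> ^ n * norm v" using \<rho> r0 by (intro mult_right_mono) auto
    finally show ?thesis .
  qed
  moreover have "1 + K \<ge> 1" unfolding K_def by (simp add: sum_nonneg)
  ultimately show ?thesis using that \<rho> r0 by (meson le_less_trans)
qed

lemma transpose_matpow_decay:
  fixes A :: "real ^ 'n ^ 'n"
  assumes "\<And>v. norm (matpow A n *v v) \<le> c * norm v"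
  shows "norm (transpose (matpow A n) *v \<eta>) \<le> c * norm \<eta>"
proof (cases "transpose (matpow A n) *v \<eta> = 0")
  case True
  have "0 \<le> c * norm \<eta>" using order_trans[OF norm_ge_zero assms] .
  then show ?thesis using True by simp
next
  case False
  define w where "w = transpose (matpow A n) *v \<eta>"
  have "norm w * norm w = w \<bullet> w" by (simp add: dot_square_norm power2_eq_square)
  also have "\<dots> = \<eta> \<bullet> (matpow A n *v w)"
    by (simp add: w_def dot_lmul_matrix)
  also have "\<dots> \<le> norm \<eta> * (c * norm w)"
    using norm_cauchy_schwarz assms by (smt (verit) mult_left_mono norm_ge_zero)
  finally have "norm w * norm w \<le> (c * norm \<eta>) * norm w" by (simp add: mult_ac)
  then show ?thesis using False by (simp add: w_def)
qed

text \<open>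
  The inverse of \<open>A\<^sup>T\<close> is bounded, so one application of \<open>A\<^sup>T\<close> shrinks a vector at most by a fixed
  factor. This is the only way in which the invertibility of \<open>A\<close> enters.
\<close>

lemma transpose_matpow_lower_bound:
  fixes A :: "real ^ 'n ^ 'n"
  assumes "invertible A"
  obtains \<sigma> where "0 < \<sigma>" "\<sigma> \<le> 1"
    "\<And>n \<eta>. norm (transpose (matpow A n) *v \<eta>) \<ge> \<sigma> ^ n * norm \<eta>"
proof -
  have "invertible (transpose A)" using assms by (simp add: transpose_invertible)
  then obtain B where B: "B ** transpose A = mat 1" by (auto simp: invertible_def)
  obtain K where K: "\<And>x. norm (B *v x) \<le> norm x * K" "K > 0"
    using bounded_linear.pos_bounded[OF matrix_vector_mul_bounded_linear[of B]] by blast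
  define \<sigma> where "\<sigma> = 1 / (1 + K)"
  have s: "0 < \<sigma>" "\<sigma> \<le> 1" using K by (auto simp: \<sigma>_def)
  have 1: "\<sigma> * norm x \<le> norm (transpose A *v x)" for x
  proof -
    have "norm x = norm (B *v (transpose A *v x))" by (simp add: matrix_vector_mul_assoc B del: transpose_matrix_vector)
    also have "\<dots> \<le> norm (transpose A *v x) * K" by (rule K)
    also have "\<dots> \<le> norm (transpose A *v x) * (1 + K)" by (intro mult_left_mono) auto
    finally show ?thesis using K by (simp add: \<sigma>_def field_simps)
  qed
  have "norm (transpose (matpow A n) *v \<eta>) \<ge> \<sigma> ^ n * norm \<eta>" for n \<eta>
    unfolding transpose_matpow
  proof (induction n)
    case (Suc n)
    have "\<sigma> ^ Suc n * norm \<eta> \<le> \<sigma> * norm (matpow (transpose A) n *v \<eta>)"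
      using Suc s by (simp add: mult.assoc)
    also have "\<dots> \<le> norm (matpow (transpose A) (Suc n) *v \<eta>)"
      using 1 by (simp add: matpow_Suc matrix_vector_mul_assoc[symmetric])
    finally show ?case .
  qed simp
  with s that show ?thesis by blast
qed

section \<open>Inverse branches\<close>

text \<open>
  The inverse branch along a word, as an affine map of the whole line: the letter \<open>k\<close> acts by
  \<open>y \<mapsto> (y + k - 1) / l\<close>. On the line the continuation of branches to neighbouring cylinders needs no
  discussion, and prefixes of a word correspond to earlier points of the backward orbit.
\<close>

definition branch :: "nat \<Rightarrow> nat list \<Rightarrow> real \<Rightarrow> real" where
  "branch l a x = fold (\<lambda>k y. (y + real k - 1) / real l) a x"

lemma branch_Nil [simp]: "branch l [] x = x"
  and branch_Cons: "branch l (k # a) x = branch l a ((x + real k - 1) / real l)"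
  and branch_append: "branch l (a @ b) x = branch l b (branch l a x)"
  and branch_snoc: "branch l (a @ [k]) x = (branch l a x + real k - 1) / real l"
  by (simp_all add: branch_def)

lemma branch_affine: "branch l a x = x / real l ^ length a + branch l a 0"
  by (induction a rule: rev_induct) (simp_all add: branch_snoc add_divide_distrib diff_divide_distrib)

lemma branch_take_affine:
  assumes "j \<le> length a"
  shows "branch l (take j a) x = x / real l ^ j + branch l (take j a) 0"
  using branch_affine[of l "take j a" x] assms by simp

lemma words_take: "a \<in> words l n \<Longrightarrow> j \<le> n \<Longrightarrow> take j a \<in> words l j"
  by (auto simp: words_def dest: in_set_takeD)

lemma words_drop: "a \<in> words l n \<Longrightarrow> j \<le> n \<Longrightarrow> drop j a \<in> words l (n - j)"
  by (auto simp: words_def dest: in_set_dropD)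

lemma words_as_lists: "words l n = {a. set a \<subseteq> {1..l} \<and> length a = n}"
  by (auto simp: words_def)

lemma finite_words [simp]: "finite (words l n)"
  unfolding words_as_lists by (intro finite_lists_length_eq) simp

lemma card_words: "card (words l n) = l ^ n"
  unfolding words_as_lists by (subst card_lists_length_eq) simp_all

lemma words_ne: "l \<ge> 1 \<Longrightarrow> words l n \<noteq> {}"
  using card_words[of l n] by fastforce

text \<open>
  The enlarged cylinders stick out of \<open>[0,1)\<close>; the interval \<open>[-1,2]\<close> contains them all and is mapped
  into itself by every branch, so that base points may be taken from a fixed compact set.
\<close>

lemma branch_in_interval:
  assumes "l \<ge> 2" "a \<in> words l n" "x \<in> {-1..2}"
  shows "branch l a x \<in> {-1..2}"
  using assms(2,3)
proof (induction a arbitrary: n x)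
  case (Cons k a)
  have k: "1 \<le> k" "k \<le> l" "a \<in> words l (length a)" using Cons.prems by (auto simp: words_def)
  have "-1 * real l \<le> x + real k - 1" "x + real k - 1 \<le> 2 * real l"
    using k Cons.prems assms(1) by auto
  then have "(x + real k - 1) / real l \<in> {-1..2}"
    using assms(1) by (auto simp: field_simps)
  with Cons.IH k show ?case by (auto simp: branch_Cons)
qed simp

lemma mem_cylinder_snoc:
  assumes "l \<ge> 2" "1 \<le> k" "k \<le> l"
  shows "y \<in> cylinder l (a @ [k]) \<longleftrightarrow>
    y \<in> {0..<1} \<and> y \<in> letter_interval l k \<and> tau l y \<in> cylinder l a"
proof -
  have tau01: "tau l y \<in> {0..<1}" by (simp add: tau_def frac_lt_1)
  show ?thesis
  proof -
    have "(\<forall>j<length (a @ [k]). (tau l ^^ j) y \<in> letter_interval l ((a @ [k]) ! (length (a @ [k]) - j - 1)))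
      \<longleftrightarrow> y \<in> letter_interval l k \<and>
        (\<forall>j<length a. (tau l ^^ j) (tau l y) \<in> letter_interval l (a ! (length a - j - 1)))"
      (is "?L \<longleftrightarrow> _")
    proof -
      have "?L \<longleftrightarrow> (\<forall>j<Suc (length a). (tau l ^^ j) y \<in> letter_interval l ((a @ [k]) ! (length a - j)))"
        by simp
      also have "\<dots> \<longleftrightarrow> y \<in> letter_interval l k \<and>
          (\<forall>j<length a. (tau l ^^ Suc j) y \<in> letter_interval l ((a @ [k]) ! (length a - Suc j)))"
        unfolding All_less_Suc2 by simp
      also have "\<dots> \<longleftrightarrow> y \<in> letter_interval l k \<and>
          (\<forall>j<length a. (tau l ^^ j) (tau l y) \<in> letter_interval l (a ! (length a - j - 1)))"
        unfolding funpow_Suc_right o_apply by (auto simp: nth_append)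
      finally show ?thesis .
    qed
    then show ?thesis using tau01 unfolding cylinder_def by blast
  qed
qed

text \<open>
  The last letter of a word is the first digit of the points of its cylinder, hence the induction
  from the right.
\<close>

lemma cylinder_iff_branch:
  assumes "l \<ge> 2" "a \<in> words l n"
  shows "y \<in> cylinder l a \<and> (tau l ^^ n) y = x \<longleftrightarrow> x \<in> {0..<1} \<and> y = branch l a x"
  using assms(2)
proof (induction a arbitrary: n x y rule: rev_induct)
  case Nil
  then show ?case by (auto simp: cylinder_def words_def)
next
  case (snoc k a)
  define m where "m = length a"
  have n: "n = Suc m" and am: "a \<in> words l m" and k: "1 \<le> k" "k \<le> l"
    using snoc.prems by (auto simp: words_def m_def)
  have l0: "real l > 0" using assms by simp
  have step: "y \<in> {0..<1} \<and> y \<in> letter_interval l k \<and> tau l y = z \<longleftrightarrow>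
      z \<in> {0..<1} \<and> y = (z + real k - 1) / real l" for z
  proof
    assume h: "y \<in> {0..<1} \<and> y \<in> letter_interval l k \<and> tau l y = z"
    then have "real_of_int (int k - 1) \<le> real l * y" "real l * y < real_of_int (int k - 1) + 1"
      using l0 by (auto simp: letter_interval_def field_simps)
    then have "\<lfloor>real l * y\<rfloor> = int k - 1" by (intro floor_unique) auto
    then have "z = real l * y - (real k - 1)" using h by (simp add: tau_def frac_def)
    then show "z \<in> {0..<1} \<and> y = (z + real k - 1) / real l"
      using h l0 \<open>real_of_int (int k - 1) \<le> real l * y\<close> \<open>real l * y < real_of_int (int k - 1) + 1\<close>
      by auto
  next
    assume h: "z \<in> {0..<1} \<and> y = (z + real k - 1) / real l"
    then have ly: "real l * y = z + real k - 1" using l0 by simp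
    have "\<lfloor>real l * y\<rfloor> = int k - 1" unfolding ly using h by (intro floor_unique) auto
    then have "tau l y = z" by (simp add: tau_def frac_def ly)
    moreover have "y \<in> {0..<1}"
    proof -
      have "0 \<le> z + real k - 1" "z + real k - 1 < real l" using h k by auto
      then show ?thesis using h l0 by simp
    qed
    moreover have "y \<in> letter_interval l k" using h l0 by (auto simp: letter_interval_def divide_right_mono intro!: divide_strict_right_mono)
    ultimately show "y \<in> {0..<1} \<and> y \<in> letter_interval l k \<and> tau l y = z" by blast
  qed
  have "y \<in> cylinder l (a @ [k]) \<and> (tau l ^^ n) y = x \<longleftrightarrow>
      y \<in> {0..<1} \<and> y \<in> letter_interval l k \<and> tau l y \<in> cylinder l a \<and> (tau l ^^ m) (tau l y) = x"
    unfolding mem_cylinder_snoc[OF assms(1) k] n by (simp only: funpow_Suc_right o_apply) blast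
  also have "\<dots> \<longleftrightarrow> (\<exists>z. y \<in> {0..<1} \<and> y \<in> letter_interval l k \<and> tau l y = z \<and>
      z \<in> cylinder l a \<and> (tau l ^^ m) z = x)" by blast
  also have "\<dots> \<longleftrightarrow> (\<exists>z. z \<in> {0..<1} \<and> y = (z + real k - 1) / real l \<and>
      x \<in> {0..<1} \<and> z = branch l a x)"
    using step snoc.IH[OF am] by blast
  also have "\<dots> \<longleftrightarrow> x \<in> {0..<1} \<and> y = branch l (a @ [k]) x"
  proof -
    have "branch l a x \<in> {0..<1}" if "x \<in> {0..<1}"
      using snoc.IH[OF am, of "branch l a x" x] that by (auto simp: cylinder_def)
    then show ?thesis by (auto simp: branch_snoc)
  qed
  finally show ?case .
qed

lemma inv_branch_eq_branch:
  assumes "l \<ge> 2" "a \<in> words l n" "j \<le> n" "x \<in> {0..<1}"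
  shows "inv_branch l a j x = branch l (take j a) x"
  unfolding inv_branch_def
  using cylinder_iff_branch[OF assms(1) words_take[OF assms(2,3)]] assms(4)
  by (intro the_equality) auto

lemma cylinder_eq_image:
  assumes "l \<ge> 2" "c \<in> words l p"
  shows "cylinder l c = branch l c ` {0..<1}"
proof (intro set_eqI iffI)
  fix y assume "y \<in> cylinder l c"
  then show "y \<in> branch l c ` {0..<1}"
    using cylinder_iff_branch[OF assms, of y "(tau l ^^ p) y"] by blast
next
  fix y assume "y \<in> branch l c ` {0..<1}"
  then show "y \<in> cylinder l c"
    using cylinder_iff_branch[OF assms] by blast
qed

text \<open>
  An affine map is determined by its values at two points, and a cylinder contains more than one.
\<close>

lemma inv_branch_ext_eq_branch:
  assumes "l \<ge> 2" "a \<in> words l n" "j \<le> n" "c \<in> words l p"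
  shows "inv_branch_ext l c a j = branch l (take j a)"
  unfolding inv_branch_ext_def
proof (rule the_equality, intro conjI exI ballI allI)
  show "branch l (take j a) x = (1 / real l ^ j) * x + branch l (take j a) 0" for x
    using branch_take_affine[of j a l x] assms by (simp add: words_def)
  show "branch l (take j a) x = inv_branch l a j x" if "x \<in> cylinder l c" for x
    using inv_branch_eq_branch[OF assms(1-3), of x] that by (auto simp: cylinder_def)
next
  fix g
  assume g: "(\<exists>u v. \<forall>x. g x = u * x + v) \<and> (\<forall>x\<in>cylinder l c. g x = inv_branch l a j x)"
  then obtain u v where uv: "\<And>x. g x = u * x + v" by blast
  define u' v' where "u' = 1 / real l ^ j" and "v' = branch l (take j a) 0"
  have br: "branch l (take j a) x = u' * x + v'" for x
    using branch_take_affine[of j a l x] assms by (simp add: words_def u'_def v'_def)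
  have eq: "u * x + v = u' * x + v'" if "x \<in> cylinder l c" for x
    using g uv inv_branch_eq_branch[OF assms(1-3), of x] that br by (auto simp: cylinder_def)
  define x1 x2 where "x1 = branch l c 0" and "x2 = branch l c (1/2)"
  have x12: "x1 \<in> cylinder l c" "x2 \<in> cylinder l c"
    unfolding cylinder_eq_image[OF assms(1,4)] x1_def x2_def by auto
  have "x2 = (1/2) / real l ^ length c + x1" unfolding x1_def x2_def by (rule branch_affine)
  then have ne: "x1 \<noteq> x2" using assms(1) by simp
  have "(u - u') * (x1 - x2) = 0" using eq[OF x12(1)] eq[OF x12(2)] by (simp add: algebra_simps)
  then have "u = u'" using ne by simp
  moreover have "v = v'" using eq[OF x12(1)] \<open>u = u'\<close> by simp
  ultimately show "g = branch l (take j a)" using uv br by auto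
qed

lemma cylinder_star_bounds:
  assumes "l \<ge> 2" "c \<in> words l p" "x \<in> cylinder_star l c"
  shows "x \<in> {-1..2}" "\<bar>x - branch l c 0\<bar> \<le> 2 / real l ^ p"
proof -
  obtain s z where s: "s \<in> {-1, 0, 1}" and z: "z \<in> cylinder l c" "x = z + s / real l ^ p"
    using assms(2,3) unfolding cylinder_star_def words_def by blast
  obtain u where u: "0 \<le> u" "u < 1" "z = branch l c u"
    using z cylinder_eq_image[OF assms(1,2)] by auto
  have p: "length c = p" using assms by (simp add: words_def)
  have "real l ^ p \<ge> 1" using assms by simp
  then have lp: "real l ^ p > 0" "1 / real l ^ p \<le> 1" using assms(1) by (auto simp: divide_le_eq_1)
  have s1: "\<bar>s\<bar> / real l ^ p \<le> 1 / real l ^ p" using s lp by (intro divide_right_mono) auto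
  have z01: "0 \<le> z" "z < 1" using z by (auto simp: cylinder_def)
  have "\<bar>s / real l ^ p\<bar> = \<bar>s\<bar> / real l ^ p" by (simp add: abs_divide)
  then have "\<bar>s / real l ^ p\<bar> \<le> 1" using s1 lp(2) by linarith
  then show "x \<in> {-1..2}" unfolding z(2) abs_le_iff using z01 by auto
  have "x - branch l c 0 = (u + s) / real l ^ p"
    using z u branch_affine[of l c u] by (simp add: p add_divide_distrib)
  also have "\<bar>\<dots>\<bar> \<le> 2 / real l ^ p"
    using s u lp by (auto simp: abs_divide intro!: divide_right_mono)
  finally show "\<bar>x - branch l c 0\<bar> \<le> 2 / real l ^ p" .
qed

section \<open>Derivatives of the partial sums\<close>

text \<open>
  The derivative of \<open>S(\<cdot>, a)\<close> at \<open>x\<close>, as a function of \<open>f = \<phi>'\<close>. It is linear in \<open>f\<close>, which is what turns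
  the dependence on the parameters into an affine one.
\<close>

definition dS :: "nat \<Rightarrow> real ^ 'n ^ 'n \<Rightarrow> (real \<Rightarrow> real ^ 'n) \<Rightarrow> nat list \<Rightarrow> real \<Rightarrow> real ^ 'n" where
  "dS l A f a x =
     (\<Sum>j = 1..length a. (1 / real l ^ j) *\<^sub>R (matpow A (j - 1) *v f (branch l (take j a) x)))"

text \<open>
  Cutting a word into a prefix and a suffix: the suffix contributes the same kind of sum, started at
  the end point of the prefix and damped by \<open>A\<^sup>n / l\<^sup>n\<close>.
\<close>

lemma dS_append:
  "dS l A f (v @ b) x =
     dS l A f v x + (1 / real l ^ length v) *\<^sub>R (matpow A (length v) *v dS l A f b (branch l v x))"
proof -
  define m where "m = length v"
  define F where "F = (\<lambda>j. (1 / real l ^ j) *\<^sub>R (matpow A (j - 1) *v f (branch l (take j (v @ b)) x)))"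
  have split: "{1..length (v @ b)} = {1..m} \<union> {1 + m..length b + m}" by (auto simp: m_def)
  have "dS l A f (v @ b) x = sum F {1..m} + sum F {1 + m..length b + m}"
    unfolding dS_def F_def[symmetric] split by (intro sum.union_disjoint) auto
  also have "sum F {1..m} = dS l A f v x"
    unfolding dS_def F_def m_def by (intro sum.cong) auto
  also have "sum F {1 + m..length b + m} = (\<Sum>j = 1..length b. F (j + m))"
    by (rule sum.shift_bounds_cl_nat_ivl)
  also have "\<dots> = (1 / real l ^ m) *\<^sub>R (matpow A m *v dS l A f b (branch l v x))"
    unfolding dS_def F_def
    by (auto simp: linear_sum[OF matrix_vector_mul_linear] scaleR_sum_right m_def branch_append power_add
        matrix_vector_mult_scaleR matrix_vector_mul_assoc matpow_add[symmetric] Suc_diff_le add.commute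
        intro!: sum.cong)
  finally show ?thesis by (simp add: m_def)
qed

lemma dS_add: "dS l A (\<lambda>x. f x + g x) a x = dS l A f a x + dS l A g a x"
  by (simp add: dS_def matrix_vector_right_distrib scaleR_add_right sum.distrib)

lemma dS_scaleR: "dS l A (\<lambda>x. c *\<^sub>R f x) a x = c *\<^sub>R dS l A f a x"
  by (simp add: dS_def matrix_vector_mult_scaleR scaleR_sum_right)

lemma dS_zero: "dS l A (\<lambda>x. 0) a x = 0"
  by (simp add: dS_def)

lemma dS_sum: "dS l A (\<lambda>x. \<Sum>i\<in>I. g i x) a x = (\<Sum>i\<in>I. dS l A (g i) a x)"
  by (induction I rule: infinite_finite_induct) (simp_all add: dS_zero dS_add)

lemma dS_affine:
  "dS l A (\<lambda>x. f x + (\<Sum>i\<in>I. t i *\<^sub>R g i x)) a x = dS l A f a x + (\<Sum>i\<in>I. t i *\<^sub>R dS l A (g i) a x)"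
  by (simp add: dS_add dS_sum dS_scaleR)

lemma sum_geometric_le_1:
  assumes "l \<ge> (2::nat)"
  shows "(\<Sum>j = 1..n. 1 / real l ^ j) \<le> 1"
proof -
  have "(\<Sum>j = 1..n. 1 / real l ^ j) \<le> 1 - 1 / real l ^ n"
  proof (induction n)
    case (Suc n)
    have "1 / real l ^ Suc n + 1 / real l ^ Suc n \<le> 1 / real l ^ n"
      using assms by (simp add: field_simps)
    with Suc show ?case by simp
  qed simp
  moreover have "0 \<le> 1 / real l ^ n" by simp
  ultimately show ?thesis by linarith
qed

lemma norm_dS_le:
  assumes "l \<ge> 2" and A: "\<And>n v. norm (matpow A n *v v) \<le> C * norm v" and "C \<ge> 0" "B \<ge> 0"
    and f: "\<And>j. 1 \<le> j \<Longrightarrow> j \<le> length a \<Longrightarrow> norm (f (branch l (take j a) x)) \<le> B"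
  shows "norm (dS l A f a x) \<le> C * B"
proof -
  have "norm (dS l A f a x) \<le> (\<Sum>j = 1..length a. (1 / real l ^ j) * (C * B))"
    unfolding dS_def
  proof (intro sum_norm_le)
    fix j assume j: "j \<in> {1..length a}"
    have "norm (matpow A (j - 1) *v f (branch l (take j a) x)) \<le> C * norm (f (branch l (take j a) x))"
      by (rule A)
    also have "\<dots> \<le> C * B" using f[of j] j assms(3) by (intro mult_left_mono) auto
    finally show "norm ((1 / real l ^ j) *\<^sub>R (matpow A (j - 1) *v f (branch l (take j a) x)))
      \<le> (1 / real l ^ j) * (C * B)" by (simp add: divide_right_mono)
  qed
  also have "\<dots> = (\<Sum>j = 1..length a. 1 / real l ^ j) * (C * B)" by (simp add: sum_distrib_right)
  also have "\<dots> \<le> 1 * (C * B)"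
    using sum_geometric_le_1[OF assms(1)] assms by (intro mult_right_mono) auto
  finally show ?thesis by simp
qed

lemma dS_lipschitz:
  assumes "l \<ge> 2" and A: "\<And>n v. norm (matpow A n *v v) \<le> C * norm v" and "C \<ge> 0" "B \<ge> 0"
    and f: "\<And>x y. norm (f x - f y) \<le> B * \<bar>x - y\<bar>"
  shows "norm (dS l A f a x - dS l A f a y) \<le> C * B * \<bar>x - y\<bar>"
proof -
  have "norm (\<Sum>j = 1..length a. (1 / real l ^ j) *\<^sub>R
      (matpow A (j - 1) *v (f (branch l (take j a) x) - f (branch l (take j a) y))))
      \<le> (\<Sum>j = 1..length a. (1 / real l ^ j) * (C * (B * \<bar>x - y\<bar>)))"
  proof (intro sum_norm_le)
    fix j assume j: "j \<in> {1..length a}"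
    have "branch l (take j a) x - branch l (take j a) y = (x - y) / real l ^ j"
      using branch_take_affine[of j a l x] branch_take_affine[of j a l y] j by (simp add: diff_divide_distrib)
    then have "\<bar>branch l (take j a) x - branch l (take j a) y\<bar> = \<bar>x - y\<bar> / real l ^ j" by (simp add: abs_divide)
    also have "\<dots> \<le> \<bar>x - y\<bar> / 1" using assms(1) by (intro divide_left_mono) auto
    finally have d: "\<bar>branch l (take j a) x - branch l (take j a) y\<bar> \<le> \<bar>x - y\<bar>" by simp
    have "norm (matpow A (j - 1) *v (f (branch l (take j a) x) - f (branch l (take j a) y)))
      \<le> C * norm (f (branch l (take j a) x) - f (branch l (take j a) y))" by (rule A)
    also have "\<dots> \<le> C * (B * \<bar>x - y\<bar>)"
      using order_trans[OF f mult_left_mono[OF d]] assms by (intro mult_left_mono) auto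
    finally show "norm ((1 / real l ^ j) *\<^sub>R
      (matpow A (j - 1) *v (f (branch l (take j a) x) - f (branch l (take j a) y))))
      \<le> (1 / real l ^ j) * (C * (B * \<bar>x - y\<bar>))" by (simp add: divide_right_mono)
  qed
  also have "\<dots> = (\<Sum>j = 1..length a. 1 / real l ^ j) * (C * (B * \<bar>x - y\<bar>))" by (simp add: sum_distrib_right)
  also have "\<dots> \<le> 1 * (C * (B * \<bar>x - y\<bar>))"
    using sum_geometric_le_1[OF assms(1)] assms by (intro mult_right_mono) auto
  finally show ?thesis
    by (simp add: dS_def matrix_vector_mult_diff_distrib scaleR_diff_right sum_subtractf mult_ac)
qed

lemma vector_derivative_S_ext:
  assumes "l \<ge> 2" "a \<in> words l n" "c \<in> words l p"
    and \<phi>: "\<And>x. (\<phi> has_vector_derivative f x) (at x)"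
  shows "vector_derivative (S_ext l A \<phi> c a) (at x) = dS l A f a x"
proof (rule vector_derivative_at)
  have la: "length a = n" using assms by (simp add: words_def)
  have S: "S_ext l A \<phi> c a = (\<lambda>x. \<Sum>j = 1..length a. matpow A (j - 1) *v \<phi> (branch l (take j a) x))"
    using inv_branch_ext_eq_branch[OF assms(1,2) _ assms(3)] la by (auto simp: S_ext_def)
  have "((\<lambda>x. matpow A (j - 1) *v \<phi> (branch l (take j a) x)) has_vector_derivative
      (1 / real l ^ j) *\<^sub>R (matpow A (j - 1) *v f (branch l (take j a) x))) (at x)"
    if "j \<in> {1..length a}" for j
  proof -
    obtain v where v: "branch l (take j a) = (\<lambda>x. x / real l ^ j + v)"
    proof
      have "j \<le> length a" using \<open>j \<in> {1..length a}\<close> by simp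
      then show "branch l (take j a) = (\<lambda>x. x / real l ^ j + branch l (take j a) 0)"
        by (intro ext branch_take_affine)
    qed
    have "(branch l (take j a) has_vector_derivative 1 / real l ^ j) (at x)"
      unfolding v has_real_derivative_iff_has_vector_derivative[symmetric]
      using assms(1) by (auto intro!: derivative_eq_intros)
    from vector_diff_chain_at[OF this \<phi>]
    have "((\<lambda>x. \<phi> (branch l (take j a) x)) has_vector_derivative
      (1 / real l ^ j) *\<^sub>R f (branch l (take j a) x)) (at x)" by (simp add: o_def)
    from bounded_linear.has_vector_derivative[OF matrix_vector_mul_bounded_linear this]
    show ?thesis by (simp add: matrix_vector_mult_scaleR)
  qed
  then show "(S_ext l A \<phi> c a has_vector_derivative dS l A f a x) (at x)"
    unfolding S dS_def by (intro has_vector_derivative_sum) auto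
qed

section \<open>Backward orbits that do not interfere\<close>

text \<open>
  A norm on the circle, equivalent to the distance to the nearest integer. The addition formula of the
  sine makes it subadditive, and it is the quantity on which the bump functions below depend.
\<close>

definition circ :: "real \<Rightarrow> real" where "circ x = \<bar>sin (pi * x)\<bar>"

lemma circ_nonneg [simp]: "circ x \<ge> 0" and circ_le_1: "circ x \<le> 1"
  by (simp_all add: circ_def)

lemma circ_minus: "circ (- x) = circ x"
  by (simp add: circ_def)

lemma circ_diff_commute: "circ (x - y) = circ (y - x)"
  by (metis circ_minus minus_diff_eq)

lemma circ_add_le: "circ (x + y) \<le> circ x + circ y"
proof -
  have "\<bar>sin (pi * x) * cos (pi * y) + cos (pi * x) * sin (pi * y)\<bar>
      \<le> \<bar>sin (pi * x)\<bar> * \<bar>cos (pi * y)\<bar> + \<bar>cos (pi * x)\<bar> * \<bar>sin (pi * y)\<bar>"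
    by (metis abs_mult abs_triangle_ineq)
  also have "\<dots> \<le> \<bar>sin (pi * x)\<bar> * 1 + 1 * \<bar>sin (pi * y)\<bar>"
    by (intro add_mono mult_left_mono mult_right_mono) auto
  finally show ?thesis by (simp add: circ_def distrib_left sin_add)
qed

lemma circ_triangle: "circ (x - z) \<le> circ (x - y) + circ (y - z)"
  using circ_add_le[of "x - y" "y - z"] by simp

lemma circ_Ints: "n \<in> \<int> \<Longrightarrow> circ n = 0"
  by (auto simp: circ_def elim!: Ints_cases)

lemma circ_cong_Ints:
  assumes "x - y \<in> \<int>"
  shows "circ x = circ y"
  using circ_add_le[of y "x - y"] circ_add_le[of x "y - x"] circ_Ints[OF assms]
    circ_diff_commute[of x y] by simp

lemma circ_of_nat_mult: "circ (real n * x) \<le> real n * circ x"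
proof (induction n)
  case (Suc n)
  have "circ (real (Suc n) * x) \<le> circ (real n * x) + circ x"
    using circ_add_le[of "real n * x" x] by (simp add: algebra_simps)
  with Suc show ?case by (simp add: algebra_simps)
qed (simp add: circ_def)

lemma circ_le: "circ x \<le> 4 * \<bar>x\<bar>"
proof -
  have "circ x \<le> \<bar>pi * x\<bar>" unfolding circ_def by (rule abs_sin_x_le_abs_x)
  also have "\<dots> \<le> 4 * \<bar>x\<bar>" using pi_less_4 by (simp add: abs_mult mult_right_mono)
  finally show ?thesis .
qed

lemma circ_pos:
  assumes "x \<noteq> 0" "\<bar>x\<bar> < 1"
  shows "circ x > 0"
proof -
  have "sin (pi * \<bar>x\<bar>) > 0"
    using assms by (intro sin_gt_zero) auto
  moreover have "\<bar>sin (pi * x)\<bar> = \<bar>sin (pi * \<bar>x\<bar>)\<bar>" by (cases "x \<ge> 0") auto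
  ultimately show ?thesis by (simp add: circ_def)
qed

text \<open>
  A branch inverts the expanding map modulo 1.
\<close>

lemma branch_expand_Ints:
  assumes "l \<ge> 1"
  shows "real l ^ length w * branch l w x - x \<in> \<int>"
proof (induction w rule: rev_induct)
  case (snoc k w)
  have "real l ^ length (w @ [k]) * branch l (w @ [k]) x - x
     = (real l ^ length w * branch l w x - x) + of_int (int l ^ length w * (int k - 1))"
    using assms by (simp add: branch_snoc field_simps)
  then show ?case using snoc by (metis Ints_add Ints_of_int)
qed simp

lemma branch_take_expand_Ints:
  assumes "l \<ge> 1" "m + i \<le> length a"
  shows "real l ^ i * branch l (take (m + i) a) x - branch l (take m a) x \<in> \<int>"
proof -
  have "length (take i (drop m a)) = i" using assms by simp
  then show ?thesis
    using branch_expand_Ints[OF assms(1), of "take i (drop m a)" "branch l (take m a) x"]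
    by (simp add: take_add branch_append)
qed

lemma branch_inj:
  assumes "l \<ge> 2" "v \<in> words l n" "w \<in> words l n" "branch l v 0 = branch l w 0"
  shows "v = w"
  using assms(2-4)
proof (induction v arbitrary: n w rule: rev_induct)
  case Nil
  then show ?case by (simp add: words_def)
next
  case (snoc k v)
  then obtain k' w' where w: "w = w' @ [k']" by (cases w rule: rev_cases) (auto simp: words_def)
  have vw: "v \<in> words l (length v)" "w' \<in> words l (length v)"
    using snoc.prems w by (auto simp: words_def)
  have v01: "branch l u 0 \<in> {0..<1}" if "u \<in> words l (length v)" for u
    using cylinder_iff_branch[OF assms(1) that, of "branch l u 0" 0] by (auto simp: cylinder_def)
  have "branch l v 0 + real k = branch l w' 0 + real k'"
    using snoc.prems(3) assms(1) unfolding w by (simp add: branch_snoc)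
  moreover from this have "\<bar>real k - real k'\<bar> < 1" using v01[OF vw(1)] v01[OF vw(2)] by auto
  then have "k = k'" by linarith
  ultimately show ?case using snoc.IH[OF vw] w by simp
qed

text \<open>
  Preimages of the same point and the same generation differ by a nonzero multiple of \<open>l^(-n)\<close>
  that does not depend on the point; a minimum over finitely many pairs of words gives \<open>\<gamma>\<close>.
\<close>

lemma branch_separation:
  assumes "l \<ge> 2"
  obtains \<gamma> where "\<gamma> > 0"
    "\<And>v w y. v \<in> words l n \<Longrightarrow> w \<in> words l n \<Longrightarrow> v \<noteq> w \<Longrightarrow> \<gamma> \<le> circ (branch l v y - branch l w y)"
proof
  define S where "S = insert 1 ((\<lambda>(v, w). circ (branch l v 0 - branch l w 0)) `
    {(v, w) \<in> words l n \<times> words l n. v \<noteq> w})"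
  have "finite {(v, w) \<in> words l n \<times> words l n. v \<noteq> w}"
    by (rule finite_subset[of _ "words l n \<times> words l n"]) auto
  then have fin: "finite S" by (simp add: S_def)
  have pos: "circ (branch l v 0 - branch l w 0) > 0"
    if "v \<in> words l n" "w \<in> words l n" "v \<noteq> w" for v w
  proof (rule circ_pos)
    have "branch l u 0 \<in> {0..<1}" if "u \<in> words l n" for u
      using cylinder_iff_branch[OF assms that, of "branch l u 0" 0] by (auto simp: cylinder_def)
    from this[OF that(1)] this[OF that(2)] show "\<bar>branch l v 0 - branch l w 0\<bar> < 1" by auto
    show "branch l v 0 - branch l w 0 \<noteq> 0" using branch_inj[OF assms] that by auto
  qed
  show "Min S > 0" using fin pos by (auto simp: S_def)
  fix v w y assume vw: "v \<in> words l n" "w \<in> words l n" "v \<noteq> w"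
  have "branch l v y - branch l w y = branch l v 0 - branch l w 0"
    using branch_affine[of l v y] branch_affine[of l w y] vw by (simp add: words_def)
  then show "Min S \<le> circ (branch l v y - branch l w y)"
    using vw fin by (intro Min_le) (auto simp: S_def)
qed

text \<open>
  The average in-degree equals the average out-degree, so some vertex has at most \<open>T\<close> neighbours on
  either side. Taking it and discarding its neighbours costs at most \<open>2 T + 1\<close> vertices.
\<close>

lemma sparse_digraph_independent_set:
  assumes "finite V" "\<And>i. i \<in> V \<Longrightarrow> card {j \<in> V. E i j} \<le> T" "k * (2 * T + 1) \<le> card V"
  shows "\<exists>J\<subseteq>V. card J = k \<and> (\<forall>i\<in>J. \<forall>j\<in>J. i \<noteq> j \<longrightarrow> \<not> E i j)"
  using assms
proof (induction k arbitrary: V)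
  case 0
  then show ?case by (intro exI[of _ "{}"]) auto
next
  case (Suc k)
  have "card V > 0" using Suc.prems(3) by (cases "card V") auto
  have "\<exists>j\<in>V. card {i \<in> V. E i j} \<le> T"
  proof (rule ccontr)
    assume "\<not> ?thesis"
    then have "(\<Sum>j\<in>V. T) < (\<Sum>j\<in>V. card {i \<in> V. E i j})"
      using Suc.prems(1) \<open>card V > 0\<close> by (intro sum_strict_mono) (auto simp: not_le)
    also have "\<dots> = (\<Sum>i\<in>V. card {j \<in> V. E i j})"
    proof -
      have c: "card {i \<in> V. P i} = (\<Sum>i\<in>V. if P i then 1 else 0)" for P :: "'a \<Rightarrow> bool"
        using Suc.prems(1) by (simp add: sum.inter_filter[symmetric])
      show ?thesis unfolding c by (rule sum.swap)
    qed
    also have "\<dots> \<le> (\<Sum>i\<in>V. T)" using Suc.prems(2) by (intro sum_mono)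
    finally show False by simp
  qed
  then obtain j where j: "j \<in> V" "card {i \<in> V. E i j} \<le> T" by blast
  define R where "R = insert j ({i \<in> V. E i j} \<union> {i \<in> V. E j i})"
  have "card R \<le> Suc (card ({i \<in> V. E i j} \<union> {i \<in> V. E j i}))"
    unfolding R_def by (rule card_insert_le_m1) auto
  also have "card ({i \<in> V. E i j} \<union> {i \<in> V. E j i}) \<le> card {i \<in> V. E i j} + card {i \<in> V. E j i}"
    by (rule card_Un_le)
  finally have "card R \<le> 2 * T + 1" using j Suc.prems(2)[OF j(1)] by simp
  moreover have "R \<subseteq> V" using j by (auto simp: R_def)
  ultimately have cR: "k * (2 * T + 1) \<le> card (V - R)"
    using Suc.prems(1,3) by (simp add: card_Diff_subset finite_subset)
  have "card {j' \<in> V - R. E i j'} \<le> T" if "i \<in> V - R" for i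
    using Suc.prems(1) that by (intro order_trans[OF card_mono Suc.prems(2)[of i]]) auto
  from Suc.IH[OF _ this cR] Suc.prems(1) obtain J where
    J: "J \<subseteq> V - R" "card J = k" "\<forall>i\<in>J. \<forall>j\<in>J. i \<noteq> j \<longrightarrow> \<not> E i j" by auto
  have "finite J" using J(1) Suc.prems(1) finite_subset by blast
  moreover have "j \<notin> J" using J by (auto simp: R_def)
  ultimately have "card (insert j J) = Suc k" using J by simp
  moreover have "\<forall>i\<in>insert j J. \<forall>j'\<in>insert j J. i \<noteq> j' \<longrightarrow> \<not> E i j'"
    using J by (auto simp: R_def)
  moreover have "insert j J \<subseteq> V" using J j by auto
  ultimately show ?case by blast
qed

lemma card_UN_subsingletons:
  assumes "\<And>m. m \<in> {1..T::nat} \<Longrightarrow> \<forall>x\<in>S m. \<forall>y\<in>S m. x = y" "\<And>m. finite (S m)"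
  shows "card (\<Union>m\<in>{1..T}. S m) \<le> T"
proof -
  have "card (\<Union>m\<in>{1..T}. S m) \<le> (\<Sum>m\<in>{1..T}. card (S m))" by (intro card_UN_le) simp
  also have "\<dots> \<le> (\<Sum>m\<in>{1..T}. 1)"
    using assms by (intro sum_mono) (simp add: card_le_Suc0_iff_eq)
  finally show ?thesis by simp
qed

text \<open>
  Let \<open>X i m\<close> be the \<open>m\<close>-th point of the backward orbit of \<open>y\<close> along \<open>i\<close>. A bump placed at \<open>X j N\<close> should be
  felt by the word \<open>j\<close> at time \<open>N\<close> and by nothing else up to time \<open>T\<close>. This fails for some words when \<open>y\<close> is
  close to a periodic point, since backward orbits can follow the cycle for different lengths of
  time before leaving it in the same way. So words have to be discarded, for two reasons.

  A word is unusable by itself if its orbit returns near \<open>X j N\<close>. If the return time is \<open>p\<close>, then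
  \<open>X j N\<close> is almost fixed by the \<open>p\<close>-th iterate of the expanding map, hence also by the iterate of order
  \<open>p N\<close>, which sends it to \<open>l^(pN-N) y\<close> modulo 1. This determines \<open>X j N\<close>, so each of the \<open>T\<close> possible return
  times spoils at most one word.

  Among the remaining words, each of the \<open>T\<close> points \<open>X i m\<close> is close to at most one \<open>X j N\<close>. The relation
  that \<open>i\<close> disturbs \<open>j\<close> therefore has out-degree at most \<open>T\<close>, and an independent set is as required.
\<close>

lemma exists_noninterfering_words:
  fixes l :: nat
  assumes l: "l \<ge> 2" and N: "1 \<le> N" "N \<le> T" "T \<le> n"
    and \<gamma>: "\<And>v w y. v \<in> words l N \<Longrightarrow> w \<in> words l N \<Longrightarrow> v \<noteq> w \<Longrightarrow> \<gamma> \<le> circ (branch l v y - branch l w y)"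
    and \<epsilon>: "\<epsilon> > 0" "4 * real l ^ (T * N + T) * \<epsilon> \<le> \<gamma>"
    and V: "V \<subseteq> words l n" "inj_on (take N) V" "T + k * (2 * T + 1) \<le> card V"
  shows "\<exists>J\<subseteq>V. card J = k \<and> (\<forall>i\<in>J. \<forall>j\<in>J. \<forall>m\<in>{1..T}.
    circ (branch l (take m i) y - branch l (take N j) y) < \<epsilon> \<longrightarrow> i = j \<and> m = N)"
proof -
  define X where "X = (\<lambda>i m. branch l (take m i) y)"
  have finV: "finite V" using V(1) finite_subset finite_words by blast
  have len: "length i = n" if "i \<in> V" for i using that V(1) by (auto simp: words_def)
  have l1: "l \<ge> 1" using l by simp
  have lpow: "real l ^ i \<ge> 1" for i using l by simp
  have sep: "i = j" if "i \<in> V" "j \<in> V" "circ (X i N - z) + circ (X j N - z) < \<gamma>" for i j z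
  proof (rule ccontr)
    assume "i \<noteq> j"
    then have "take N i \<noteq> take N j" using V(2) that by (auto dest: inj_onD)
    then have "\<gamma> \<le> circ (X i N - X j N)"
      unfolding X_def using that V(1) N by (intro \<gamma> words_take[of _ l n]) auto
    also have "\<dots> \<le> circ (X i N - z) + circ (X j N - z)"
      using circ_triangle[of "X i N" "X j N" z] circ_diff_commute[of z "X j N"] by simp
    finally show False using that by simp
  qed
  have "4 * 1 * \<epsilon> \<le> 4 * real l ^ (T * N + T) * \<epsilon>"
    using \<epsilon>(1) lpow by (intro mult_right_mono mult_left_mono) auto
  then have \<epsilon>4: "4 * \<epsilon> \<le> \<gamma>" using \<epsilon>(2) by simp
  define P where "P = (\<lambda>p. {j \<in> V. circ ((real l ^ p - 1) * X j N) \<le> real l ^ T * \<epsilon>})"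
  define V' where "V' = V - (\<Union>p\<in>{1..T}. P p)"
  have P1: "\<forall>i\<in>P p. \<forall>j\<in>P p. i = j" if p: "p \<in> {1..T}" for p
  proof -
    \<comment> \<open>geometric sum: \<open>l^(pN) - 1 = s (l\<^sup>p - 1)\<close> with an integer \<open>s\<close>, so almost fixed by one iterate implies almost fixed by its powers\<close>
    define s where "s = (\<Sum>i<N. (l ^ p) ^ i)"
    have s1: "(real l ^ p) ^ N - 1 = real s * (real l ^ p - 1)"
      using power_diff_1_eq[of "real l ^ p" N] by (simp add: s_def mult.commute)
    have "real l ^ p - 1 \<ge> 1"
    proof -
      have "real l ^ 1 \<le> real l ^ p" using p l by (intro power_increasing) auto
      moreover have "real l \<ge> 2" using l by simp
      ultimately show ?thesis unfolding power_one_right by linarith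
    qed
    then have "real s * 1 \<le> real s * (real l ^ p - 1)" by (intro mult_left_mono) auto
    then have s2: "real s \<le> real l ^ (T * N)"
    proof -
      have "real s \<le> (real l ^ p) ^ N" using s1 \<open>real s * 1 \<le> _\<close> by simp
      also have "\<dots> = real l ^ (p * N)" by (simp add: power_mult)
      also have "\<dots> \<le> real l ^ (T * N)" using p l by (intro power_increasing) auto
      finally show ?thesis .
    qed
    have pN: "p * N \<ge> N" using p by simp
    define z where "z = real l ^ (p * N - N) * y"
    have close: "circ (X j N - z) < \<gamma> / 2" if j: "j \<in> P p" for j
    proof -
      have "real l ^ N * X j N - y \<in> \<int>"
        using branch_take_expand_Ints[OF l1, of 0 N j y] j N len[of j] by (auto simp: P_def X_def)
      then have "real_of_int (int l ^ (p * N - N)) * (real l ^ N * X j N - y) \<in> \<int>"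
        by (intro Ints_mult) auto
      also have "real_of_int (int l ^ (p * N - N)) * (real l ^ N * X j N - y) = (real l ^ p) ^ N * X j N - z"
        using pN by (simp add: z_def right_diff_distrib mult.assoc[symmetric] power_add[symmetric] power_mult[symmetric])
      finally have i: "(real l ^ p) ^ N * X j N - z \<in> \<int>" .
      have "circ (X j N - z) = circ (X j N - (real l ^ p) ^ N * X j N)"
        using i by (intro circ_cong_Ints) (simp add: algebra_simps)
      also have "\<dots> = circ (real s * ((real l ^ p - 1) * X j N))"
        unfolding mult.assoc[symmetric] s1[symmetric]
        using circ_diff_commute[of "X j N" "(real l ^ p) ^ N * X j N"] by (simp add: left_diff_distrib)
      also have "\<dots> \<le> real s * circ ((real l ^ p - 1) * X j N)" by (rule circ_of_nat_mult)
      also have "\<dots> \<le> real l ^ (T * N) * (real l ^ T * \<epsilon>)"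
        using j s2 by (intro mult_mono) (auto simp: P_def)
      also have "\<dots> = (4 * real l ^ (T * N + T) * \<epsilon>) / 4" by (simp add: power_add)
      also have "\<dots> < \<gamma> / 2" using \<epsilon> \<epsilon>4 by simp
      finally show ?thesis .
    qed
    show ?thesis
    proof (intro ballI)
      fix i j assume "i \<in> P p" "j \<in> P p"
      then show "i = j" using sep[of i j z] close[of i] close[of j] by (auto simp: P_def)
    qed
  qed
  have finP: "finite (P p)" for p using finV by (simp add: P_def)
  have "card (\<Union>p\<in>{1..T}. P p) \<le> T" by (rule card_UN_subsingletons[OF P1 finP])
  moreover have "(\<Union>p\<in>{1..T}. P p) \<subseteq> V" by (auto simp: P_def)
  ultimately have cV': "k * (2 * T + 1) \<le> card V'"
    using V(3) finV unfolding V'_def by (subst card_Diff_subset) (auto simp: finite_subset)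
  define E where "E = (\<lambda>i j. \<exists>m\<in>{1..T}. circ (X i m - X j N) < \<epsilon>)"
  have deg: "card {j \<in> V'. E i j} \<le> T" if "i \<in> V'" for i
  proof -
    have "{j \<in> V'. E i j} = (\<Union>m\<in>{1..T}. {j \<in> V'. circ (X i m - X j N) < \<epsilon>})"
      by (auto simp: E_def)
    also have "card \<dots> \<le> T"
    proof (rule card_UN_subsingletons)
      fix m
      show "\<forall>x\<in>{j \<in> V'. circ (X i m - X j N) < \<epsilon>}. \<forall>y\<in>{j \<in> V'. circ (X i m - X j N) < \<epsilon>}. x = y"
      proof (intro ballI)
        fix a b assume "a \<in> {j \<in> V'. circ (X i m - X j N) < \<epsilon>}" "b \<in> {j \<in> V'. circ (X i m - X j N) < \<epsilon>}"
        then have "a \<in> V" "b \<in> V" "circ (X a N - X i m) < \<epsilon>" "circ (X b N - X i m) < \<epsilon>"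
          by (auto simp: V'_def circ_diff_commute[of "X i m"])
        then show "a = b" using \<epsilon>4 \<epsilon>(1) by (intro sep[where z = "X i m"]) auto
      qed
    qed (use finV in \<open>auto simp: V'_def\<close>)
    finally show ?thesis .
  qed
  have finV': "finite V'" using finV by (simp add: V'_def)
  have "\<exists>J\<subseteq>V'. card J = k \<and> (\<forall>i\<in>J. \<forall>j\<in>J. i \<noteq> j \<longrightarrow> \<not> E i j)"
    by (rule sparse_digraph_independent_set[OF finV' deg cV'])
  then obtain J where J: "J \<subseteq> V'" "card J = k" "\<forall>i\<in>J. \<forall>j\<in>J. i \<noteq> j \<longrightarrow> \<not> E i j"
    by (elim exE conjE)
  have self: "m = N" if j: "j \<in> V'" "m \<in> {1..T}" "circ (X j m - X j N) < \<epsilon>" for j m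
  proof (rule ccontr)
    assume "m \<noteq> N"
    define p where "p = (if m < N then N - m else m - N)"
    have p: "p \<in> {1..T}" using \<open>m \<noteq> N\<close> j(2) N by (auto simp: p_def)
    have jV: "j \<in> V" "j \<notin> P p" using j p by (auto simp: V'_def)
    have "circ ((real l ^ p - 1) * X j N) \<le> real l ^ T * \<epsilon>"
    proof (cases "m < N")
      case True
      then have "real l ^ p * X j N - X j m \<in> \<int>"
        using branch_take_expand_Ints[OF l1, of m p j y] len[OF jV(1)] N by (simp add: X_def p_def)
      then have "circ ((real l ^ p - 1) * X j N) = circ (X j m - X j N)"
        by (intro circ_cong_Ints) (simp add: algebra_simps)
      also have "\<dots> \<le> 1 * \<epsilon>" using j by simp
      also have "\<dots> \<le> real l ^ T * \<epsilon>" using lpow \<epsilon>(1) by (intro mult_right_mono) auto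
      finally show ?thesis .
    next
      case False
      then have "real l ^ p * X j m - X j N \<in> \<int>"
        using branch_take_expand_Ints[OF l1, of N p j y] len[OF jV(1)] N j(2) by (simp add: X_def p_def)
      then have "circ ((real l ^ p - 1) * X j N) = circ (real l ^ p * X j N - real l ^ p * X j m)"
        by (intro circ_cong_Ints) (simp add: algebra_simps)
      also have "\<dots> = circ (real (l ^ p) * (X j N - X j m))" by (simp add: algebra_simps)
      also have "\<dots> \<le> real (l ^ p) * circ (X j N - X j m)" by (rule circ_of_nat_mult)
      also have "\<dots> \<le> real l ^ T * \<epsilon>"
        using j p l circ_diff_commute[of "X j N" "X j m"]
        by (intro mult_mono) (auto intro!: power_increasing)
      finally show ?thesis .
    qed
    then show False using jV by (simp add: P_def)
  qed
  have "i = j \<and> m = N" if "i \<in> J" "j \<in> J" "m \<in> {1..T}" "circ (X i m - X j N) < \<epsilon>" for i j m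
  proof
    have "E i j" using that unfolding E_def by blast
    then show "i = j" using J(3) that by blast
    then show "m = N" using self[of j m] that J(1) by blast
  qed
  moreover have "J \<subseteq> V" using J by (auto simp: V'_def)
  ultimately show ?thesis using J(2) unfolding X_def by blast
qed

section \<open>Bump functions\<close>

text \<open>
  A trigonometric polynomial whose derivative is concentrated at \<open>z\<close>. The factor raised to the power \<open>L\<close> is
  \<open>cos\<^sup>2 (\<pi> (x - z))\<close>, which is close to 1 at \<open>z\<close> and exponentially small in \<open>L\<close> elsewhere. The derivative need
  not vanish away from \<open>z\<close>, but it is uniformly small, which is what diagonal dominance asks for.
\<close>

definition bump :: "nat \<Rightarrow> real \<Rightarrow> real \<Rightarrow> real" where
  "bump L z x = sin (2 * pi * (x - z)) * ((1 + cos (2 * pi * (x - z))) / 2) ^ L"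

definition bump' :: "nat \<Rightarrow> real \<Rightarrow> real \<Rightarrow> real" where
  "bump' L z x = 2 * pi * (1 - circ (x - z) ^ 2) ^ L * (1 - 2 * circ (x - z) ^ 2 - 2 * real L * circ (x - z) ^ 2)"

lemma bump_has_derivative: "(bump L z has_real_derivative bump' L z x) (at x)"
proof -
  define \<theta> where "\<theta> = 2 * pi * (x - z)"
  define c where "c = (1 + cos \<theta>) / 2"
  have cs: "circ (x - z) ^ 2 = 1 - c"
    using cos_double_sin[of "pi * (x - z)"] by (simp add: circ_def c_def \<theta>_def mult.assoc field_simps)
  have cos: "cos \<theta> = 2 * c - 1" by (simp add: c_def field_simps)
  have "sin \<theta> * sin \<theta> = 1 - (cos \<theta>)\<^sup>2"
    using sin_squared_eq[of \<theta>] by (simp add: power2_eq_square)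
  also have "\<dots> = 4 * c * (1 - c)" by (simp add: cos power2_eq_square algebra_simps)
  finally have ss: "sin \<theta> * sin \<theta> = 4 * c * (1 - c)" .
  have d: "(bump L z has_real_derivative
      (cos \<theta> * (2 * pi)) * c ^ L + sin \<theta> * (real L * c ^ (L - 1) * (- sin \<theta> * (2 * pi) / 2))) (at x)"
    unfolding bump_def[abs_def] \<theta>_def c_def
    by (auto intro!: derivative_eq_intros)
  have "sin \<theta> * (real L * c ^ (L - 1) * (- sin \<theta> * (2 * pi) / 2)) = - pi * real L * c ^ (L - 1) * (sin \<theta> * sin \<theta>)"
    by simp
  also have "\<dots> = - pi * real L * (c ^ (L - 1) * c) * (4 * (1 - c))" by (simp add: ss)
  also have "\<dots> = - pi * real L * c ^ L * (4 * (1 - c))" by (cases L) simp_all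
  finally have "(cos \<theta> * (2 * pi)) * c ^ L + sin \<theta> * (real L * c ^ (L - 1) * (- sin \<theta> * (2 * pi) / 2)) = bump' L z x"
    by (simp add: bump'_def cs cos algebra_simps)
  with d show ?thesis by simp
qed

lemma circ_sq_bounds: "0 \<le> circ x ^ 2" "circ x ^ 2 \<le> 1"
  using circ_le_1[of x] by (simp_all add: power_le_one)

text \<open>
  Uniform in \<open>L\<close>: the term that carries the factor \<open>L\<close> is tamed by
  \<open>(1 - q)\<^sup>L (1 + L q) \<le> (1 - q)\<^sup>L (1 + q)\<^sup>L \<le> 1\<close>, with \<open>q = sin\<^sup>2 (\<pi> (x - z))\<close>.
\<close>

lemma abs_bump'_le: "\<bar>bump' L z x\<bar> \<le> 6 * pi"
proof -
  define q where "q = circ (x - z) ^ 2"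
  have q: "0 \<le> q" "q \<le> 1" using circ_sq_bounds[of "x - z"] by (simp_all add: q_def)
  have c1: "(1 - q) ^ L \<le> 1" "0 \<le> (1 - q) ^ L" using q by (auto intro: power_le_one)
  have "(1 - q) ^ L * (1 + real L * q) \<le> (1 - q) ^ L * (1 + q) ^ L"
    using q c1 Bernoulli_inequality[of q L] by (intro mult_left_mono) auto
  also have "\<dots> = (1 - q\<^sup>2) ^ L"
    by (simp add: power_mult_distrib[symmetric] power2_eq_square algebra_simps)
  also have "\<dots> \<le> 1" using q by (intro power_le_one) (auto simp: power_le_one)
  finally have b: "(1 - q) ^ L * (real L * q) \<le> 1" using c1 by (simp add: distrib_left)
  have "\<bar>(1 - q) ^ L * (1 - 2 * q - 2 * real L * q)\<bar>
      \<le> \<bar>(1 - q) ^ L * (1 - 2 * q)\<bar> + 2 * ((1 - q) ^ L * (real L * q))"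
  proof -
    have "(1 - q) ^ L * (1 - 2 * q - 2 * real L * q)
        = (1 - q) ^ L * (1 - 2 * q) - 2 * ((1 - q) ^ L * (real L * q))" by (simp add: algebra_simps)
    moreover have "0 \<le> (1 - q) ^ L * (real L * q)" using c1 q by simp
    ultimately show ?thesis by linarith
  qed
  also have "\<bar>(1 - q) ^ L * (1 - 2 * q)\<bar> \<le> 1 * 1"
    unfolding abs_mult using q c1 by (intro mult_mono) auto
  finally have "\<bar>(1 - q) ^ L * (1 - 2 * q - 2 * real L * q)\<bar> \<le> 3" using b by simp
  then have "2 * pi * \<bar>(1 - q) ^ L * (1 - 2 * q - 2 * real L * q)\<bar> \<le> 2 * pi * 3"
    by (intro mult_left_mono) auto
  then show ?thesis unfolding bump'_def q_def[symmetric] by (simp add: abs_mult mult.assoc)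
qed

lemma bump'_near:
  assumes "real L * circ (x - z) ^ 2 \<le> 1 / 16" "circ (x - z) ^ 2 \<le> 1 / 16"
  shows "pi \<le> bump' L z x"
proof -
  define q where "q = circ (x - z) ^ 2"
  have q: "0 \<le> q" "q \<le> 1 / 16" "real L * q \<le> 1 / 16" using assms by (auto simp: q_def)
  have "1 + real L * (- q) \<le> (1 + (- q)) ^ L" using q by (intro Bernoulli_inequality) auto
  then have "15 / 16 \<le> (1 - q) ^ L" using q by simp
  moreover have "3 / 4 \<le> 1 - 2 * q - 2 * real L * q" using q by simp
  ultimately have "15 / 16 * (3 / 4) \<le> (1 - q) ^ L * (1 - 2 * q - 2 * real L * q)"
    by (intro mult_mono) auto
  then have "2 * pi * (1 / 2) \<le> 2 * pi * ((1 - q) ^ L * (1 - 2 * q - 2 * real L * q))"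
    by (intro mult_left_mono) auto
  then show ?thesis unfolding bump'_def q_def[symmetric] by (simp add: mult.assoc)
qed

lemma bump'_far:
  assumes "e \<le> circ (x - z)" "0 \<le> e"
  shows "\<bar>bump' L z x\<bar> \<le> 2 * pi * (1 - e\<^sup>2) ^ L * (1 + 2 * real L)"
proof -
  define q where "q = circ (x - z) ^ 2"
  have q: "0 \<le> q" "q \<le> 1" using circ_sq_bounds[of "x - z"] by (simp_all add: q_def)
  have eq: "e\<^sup>2 \<le> q" unfolding q_def using assms by (intro power_mono)
  have "real L * q \<le> real L * 1" using q by (intro mult_left_mono) auto
  moreover have "0 \<le> real L * q" using q by simp
  ultimately have "\<bar>1 - 2 * q - 2 * real L * q\<bar> \<le> 1 + 2 * real L" using q by linarith
  moreover have "(1 - q) ^ L \<le> (1 - e\<^sup>2) ^ L" using eq q by (intro power_mono) auto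
  ultimately have "(1 - q) ^ L * \<bar>1 - 2 * q - 2 * real L * q\<bar> \<le> (1 - e\<^sup>2) ^ L * (1 + 2 * real L)"
    using q eq by (intro mult_mono) auto
  then have "2 * pi * ((1 - q) ^ L * \<bar>1 - 2 * q - 2 * real L * q\<bar>) \<le> 2 * pi * ((1 - e\<^sup>2) ^ L * (1 + 2 * real L))"
    by (intro mult_left_mono) auto
  then show ?thesis unfolding bump'_def q_def[symmetric] using q by (simp add: abs_mult mult.assoc)
qed

lemma exists_concentrated_bump:
  assumes "0 < e" "e \<le> 1" "0 < \<theta>"
  shows "\<exists>L. 2 * pi * (1 - e\<^sup>2) ^ L * (1 + 2 * real L) < \<theta>"
proof -
  define q where "q = 1 - e\<^sup>2"
  have "e\<^sup>2 \<le> 1" using assms by (simp add: power_le_one)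
  then have q: "norm q < 1" using assms by (simp add: q_def abs_if)
  have "(\<lambda>L. 2 * pi * q ^ L + 4 * pi * (of_nat L * q ^ L)) \<longlonglongrightarrow> 2 * pi * 0 + 4 * pi * 0"
    using q by (intro tendsto_add tendsto_mult tendsto_const LIMSEQ_power_zero powser_times_n_limit_0)
  then have "(\<lambda>L. 2 * pi * q ^ L * (1 + 2 * real L)) \<longlonglongrightarrow> 0" by (simp add: algebra_simps)
  then have "eventually (\<lambda>L. 2 * pi * q ^ L * (1 + 2 * real L) < \<theta>) sequentially"
    using assms(3) by (rule order_tendstoD)
  then show ?thesis unfolding q_def by (auto simp: eventually_sequentially)
qed

section \<open>Smoothness of trigonometric polynomials\<close>

text \<open>
  An algebra of periodic functions that is closed under differentiation.
\<close>

inductive_set trig_alg :: "real \<Rightarrow> (real \<Rightarrow> real) set" for z where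
  const: "(\<lambda>x. c) \<in> trig_alg z"
| sin: "(\<lambda>x. sin (2 * pi * (x - z))) \<in> trig_alg z"
| cos: "(\<lambda>x. cos (2 * pi * (x - z))) \<in> trig_alg z"
| add: "f \<in> trig_alg z \<Longrightarrow> g \<in> trig_alg z \<Longrightarrow> (\<lambda>x. f x + g x) \<in> trig_alg z"
| mult: "f \<in> trig_alg z \<Longrightarrow> g \<in> trig_alg z \<Longrightarrow> (\<lambda>x. f x * g x) \<in> trig_alg z"

lemma trig_alg_power: "f \<in> trig_alg z \<Longrightarrow> (\<lambda>x. f x ^ n) \<in> trig_alg z"
  by (induction n) (auto intro: trig_alg.intros)

lemma bump_in_trig_alg: "bump L z \<in> trig_alg z"
proof -
  have "(\<lambda>x. 1 / 2 + 1 / 2 * cos (2 * pi * (x - z))) \<in> trig_alg z"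
    by (intro trig_alg.intros)
  from trig_alg.mult[OF trig_alg.sin trig_alg_power[OF this]]
  show ?thesis by (simp add: bump_def[abs_def] add_divide_distrib)
qed

lemma trig_alg_derivative:
  assumes "f \<in> trig_alg z"
  shows "\<exists>g\<in>trig_alg z. \<forall>x. (f has_real_derivative g x) (at x)"
  using assms
proof induction
  case (const c)
  then show ?case by (intro bexI[of _ "\<lambda>x. 0"]) (auto intro: trig_alg.const)
next
  case sin
  show ?case
    by (intro bexI[of _ "\<lambda>x. (2 * pi) * cos (2 * pi * (x - z))"] allI trig_alg.intros)
       (auto intro!: derivative_eq_intros)
next
  case cos
  show ?case
    by (intro bexI[of _ "\<lambda>x. (- 2 * pi) * sin (2 * pi * (x - z))"] allI trig_alg.intros)
       (auto intro!: derivative_eq_intros)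
next
  case (add f g)
  then obtain f' g' where "f' \<in> trig_alg z" "g' \<in> trig_alg z"
    "\<And>x. (f has_real_derivative f' x) (at x)" "\<And>x. (g has_real_derivative g' x) (at x)" by blast
  then show ?case
    by (intro bexI[of _ "\<lambda>x. f' x + g' x"]) (auto intro!: derivative_eq_intros trig_alg.intros)
next
  case (mult f g)
  then obtain f' g' where "f' \<in> trig_alg z" "g' \<in> trig_alg z"
    "\<And>x. (f has_real_derivative f' x) (at x)" "\<And>x. (g has_real_derivative g' x) (at x)" by blast
  with mult show ?case
    by (intro bexI[of _ "\<lambda>x. f x * g' x + f' x * g x"])
       (auto intro!: derivative_eq_intros trig_alg.intros)
qed

lemma trig_alg_periodic: "f \<in> trig_alg z \<Longrightarrow> f (x + 1) = f x"
proof (induction rule: trig_alg.induct)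
  have "2 * pi * (x + 1 - z) = 2 * pi * (x - z) + 2 * pi" by (simp add: algebra_simps)
  note e = this
  case sin show ?case unfolding e by simp
next
  have "2 * pi * (x + 1 - z) = 2 * pi * (x - z) + 2 * pi" by (simp add: algebra_simps)
  note e = this
  case cos show ?case unfolding e by simp
qed simp_all

lemma nth_vderiv_0 [simp]: "nth_vderiv 0 f = f"
  and nth_vderiv_Suc: "nth_vderiv (Suc k) f = (\<lambda>x. vector_derivative (nth_vderiv k f) (at x))"
  by (simp_all add: nth_vderiv_def)

lemma trig_alg_scaleR_in_Cinf:
  assumes "f \<in> trig_alg z"
  shows "(\<lambda>x. f x *\<^sub>R v) \<in> Cinf_circle"
proof -
  have scale: "((\<lambda>x. f x *\<^sub>R v) has_vector_derivative g x *\<^sub>R v) (at x)"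
    if "\<forall>x. (f has_real_derivative g x) (at x)" for f g x
  proof -
    have "(f has_vector_derivative g x) (at x)"
      using that by (simp add: has_real_derivative_iff_has_vector_derivative)
    from bounded_linear.has_vector_derivative[OF bounded_linear_scaleR_left this] show ?thesis .
  qed
  have nth: "\<exists>g\<in>trig_alg z. nth_vderiv k (\<lambda>x. f x *\<^sub>R v) = (\<lambda>x. g x *\<^sub>R v)" for k
  proof (induction k)
    case (Suc k)
    then obtain g where g: "g \<in> trig_alg z" "nth_vderiv k (\<lambda>x. f x *\<^sub>R v) = (\<lambda>x. g x *\<^sub>R v)" by blast
    obtain g' where g': "g' \<in> trig_alg z" "\<forall>x. (g has_real_derivative g' x) (at x)"
      using trig_alg_derivative[OF g(1)] by blast
    show ?case
      using g' vector_derivative_at[OF scale[OF g'(2)]] by (auto simp: nth_vderiv_Suc g(2))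
  qed (use assms in auto)
  have "nth_vderiv k (\<lambda>x. f x *\<^sub>R v) differentiable (at x)" for k x
  proof -
    obtain g where g: "g \<in> trig_alg z" "nth_vderiv k (\<lambda>x. f x *\<^sub>R v) = (\<lambda>x. g x *\<^sub>R v)"
      using nth by blast
    obtain g' where "\<forall>x. (g has_real_derivative g' x) (at x)"
      using trig_alg_derivative[OF g(1)] by blast
    from scale[OF this, of x] show ?thesis unfolding g(2) by (rule differentiableI_vector)
  qed
  moreover from this have "continuous_on UNIV (nth_vderiv k (\<lambda>x. f x *\<^sub>R v))" for k
    by (simp add: differentiable_imp_continuous_within continuous_at_imp_continuous_on)
  ultimately show ?thesis
    using trig_alg_periodic[OF assms] by (auto simp: Cinf_circle_def Cr_circle_def)
qed

section \<open>Transversality by diagonal dominance\<close>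

text \<open>
  Look at the row belonging to the largest entry of \<open>\<Delta>\<close>.
\<close>

lemma diagonally_dominant_bound:
  fixes M :: "'a \<Rightarrow> 'a \<Rightarrow> real"
  assumes J: "finite J" "card J = k" and D: "D > 0"
    and diag: "\<And>i. i \<in> J \<Longrightarrow> 2 * D \<le> \<bar>M i i\<bar>"
    and off: "\<And>i j. i \<in> J \<Longrightarrow> j \<in> J \<Longrightarrow> i \<noteq> j \<Longrightarrow> real k * \<bar>M i j\<bar> \<le> D"
    and \<Delta>: "\<And>i. i \<in> J \<Longrightarrow> \<bar>\<Sum>j\<in>J. M i j * \<Delta> j\<bar> \<le> \<tau>"
    and j: "j \<in> J"
  shows "\<bar>\<Delta> j\<bar> \<le> \<tau> / D"
proof -
  have "Max ((\<lambda>j. \<bar>\<Delta> j\<bar>) ` J) \<in> (\<lambda>j. \<bar>\<Delta> j\<bar>) ` J" using J j by (intro Max_in) auto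
  then obtain i where i: "i \<in> J" "Max ((\<lambda>j. \<bar>\<Delta> j\<bar>) ` J) = \<bar>\<Delta> i\<bar>" by auto
  have max: "\<bar>\<Delta> j\<bar> \<le> \<bar>\<Delta> i\<bar>" if "j \<in> J" for j
    using that J unfolding i(2)[symmetric] by (intro Max_ge) auto
  have k: "k > 0" using J i by (auto simp: card_gt_0_iff)
  have "(\<Sum>j\<in>J. M i j * \<Delta> j) = M i i * \<Delta> i + (\<Sum>j\<in>J - {i}. M i j * \<Delta> j)"
    using J i by (simp add: sum.remove)
  then have "\<bar>M i i\<bar> * \<bar>\<Delta> i\<bar> \<le> \<tau> + \<bar>\<Sum>j\<in>J - {i}. M i j * \<Delta> j\<bar>"
    using \<Delta>[OF i(1)] unfolding abs_mult[symmetric] by linarith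
  also have "\<bar>\<Sum>j\<in>J - {i}. M i j * \<Delta> j\<bar> \<le> (\<Sum>j\<in>J - {i}. D / real k * \<bar>\<Delta> i\<bar>)"
  proof (intro order_trans[OF sum_abs] sum_mono)
    fix j assume j: "j \<in> J - {i}"
    then have "\<bar>M i j\<bar> \<le> D / real k" using off[OF i(1), of j] j k by (auto simp: field_simps)
    then show "\<bar>M i j * \<Delta> j\<bar> \<le> D / real k * \<bar>\<Delta> i\<bar>"
      unfolding abs_mult using j max[of j] D by (intro mult_mono) auto
  qed
  also have "\<dots> = real (card (J - {i})) * (D / real k * \<bar>\<Delta> i\<bar>)" by simp
  also have "\<dots> \<le> real k * (D / real k * \<bar>\<Delta> i\<bar>)"
    using J i D by (intro mult_right_mono) auto
  also have "\<dots> = D * \<bar>\<Delta> i\<bar>" using k by simp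
  finally have "\<bar>M i i\<bar> * \<bar>\<Delta> i\<bar> \<le> \<tau> + D * \<bar>\<Delta> i\<bar>" by simp
  moreover have "2 * D * \<bar>\<Delta> i\<bar> \<le> \<bar>M i i\<bar> * \<bar>\<Delta> i\<bar>" using diag[OF i(1)] by (intro mult_right_mono) auto
  ultimately have "D * \<bar>\<Delta> i\<bar> \<le> \<tau>" by simp
  then have "\<bar>\<Delta> i\<bar> \<le> \<tau> / D" using D by (simp add: field_simps)
  with max[OF j] show ?thesis by linarith
qed

lemma inner_matrix_vector_transpose:
  fixes A :: "real ^ 'n ^ 'n"
  shows "\<eta> \<bullet> (A *v v) = (transpose A *v \<eta>) \<bullet> v"
  by (simp add: dot_lmul_matrix)

definition bump_field :: "nat \<Rightarrow> 'n \<Rightarrow> real \<Rightarrow> real \<Rightarrow> real ^ 'n" where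
  "bump_field L c z x = bump' L z x *\<^sub>R axis c 1"

lemma inner_dS_bump_field:
  fixes A :: "real ^ 'n ^ 'n"
  shows "\<eta> \<bullet> dS l A (bump_field L c z) a y =
    (\<Sum>m = 1..length a. (1 / real l ^ m) * (bump' L z (branch l (take m a) y) *
      (\<eta> \<bullet> (matpow A (m - 1) *v axis c 1))))"
  by (simp add: dS_def bump_field_def inner_sum_right matrix_vector_mult_scaleR)

lemma exists_near_grid_point:
  assumes "R > 0"
  shows "\<exists>i<R. circ (x - real i / real R) \<le> 4 / real R"
proof -
  define i where "i = nat \<lfloor>real R * frac x\<rfloor>"
  have f: "0 \<le> frac x" "frac x < 1" by (simp_all add: frac_lt_1)
  have Rf: "0 \<le> real R * frac x" "real R * frac x < real R * 1"
    using f assms by (auto intro!: mult_strict_left_mono simp del: mult_1_right)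
  have i: "real i \<le> real R * frac x" "real R * frac x < real i + 1"
    using Rf by (auto simp: i_def)
  have "i < R" using i Rf by linarith
  moreover have "circ (x - real i / real R) \<le> 4 / real R"
  proof -
    have "circ (x - real i / real R) = circ (frac x - real i / real R)"
      by (intro circ_cong_Ints) (simp add: frac_def)
    also have "\<dots> \<le> 4 * \<bar>frac x - real i / real R\<bar>" by (rule circ_le)
    also have "frac x - real i / real R = (real R * frac x - real i) / real R"
      using assms by (simp add: field_simps)
    also have "4 * \<bar>\<dots>\<bar> \<le> 4 / real R" using i assms by (simp add: abs_divide divide_le_cancel)
    finally show ?thesis .
  qed
  ultimately show ?thesis by blast
qed

text \<open>
  The finite family consists of the bumps centred at the points \<open>i/R\<close>, in each coordinate direction. For a
  given \<open>\<eta>\<close>, the direction \<open>c\<close> is a coordinate in which the vector \<open>(A\<^sup>T)^(N-1) \<eta>\<close> is not small, and the bump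
  assigned to a selected word \<open>j\<close> is one centred near its point \<open>X j N\<close>. The number \<open>D\<close> is a lower bound for the
  contribution of this point, up to a factor \<open>\<pi>\<close>.

  Everything else is an error: the points up to time \<open>T\<close> are away from the centre, where the bump is
  at most \<open>\<theta>\<close>, and the later ones carry a factor \<open>\<rho>\<^sup>T\<close>. Both are made small against
  \<open>D / (k + 1)\<close>, the first by the choice of \<open>L\<close>, the second by the hypothesis on \<open>T\<close>. Hence the matrix with rows
  indexed by words and columns by their bumps is diagonally dominant, uniformly in
  \<open>y\<close>, \<open>\<eta>\<close> and the length \<open>n\<close>.
\<close>

lemma transversal_bump_family:
  fixes A :: "real ^ 'n ^ 'n"
  assumes l: "l \<ge> 2" and C: "C \<ge> 1" and \<rho>: "0 < \<rho>" "\<rho> < 1" and \<sigma>: "0 < \<sigma>"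
    and decay: "\<And>n v. norm (matpow A n *v v) \<le> C * \<rho> ^ n * norm v"
    and lower: "\<And>n \<eta>. \<sigma> ^ n * norm \<eta> \<le> norm (transpose (matpow A n) *v \<eta>)"
    and N: "1 \<le> N" "N \<le> T"
    and D: "D = \<sigma> ^ (N - 1) / (2 * real CARD('n) * real l ^ N)"
    and T: "24 * pi * C * \<rho> ^ T * (real k + 1) \<le> D"
  obtains L R where "R > 0"
    "\<And>y \<eta> n V. 1 / 2 \<le> norm \<eta> \<Longrightarrow> norm \<eta> \<le> 2 \<Longrightarrow> T \<le> n \<Longrightarrow> V \<subseteq> words l n \<Longrightarrow>
      inj_on (take N) V \<Longrightarrow> T + k * (2 * T + 1) \<le> card V \<Longrightarrow>
      \<exists>J c \<zeta>. J \<subseteq> V \<and> card J = k \<and> (\<forall>j\<in>J. \<zeta> j < R) \<and>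
        (\<forall>i\<in>J. 2 * D \<le> \<bar>\<eta> \<bullet> dS l A (bump_field L c (real (\<zeta> i) / real R)) i y\<bar>) \<and>
        (\<forall>i\<in>J. \<forall>j\<in>J. i \<noteq> j \<longrightarrow>
          (real k + 1) * \<bar>\<eta> \<bullet> dS l A (bump_field L c (real (\<zeta> j) / real R)) i y\<bar> \<le> D)"
proof -
  have D0: "D > 0" using \<sigma> l by (simp add: D)
  obtain \<gamma> where \<gamma>: "\<gamma> > 0"
    "\<And>v w y. v \<in> words l N \<Longrightarrow> w \<in> words l N \<Longrightarrow> v \<noteq> w \<Longrightarrow> \<gamma> \<le> circ (branch l v y - branch l w y)"
    using branch_separation[OF l] by blast
  define Q where "Q = 4 * real l ^ (T * N + T)"
  have "1 \<le> real l ^ (T * N + T)" using l by simp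
  then have Q: "Q > 0" using l by (simp add: Q_def)
  \<comment> \<open>the radius of interference, small enough for the selection of words\<close>
  define \<epsilon> where "\<epsilon> = min 1 (\<gamma> / Q)"
  have \<epsilon>: "0 < \<epsilon>" "\<epsilon> \<le> 1" "Q * \<epsilon> \<le> \<gamma>"
  proof -
    show "0 < \<epsilon>" "\<epsilon> \<le> 1" using \<gamma>(1) Q by (simp_all add: \<epsilon>_def)
    have "Q * \<epsilon> \<le> Q * (\<gamma> / Q)" using Q by (intro mult_left_mono) (auto simp: \<epsilon>_def)
    then show "Q * \<epsilon> \<le> \<gamma>" using Q by simp
  qed
  define \<theta> where "\<theta> = D / (4 * C * (real k + 1))"
  have \<theta>: "\<theta> > 0" using D0 C by (simp add: \<theta>_def)
  obtain L where L: "2 * pi * (1 - (\<epsilon> / 2)\<^sup>2) ^ L * (1 + 2 * real L) < \<theta>"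
    using exists_concentrated_bump[of "\<epsilon> / 2" \<theta>] \<epsilon> \<theta> by auto
  \<comment> \<open>a centre grid so fine that a nearby centre sees the orbit point at the top of its bump, and that points at distance \<open>\<epsilon>\<close> from the orbit point stay at distance \<open>\<epsilon>/2\<close> from the centre\<close>
  define R where "R = 16 * (L + 1) + nat \<lceil>8 / \<epsilon>\<rceil>"
  have R: "R > 0" by (simp add: R_def)
  have "real R \<ge> 8 / \<epsilon>" unfolding R_def by linarith
  then have R1: "4 / real R \<le> \<epsilon> / 2" using \<epsilon> R by (simp add: field_simps)
  have R2: "real R \<ge> 16 * (real L + 1)" unfolding R_def by simp
  have R3: "(real L + 1) * (4 / real R)\<^sup>2 \<le> 1 / 16"
  proof -
    have "4 / real R \<le> 4 / (16 * (real L + 1))" using R2 by (intro divide_left_mono) auto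
    then have "(4 / real R)\<^sup>2 \<le> (4 / (16 * (real L + 1)))\<^sup>2" by (intro power_mono) auto
    then have "(real L + 1) * (4 / real R)\<^sup>2 \<le> (real L + 1) * (4 / (16 * (real L + 1)))\<^sup>2"
      by (intro mult_left_mono) auto
    also have "\<dots> = 1 / (16 * (real L + 1))"
    proof -
      have "a * (4 / (16 * a))\<^sup>2 = 1 / (16 * a)" if "a > 0" for a :: real
        using that by (simp add: power2_eq_square field_simps)
      from this[of "real L + 1"] show ?thesis by simp
    qed
    also have "\<dots> \<le> 1 / 16" by (simp add: field_simps)
    finally show ?thesis .
  qed
  \<comment> \<open>bounds every term except the main one, up to the summable factor \<open>l^(-m)\<close>\<close>
  define err where "err = 2 * C * \<theta> + 12 * pi * C * \<rho> ^ T"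
  have err: "(real k + 1) * err \<le> D" "0 \<le> err"
  proof -
    have "(real k + 1) * err = (real k + 1) * (2 * C * \<theta>) + 12 * pi * C * \<rho> ^ T * (real k + 1)"
      by (simp add: err_def algebra_simps)
    also have "(real k + 1) * (2 * C * \<theta>) = D / 2"
    proof -
      have "a * (2 * C * (D / (4 * C * a))) = D / 2" if "a > 0" for a
        using that C by simp
      from this[of "real k + 1"] show ?thesis by (simp add: \<theta>_def)
    qed
    finally show "(real k + 1) * err \<le> D" using T by simp
    show "0 \<le> err" using C \<theta> \<rho> by (simp add: err_def)
  qed
  show ?thesis
  proof (rule that[OF R])
    fix y \<eta> n V
    assume \<eta>: "1 / 2 \<le> norm (\<eta> :: real ^ 'n)" "norm \<eta> \<le> 2" and n: "T \<le> n" and V: "V \<subseteq> words l n"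
      "inj_on (take N) V" "T + k * (2 * T + 1) \<le> card V"
    define X where "X = (\<lambda>i m. branch l (take m i) y)"
    obtain J where J: "J \<subseteq> V" "card J = k"
      "\<And>i j m. i \<in> J \<Longrightarrow> j \<in> J \<Longrightarrow> m \<in> {1..T} \<Longrightarrow> circ (X i m - X j N) < \<epsilon> \<Longrightarrow> i = j \<and> m = N"
      using exists_noninterfering_words[OF l N n \<gamma>(2) \<epsilon>(1) \<epsilon>(3)[unfolded Q_def] V, where y = y]
      unfolding X_def by blast
    have len: "length i = n" if "i \<in> J" for i using that J V by (auto simp: words_def)
    define w where "w = transpose (matpow A (N - 1)) *v \<eta>"
    obtain c where c: "norm w \<le> real CARD('n) * \<bar>w $ c\<bar>"
    proof -
      have "\<exists>c. norm w \<le> real CARD('n) * \<bar>w $ c\<bar>"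
      proof (rule ccontr)
        assume "\<not> ?thesis"
        then have "\<bar>w $ c\<bar> < norm w / real CARD('n)" for c
          by (simp add: not_le field_simps)
        then have "(\<Sum>c\<in>UNIV. \<bar>w $ c\<bar>) < (\<Sum>c\<in>(UNIV::'n set). norm w / real CARD('n))"
          by (intro sum_strict_mono) auto
        then show False using norm_le_l1_cart[of w] by simp
      qed
      then show ?thesis using that by blast
    qed
    have "\<exists>\<zeta>. \<forall>j. \<zeta> j < R \<and> circ (X j N - real (\<zeta> j) / real R) \<le> 4 / real R"
      by (intro choice allI) (use exists_near_grid_point[OF R] in blast)
    then obtain \<zeta> where \<zeta>: "\<And>j. \<zeta> j < R" "\<And>j. circ (X j N - real (\<zeta> j) / real R) \<le> 4 / real R"
      by blast
    define co where "co = (\<lambda>m. \<eta> \<bullet> (matpow A (m - 1) *v axis c 1))"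
    define F where "F = (\<lambda>i j m. (1 / real l ^ m) * (bump' L (real (\<zeta> j) / real R) (X i m) * co m))"
    have sum: "\<eta> \<bullet> dS l A (bump_field L c (real (\<zeta> j) / real R)) i y = (\<Sum>m = 1..n. F i j m)"
      if "i \<in> J" for i j
      using len[OF that] by (simp add: inner_dS_bump_field F_def X_def co_def)
    have co: "\<bar>co m\<bar> \<le> 2 * C * \<rho> ^ (m - 1)" for m
    proof -
      have "\<bar>co m\<bar> \<le> norm \<eta> * norm (matpow A (m - 1) *v axis c 1)"
        unfolding co_def by (rule Cauchy_Schwarz_ineq2)
      also have "\<dots> \<le> 2 * (C * \<rho> ^ (m - 1) * norm (axis c (1::real)))"
        using \<eta>(2) by (intro mult_mono decay) auto
      finally show ?thesis by (simp add: norm_axis_1 mult_ac)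
    qed
    have small: "\<bar>F i j m\<bar> \<le> (1 / real l ^ m) * err" if ij: "i \<in> J" "j \<in> J" "m \<ge> 1" "i \<noteq> j \<or> m \<noteq> N" for i j m
    proof -
      define b where "b = bump' L (real (\<zeta> j) / real R) (X i m)"
      have "\<bar>b\<bar> * \<bar>co m\<bar> \<le> err"
      proof (cases "m \<le> T")
        case True
        then have "\<epsilon> \<le> circ (X i m - X j N)" using J(3)[OF ij(1,2), of m] ij by force
        also have "\<dots> \<le> circ (X i m - real (\<zeta> j) / real R) + circ (X j N - real (\<zeta> j) / real R)"
          using circ_triangle[of "X i m" "X j N" "real (\<zeta> j) / real R"]
            circ_diff_commute[of "X j N" "real (\<zeta> j) / real R"] by simp
        finally have "\<epsilon> / 2 \<le> circ (X i m - real (\<zeta> j) / real R)" using \<zeta>(2)[of j] R1 by linarith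
        from bump'_far[OF this, of L] L \<epsilon> have "\<bar>b\<bar> \<le> \<theta>" by (simp add: b_def)
        moreover have "\<bar>co m\<bar> \<le> 2 * C * 1"
          using \<rho> C by (intro order_trans[OF co] mult_left_mono) (auto intro: power_le_one)
        ultimately have "\<bar>b\<bar> * \<bar>co m\<bar> \<le> \<theta> * (2 * C * 1)" using \<theta> by (intro mult_mono) auto
        also have "\<dots> \<le> err" using C \<rho> by (simp add: err_def)
        finally show ?thesis .
      next
        case False
        have "\<bar>co m\<bar> \<le> 2 * C * \<rho> ^ T"
          using \<rho> C False by (intro order_trans[OF co] mult_left_mono) (auto intro: power_decreasing)
        then have "\<bar>b\<bar> * \<bar>co m\<bar> \<le> 6 * pi * (2 * C * \<rho> ^ T)"
          unfolding b_def using abs_bump'_le by (intro mult_mono) auto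
        also have "\<dots> \<le> err" using C \<theta> by (simp add: err_def)
        finally show ?thesis .
      qed
      then show ?thesis unfolding F_def b_def[symmetric]
        by (simp add: abs_mult divide_right_mono)
    qed
    have off: "\<bar>\<eta> \<bullet> dS l A (bump_field L c (real (\<zeta> j) / real R)) i y\<bar> \<le> err" if ij: "i \<in> J" "j \<in> J" "i \<noteq> j" for i j
    proof -
      have "\<bar>\<Sum>m = 1..n. F i j m\<bar> \<le> (\<Sum>m = 1..n. (1 / real l ^ m) * err)"
        using small[OF ij(1,2)] ij(3) by (intro order_trans[OF sum_abs] sum_mono) auto
      also have "\<dots> = (\<Sum>m = 1..n. 1 / real l ^ m) * err" by (simp add: sum_distrib_right)
      also have "\<dots> \<le> 1 * err" using sum_geometric_le_1[OF l] err by (intro mult_right_mono) auto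
      finally show ?thesis using sum[OF ij(1)] by simp
    qed
    have diag: "2 * D \<le> \<bar>\<eta> \<bullet> dS l A (bump_field L c (real (\<zeta> i) / real R)) i y\<bar>" if i: "i \<in> J" for i
    proof -
      have q: "circ (X i N - real (\<zeta> i) / real R) ^ 2 \<le> (4 / real R)\<^sup>2"
        using \<zeta>(2)[of i] by (intro power_mono) auto
      have "0 \<le> real L * (4 / real R)\<^sup>2" by simp
      then have q1: "(4 / real R)\<^sup>2 \<le> 1 / 16" using R3 unfolding distrib_right by linarith
      have "real L * circ (X i N - real (\<zeta> i) / real R) ^ 2 \<le> real L * (4 / real R)\<^sup>2"
        using q by (intro mult_left_mono) auto
      also have "\<dots> \<le> 1 / 16" using R3 zero_le_power2[of "4 / real R"] unfolding distrib_right by linarith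
      finally have b: "pi \<le> bump' L (real (\<zeta> i) / real R) (X i N)"
        using order_trans[OF q q1] by (intro bump'_near)
      have "co N = w $ c"
        unfolding co_def inner_matrix_vector_transpose w_def by (simp add: inner_axis)
      moreover have "\<sigma> ^ (N - 1) * (1 / 2) \<le> norm w"
        unfolding w_def using \<eta> \<sigma> by (intro order_trans[OF mult_left_mono lower]) auto
      ultimately have "\<sigma> ^ (N - 1) * (1 / 2) \<le> real CARD('n) * \<bar>co N\<bar>" using c by simp
      then have "\<sigma> ^ (N - 1) * (1 / 2) / real CARD('n) \<le> \<bar>co N\<bar>" by (simp add: field_simps)
      moreover have "\<sigma> ^ (N - 1) * (1 / 2) / real CARD('n) = D * real l ^ N" using l by (simp add: D)
      ultimately have coN: "D * real l ^ N \<le> \<bar>co N\<bar>" by simp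
      have "D * pi = (1 / real l ^ N) * (pi * (D * real l ^ N))" using l by simp
      also have "\<dots> \<le> (1 / real l ^ N) * (\<bar>bump' L (real (\<zeta> i) / real R) (X i N)\<bar> * \<bar>co N\<bar>)"
        using b coN D0 by (intro mult_left_mono mult_mono) auto
      also have "\<dots> = \<bar>F i i N\<bar>" by (simp add: F_def abs_mult)
      finally have main: "D * pi \<le> \<bar>F i i N\<bar>" .
      have "\<bar>\<Sum>m\<in>{1..n} - {N}. F i i m\<bar> \<le> (\<Sum>m\<in>{1..n} - {N}. (1 / real l ^ m) * err)"
        using small[OF i i] by (intro order_trans[OF sum_abs] sum_mono) auto
      also have "\<dots> \<le> (\<Sum>m = 1..n. (1 / real l ^ m) * err)"
        using err by (intro sum_mono2) auto
      also have "\<dots> = (\<Sum>m = 1..n. 1 / real l ^ m) * err" by (simp add: sum_distrib_right)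
      also have "\<dots> \<le> 1 * err" using sum_geometric_le_1[OF l] err by (intro mult_right_mono) auto
      finally have rest: "\<bar>\<Sum>m\<in>{1..n} - {N}. F i i m\<bar> \<le> err" by simp
      have "0 \<le> real k * err" using err by simp
      then have eD: "err \<le> D" using err(1) unfolding distrib_right by linarith
      have "(\<Sum>m = 1..n. F i i m) = F i i N + (\<Sum>m\<in>{1..n} - {N}. F i i m)"
        using N n by (subst sum.remove[of _ N]) auto
      moreover have "3 * D \<le> D * pi" using D0 pi_gt3 by simp
      ultimately have "2 * D \<le> \<bar>\<Sum>m = 1..n. F i i m\<bar>" using main rest eD by linarith
      then show ?thesis using sum[OF i] by simp
    qed
    have off': "(real k + 1) * \<bar>\<eta> \<bullet> dS l A (bump_field L c (real (\<zeta> j) / real R)) i y\<bar> \<le> D"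
      if "i \<in> J" "j \<in> J" "i \<noteq> j" for i j
      using off[OF that] by (intro order_trans[OF mult_left_mono err(1)]) auto
    show "\<exists>J c \<zeta>. J \<subseteq> V \<and> card J = k \<and> (\<forall>j\<in>J. \<zeta> j < R) \<and>
      (\<forall>i\<in>J. 2 * D \<le> \<bar>\<eta> \<bullet> dS l A (bump_field L c (real (\<zeta> i) / real R)) i y\<bar>) \<and>
      (\<forall>i\<in>J. \<forall>j\<in>J. i \<noteq> j \<longrightarrow>
        (real k + 1) * \<bar>\<eta> \<bullet> dS l A (bump_field L c (real (\<zeta> j) / real R)) i y\<bar> \<le> D)"
      by (intro exI[of _ J] exI[of _ c] exI[of _ \<zeta>] conjI ballI impI J(1,2) \<zeta>(1) diag off')
  qed
qed

section \<open>The measure of the bad parameters\<close>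

text \<open>
  A discrete form of Fubini's theorem: once the coordinates outside \<open>I\<close> are fixed, those in \<open>I\<close> range over a
  cube of side \<open>2 w + 1\<close>.
\<close>

lemma card_fibrewise_close_le:
  fixes S :: "('i \<Rightarrow> int) set"
  assumes fin: "finite Idx" "I \<subseteq> Idx" "finite G"
    and S: "S \<subseteq> Idx \<rightarrow>\<^sub>E G"
    and close: "\<And>u v i. u \<in> S \<Longrightarrow> v \<in> S \<Longrightarrow> (\<forall>j\<in>Idx - I. u j = v j) \<Longrightarrow> i \<in> I \<Longrightarrow> \<bar>u i - v i\<bar> \<le> int w"
  shows "card S \<le> card G ^ (card Idx - card I) * (2 * w + 1) ^ card I"
proof -
  define r where "r = (\<lambda>u :: 'i \<Rightarrow> int. restrict u (Idx - I))"
  have finI: "finite I" using fin finite_subset by blast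
  have finS: "finite S" using finite_subset[OF S] fin by (simp add: finite_PiE)
  have fibre: "card {u \<in> S. r u = v} \<le> (2 * w + 1) ^ card I" for v
  proof (cases "{u \<in> S. r u = v} = {}")
    case False
    then obtain u0 where u0: "u0 \<in> S" "r u0 = v" by blast
    have agree: "\<forall>j\<in>Idx - I. u j = u' j" if "r u = r u'" for u u'
      using that unfolding r_def by (metis restrict_apply')
    have "card {u \<in> S. r u = v} \<le> card (Pi\<^sub>E I (\<lambda>i. {u0 i - int w..u0 i + int w}))"
    proof (rule card_inj_on_le[of "\<lambda>u. restrict u I"])
      show "inj_on (\<lambda>u. restrict u I) {u \<in> S. r u = v}"
      proof (rule inj_onI)
        fix u u' assume u: "u \<in> {u \<in> S. r u = v}" "u' \<in> {u \<in> S. r u = v}" "restrict u I = restrict u' I"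
        have "u i = u' i" if "i \<in> Idx" for i
        proof (cases "i \<in> I")
          case True
          then show ?thesis using u(3) by (metis restrict_apply')
        next
          case False
          then show ?thesis using agree[of u u'] u that by auto
        qed
        then show "u = u'" using u S by (intro PiE_ext[of u Idx "\<lambda>_. G" u']) auto
      qed
      show "(\<lambda>u. restrict u I) ` {u \<in> S. r u = v} \<subseteq> Pi\<^sub>E I (\<lambda>i. {u0 i - int w..u0 i + int w})"
      proof (rule image_subsetI)
        fix u assume "u \<in> {u \<in> S. r u = v}"
        then have u: "u \<in> S" "v = r u" by auto
        have "u i \<in> {u0 i - int w..u0 i + int w}" if "i \<in> I" for i
        proof -
          have "\<forall>j\<in>Idx - I. u j = u0 j" using u u0 by (intro agree) simp
          from close[OF u(1) u0(1) this that] show ?thesis by auto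
        qed
        then show "restrict u I \<in> Pi\<^sub>E I (\<lambda>i. {u0 i - int w..u0 i + int w})"
          by auto
      qed
      show "finite (Pi\<^sub>E I (\<lambda>i. {u0 i - int w..u0 i + int w}))"
        using finI by (intro finite_PiE) auto
    qed
    also have "\<dots> = (2 * w + 1) ^ card I"
    proof -
      have "nat (u0 i + int w + 1 - (u0 i - int w)) = 2 * w + 1" for i by (simp add: nat_eq_iff)
      then show ?thesis using finI by (simp add: card_PiE)
    qed
    finally show ?thesis .
  next
    case True
    show ?thesis unfolding True by simp
  qed
  have "S = (\<Union>v\<in>r ` S. {u \<in> S. r u = v})" by auto
  then have "card S \<le> (\<Sum>v\<in>r ` S. card {u \<in> S. r u = v})"
    using card_UN_le[of "r ` S" "\<lambda>v. {u \<in> S. r u = v}"] finS by simp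
  also have "\<dots> \<le> (\<Sum>v\<in>r ` S. (2 * w + 1) ^ card I)" by (intro sum_mono fibre)
  also have "\<dots> = card (r ` S) * (2 * w + 1) ^ card I" by simp
  also have "card (r ` S) \<le> card G ^ (card Idx - card I)"
  proof -
    have "r ` S \<subseteq> (Idx - I) \<rightarrow>\<^sub>E G"
    proof (rule image_subsetI)
      fix u assume "u \<in> S"
      then have "u \<in> Idx \<rightarrow>\<^sub>E G" using S by blast
      then show "r u \<in> (Idx - I) \<rightarrow>\<^sub>E G" by (auto simp: r_def PiE_iff)
    qed
    then have "card (r ` S) \<le> card ((Idx - I) \<rightarrow>\<^sub>E G)"
      using fin by (intro card_mono finite_PiE) auto
    then show ?thesis using fin finI by (simp add: card_PiE card_Diff_subset)
  qed
  finally show ?thesis by simp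
qed

definition grid :: "real \<Rightarrow> real \<Rightarrow> int set" where
  "grid B \<delta> = {- \<lceil>B / \<delta>\<rceil>..\<lceil>B / \<delta>\<rceil>}"

lemma finite_grid [simp]: "finite (grid B \<delta>)"
  by (simp add: grid_def)

lemma floor_in_grid:
  assumes "\<bar>x\<bar> \<le> B" "0 < \<delta>"
  shows "\<lfloor>x / \<delta>\<rfloor> \<in> grid B \<delta>"
proof -
  have "- (B / \<delta>) \<le> x / \<delta>" "x / \<delta> \<le> B / \<delta>"
    using divide_right_mono[of "- B" x \<delta>] divide_right_mono[of x B \<delta>] assms by auto
  then have "real_of_int (- \<lceil>B / \<delta>\<rceil>) \<le> x / \<delta>" "real_of_int \<lfloor>x / \<delta>\<rfloor> \<le> real_of_int \<lceil>B / \<delta>\<rceil>"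
    using le_of_int_ceiling[of "B / \<delta>"] of_int_floor_le[of "x / \<delta>"] by linarith+
  then show ?thesis unfolding grid_def atLeastAtMost_iff le_floor_iff of_int_le_iff by simp
qed

lemma floor_grid_error:
  assumes "0 < \<delta>"
  shows "\<bar>x - \<delta> * real_of_int \<lfloor>x / \<delta>\<rfloor>\<bar> \<le> \<delta>"
    "\<delta> * real_of_int \<lfloor>x / \<delta>\<rfloor> \<le> x" "x \<le> \<delta> * real_of_int \<lfloor>x / \<delta>\<rfloor> + \<delta>"
proof -
  have "real_of_int \<lfloor>x / \<delta>\<rfloor> \<le> x / \<delta>" by (rule of_int_floor_le)
  then show 1: "\<delta> * real_of_int \<lfloor>x / \<delta>\<rfloor> \<le> x"
    using assms by (simp only: pos_le_divide_eq mult.commute)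
  have "x / \<delta> \<le> real_of_int \<lfloor>x / \<delta>\<rfloor> + 1" by linarith
  then have "x \<le> (real_of_int \<lfloor>x / \<delta>\<rfloor> + 1) * \<delta>" using assms by (simp only: pos_divide_le_eq)
  then show 2: "x \<le> \<delta> * real_of_int \<lfloor>x / \<delta>\<rfloor> + \<delta>" by (simp add: algebra_simps)
  from 1 2 show "\<bar>x - \<delta> * real_of_int \<lfloor>x / \<delta>\<rfloor>\<bar> \<le> \<delta>" by linarith
qed

lemma card_grid_le:
  assumes "0 < \<delta>" "\<delta> \<le> 1" "0 \<le> B"
  shows "real (card (grid B \<delta>)) \<le> (2 * B + 3) / \<delta>"
proof -
  have "0 \<le> B / \<delta>" using assms by simp
  then have "0 \<le> \<lceil>B / \<delta>\<rceil>" by linarith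
  then have "real (card (grid B \<delta>)) = 2 * real_of_int \<lceil>B / \<delta>\<rceil> + 1" by (simp add: grid_def)
  also have "\<dots> \<le> 2 * (B / \<delta> + 1) + 1"
    by (intro add_right_mono mult_left_mono of_int_ceiling_le_add_one) simp
  also have "\<dots> \<le> (2 * B + 3) / \<delta>" using assms by (simp add: field_simps)
  finally show ?thesis .
qed

text \<open>
  The concentrated words, with a common base point for all of them, an arbitrary real number in the
  place of the integer \<open>\<xi>\<close>, and any constant in the place of \<open>2 \<alpha>\<close>. In this form the set is compatible both
  with rescaling the pair \<open>(\<xi>, \<eta>)\<close> and with passing to suffixes.
\<close>

definition near_words ::
  "nat \<Rightarrow> real ^ 'n ^ 'n \<Rightarrow> (real \<Rightarrow> real ^ 'n) \<Rightarrow> real \<Rightarrow> nat \<Rightarrow> real \<Rightarrow> real \<Rightarrow> real ^ 'n \<Rightarrow> nat list set" where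
  "near_words l A f C n y \<xi> \<eta> = {b \<in> words l n.
     \<bar>\<xi> + \<eta> \<bullet> dS l A f b y\<bar> < C / real l ^ n * norm (transpose (matpow A n) *v \<eta>)}"

text \<open>
  Diagonal dominance of the matrix with entries \<open>\<eta> \<bullet> dS (g (\<iota> j)) i y\<close>. The factor \<open>k + 1\<close> makes a whole row of
  off-diagonal entries smaller than \<open>D\<close>.
\<close>

definition transversal ::
  "nat \<Rightarrow> real ^ 'n ^ 'n \<Rightarrow> (nat \<Rightarrow> real \<Rightarrow> real ^ 'n) \<Rightarrow> nat \<Rightarrow> real \<Rightarrow> real \<Rightarrow> real ^ 'n
     \<Rightarrow> nat list set \<Rightarrow> (nat list \<Rightarrow> nat) \<Rightarrow> bool" where
  "transversal l A g k D y \<eta> J \<iota> \<longleftrightarrow>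
     (\<forall>i\<in>J. 2 * D \<le> \<bar>\<eta> \<bullet> dS l A (g (\<iota> i)) i y\<bar>) \<and>
     (\<forall>i\<in>J. \<forall>j\<in>J. i \<noteq> j \<longrightarrow> (real k + 1) * \<bar>\<eta> \<bullet> dS l A (g (\<iota> j)) i y\<bar> \<le> D)"

text \<open>
  Two words with the same bump would give equal diagonal and off-diagonal entries.
\<close>

lemma transversal_inj:
  assumes "transversal l A g k D y \<eta> J \<iota>" "D > 0"
  shows "inj_on \<iota> J"
proof (rule inj_onI, rule ccontr)
  fix i j assume ij: "i \<in> J" "j \<in> J" "\<iota> i = \<iota> j" "i \<noteq> j"
  define a where "a = \<bar>\<eta> \<bullet> dS l A (g (\<iota> i)) i y\<bar>"
  have "2 * D \<le> a" "(real k + 1) * a \<le> D"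
    using assms(1) ij unfolding transversal_def a_def by metis+
  moreover have "0 \<le> real k * a" by (simp add: a_def)
  ultimately show False using assms(2) unfolding distrib_right by linarith
qed

abbreviation (input) perturb ::
  "nat \<Rightarrow> (real \<Rightarrow> real ^ 'n) \<Rightarrow> (nat \<Rightarrow> real \<Rightarrow> real ^ 'n) \<Rightarrow> (nat \<Rightarrow> real) \<Rightarrow> real \<Rightarrow> real ^ 'n" where
  "perturb m f g t \<equiv> (\<lambda>x. f x + (\<Sum>i = 1..m. t i *\<^sub>R g i x))"

text \<open>
  The quantities that are required to be small are affine functions of \<open>u\<close>. For two solutions that agree
  off the bumps of \<open>J\<close>, diagonal dominance bounds the difference in the remaining coordinates by
  \<open>2 c / D\<close> grid steps. So each of the \<open>k\<close> conditions gains a factor of order \<open>\<delta>\<close>.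
\<close>

lemma card_transversal_solutions_le:
  fixes A :: "real ^ 'n ^ 'n"
  assumes \<delta>: "\<delta> > 0" and D: "D > 0" and J: "finite J" "card J = k" "\<iota> \<in> J \<rightarrow> {1..m}"
    and tr: "transversal l A g k D y \<eta> J \<iota>"
  shows "card {u \<in> {1..m} \<rightarrow>\<^sub>E G. finite G \<and>
      (\<forall>b\<in>J. \<bar>\<xi> + \<eta> \<bullet> dS l A (perturb m f g (\<lambda>i. \<delta> * real_of_int (u i))) b y\<bar> \<le> c * \<delta>)}
    \<le> card G ^ (m - k) * (2 * nat \<lceil>2 * c / D\<rceil> + 1) ^ k"
proof (cases "finite G")
  case True
  define S where "S = {u \<in> {1..m} \<rightarrow>\<^sub>E G. finite G \<and>
      (\<forall>b\<in>J. \<bar>\<xi> + \<eta> \<bullet> dS l A (perturb m f g (\<lambda>i. \<delta> * real_of_int (u i))) b y\<bar> \<le> c * \<delta>)}"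
  have inj: "inj_on \<iota> J" by (rule transversal_inj[OF tr D])
  have cI: "card (\<iota> ` J) = k" using card_image[OF inj] J by simp
  have "card S \<le> card G ^ (card {1..m} - card (\<iota> ` J)) * (2 * nat \<lceil>2 * c / D\<rceil> + 1) ^ card (\<iota> ` J)"
  proof (rule card_fibrewise_close_le)
    show "\<iota> ` J \<subseteq> {1..m}" using J by auto
    fix u v i assume uv: "u \<in> S" "v \<in> S" "\<forall>j\<in>{1..m} - \<iota> ` J. u j = v j" "i \<in> \<iota> ` J"
    then obtain j where j: "j \<in> J" "i = \<iota> j" by auto
    define \<Delta> where "\<Delta> = (\<lambda>j. real_of_int (u (\<iota> j) - v (\<iota> j)))"
    define M where "M = (\<lambda>i j. \<eta> \<bullet> dS l A (g (\<iota> j)) i y)"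
    have "\<bar>\<Sum>j\<in>J. M b j * \<Delta> j\<bar> \<le> 2 * c" if b: "b \<in> J" for b
    proof -
      define h where "h = (\<lambda>i. \<eta> \<bullet> dS l A (g i) b y)"
      define F where "F = (\<lambda>u. \<xi> + \<eta> \<bullet> dS l A (perturb m f g (\<lambda>i. \<delta> * real_of_int (u i))) b y)"
      have F: "F u = \<xi> + \<eta> \<bullet> dS l A f b y + (\<Sum>i = 1..m. \<delta> * real_of_int (u i) * h i)" for u
        by (simp add: F_def dS_affine inner_add_right inner_sum_right h_def)
      have "F u - F v = (\<Sum>i = 1..m. \<delta> * (h i * real_of_int (u i - v i)))"
        unfolding F by (simp add: sum_subtractf[symmetric] algebra_simps)
      also have "\<dots> = (\<Sum>i\<in>\<iota> ` J. \<delta> * (h i * real_of_int (u i - v i)))"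
        using uv(3) J(3) by (intro sum.mono_neutral_right) auto
      also have "\<dots> = (\<Sum>j\<in>J. \<delta> * (M b j * \<Delta> j))"
        by (subst sum.reindex[OF inj]) (simp add: h_def M_def \<Delta>_def)
      also have "\<dots> = \<delta> * (\<Sum>j\<in>J. M b j * \<Delta> j)" by (simp add: sum_distrib_left)
      finally have "\<bar>\<delta> * (\<Sum>j\<in>J. M b j * \<Delta> j)\<bar> = \<bar>F u - F v\<bar>" by simp
      moreover have "\<bar>F u\<bar> \<le> c * \<delta>" "\<bar>F v\<bar> \<le> c * \<delta>" using uv b by (auto simp: S_def F_def)
      ultimately have "\<delta> * \<bar>\<Sum>j\<in>J. M b j * \<Delta> j\<bar> \<le> \<delta> * (2 * c)"
        using \<delta> by (simp add: abs_mult algebra_simps)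
      then show ?thesis using \<delta> by simp
    qed
    moreover have "real k * \<bar>M i j\<bar> \<le> D" if "i \<in> J" "j \<in> J" "i \<noteq> j" for i j
    proof -
      have "(real k + 1) * \<bar>M i j\<bar> \<le> D" using tr that unfolding transversal_def M_def by blast
      then show ?thesis by (simp add: distrib_right)
    qed
    moreover have "2 * D \<le> \<bar>M i i\<bar>" if "i \<in> J" for i
      using tr that unfolding transversal_def M_def by blast
    ultimately have "\<bar>\<Delta> j\<bar> \<le> 2 * c / D"
      using diagonally_dominant_bound[OF J(1,2) D, of M \<Delta> "2 * c" j] j by blast
    then have "real_of_int \<bar>u i - v i\<bar> \<le> 2 * c / D" by (simp add: \<Delta>_def j)
    then show "\<bar>u i - v i\<bar> \<le> int (nat \<lceil>2 * c / D\<rceil>)" by linarith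
  qed (auto simp: S_def True)
  then show ?thesis unfolding S_def[symmetric] by (simp add: cI)
qed simp

text \<open>
  The cells of mesh \<open>\<delta>\<close> in parameter space at whose corner \<open>k\<close> transversal words of length \<open>n\<close> are concentrated.
  Base point, \<open>\<xi>\<close> and \<open>\<eta>\<close> are taken from grids of the same mesh, which makes the number of
  configurations finite.
\<close>

definition bad_cells ::
  "nat \<Rightarrow> real ^ 'n ^ 'n \<Rightarrow> nat \<Rightarrow> (real \<Rightarrow> real ^ 'n) \<Rightarrow> (nat \<Rightarrow> real \<Rightarrow> real ^ 'n) \<Rightarrow> nat \<Rightarrow> real \<Rightarrow> real \<Rightarrow> real
     \<Rightarrow> real \<Rightarrow> nat \<Rightarrow> (nat \<Rightarrow> int) set" where
  "bad_cells l A m f g k D B c \<delta> n = {u \<in> {1..m} \<rightarrow>\<^sub>E grid 1 \<delta>.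
     \<exists>y\<in>grid 2 \<delta>. \<exists>\<xi>\<in>grid B \<delta>. \<exists>v\<in>UNIV \<rightarrow>\<^sub>E grid 1 \<delta>.
     \<exists>J\<in>{J. J \<subseteq> words l n \<and> card J = k}. \<exists>\<iota>\<in>J \<rightarrow>\<^sub>E {1..m}.
       transversal l A g k D (\<delta> * real_of_int y) (\<chi> i. \<delta> * real_of_int (v i)) J \<iota> \<and>
       (\<forall>b\<in>J. \<bar>\<delta> * real_of_int \<xi> + (\<chi> i. \<delta> * real_of_int (v i)) \<bullet>
          dS l A (perturb m f g (\<lambda>i. \<delta> * real_of_int (u i))) b (\<delta> * real_of_int y)\<bar> \<le> c * \<delta>)}"

lemma card_UN_le_mult:
  assumes "finite I" "\<And>i. i \<in> I \<Longrightarrow> card (S i) \<le> b"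
  shows "card (\<Union>i\<in>I. S i) \<le> card I * b"
proof -
  have "card (\<Union>i\<in>I. S i) \<le> (\<Sum>i\<in>I. card (S i))" by (rule card_UN_le[OF assms(1)])
  also have "\<dots> \<le> (\<Sum>i\<in>I. b)" using assms(2) by (rule sum_mono)
  finally show ?thesis by simp
qed

lemma card_bad_cells_le:
  fixes A :: "real ^ 'n ^ 'n"
  assumes \<delta>: "\<delta> > 0" and D: "D > 0"
  shows "card (bad_cells l A m f g k D B c \<delta> n) \<le>
    card (grid 2 \<delta>) * (card (grid B \<delta>) * (card (grid 1 \<delta>) ^ CARD('n) * ((l ^ n) ^ k * (m ^ k *
      (card (grid 1 \<delta>) ^ (m - k) * (2 * nat \<lceil>2 * c / D\<rceil> + 1) ^ k)))))"
proof -
  define V :: "('n \<Rightarrow> int) set" where "V = UNIV \<rightarrow>\<^sub>E grid 1 \<delta>"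
  define JJ where "JJ = {J. J \<subseteq> words l n \<and> card J = k}"
  define S where "S = (\<lambda>y \<xi> v J. {u \<in> {1..m} \<rightarrow>\<^sub>E grid 1 \<delta>. finite (grid 1 \<delta>) \<and>
    (\<forall>b\<in>J. \<bar>\<delta> * real_of_int \<xi> + (\<chi> i. \<delta> * real_of_int (v i)) \<bullet>
          dS l A (perturb m f g (\<lambda>i. \<delta> * real_of_int (u i))) b (\<delta> * real_of_int y)\<bar> \<le> c * \<delta>)})"
  define S' where "S' = (\<lambda>y \<xi> v J \<iota>.
    if transversal l A g k D (\<delta> * real_of_int y) (\<chi> i. \<delta> * real_of_int (v i)) J \<iota> then S y \<xi> v J else {})"
  have finV: "finite V" by (simp add: V_def finite_PiE)
  have cV: "card V = card (grid 1 \<delta>) ^ CARD('n)" by (simp add: V_def card_PiE)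
  have finJJ: "finite JJ" unfolding JJ_def by (rule finite_subset[of _ "Pow (words l n)"]) auto
  have cJJ: "card JJ \<le> (l ^ n) ^ k"
  proof -
    have "card JJ = (l ^ n) choose k" unfolding JJ_def by (simp add: n_subsets card_words)
    then show ?thesis by (cases "k \<le> l ^ n") (simp_all add: binomial_le_pow binomial_eq_0)
  qed
  have "bad_cells l A m f g k D B c \<delta> n \<subseteq>
    (\<Union>y\<in>grid 2 \<delta>. \<Union>\<xi>\<in>grid B \<delta>. \<Union>v\<in>V. \<Union>J\<in>JJ. \<Union>\<iota>\<in>J \<rightarrow>\<^sub>E {1..m}. S' y \<xi> v J \<iota>)"
    (is "_ \<subseteq> ?U")
  proof
    fix u assume "u \<in> bad_cells l A m f g k D B c \<delta> n"
    then obtain y \<xi> v J \<iota> where u: "u \<in> {1..m} \<rightarrow>\<^sub>E grid 1 \<delta>" "y \<in> grid 2 \<delta>" "\<xi> \<in> grid B \<delta>" "v \<in> V" "J \<in> JJ"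
      "\<iota> \<in> J \<rightarrow>\<^sub>E {1..m}"
      "transversal l A g k D (\<delta> * real_of_int y) (\<chi> i. \<delta> * real_of_int (v i)) J \<iota>"
      "\<forall>b\<in>J. \<bar>\<delta> * real_of_int \<xi> + (\<chi> i. \<delta> * real_of_int (v i)) \<bullet>
          dS l A (perturb m f g (\<lambda>i. \<delta> * real_of_int (u i))) b (\<delta> * real_of_int y)\<bar> \<le> c * \<delta>"
      unfolding bad_cells_def V_def[symmetric] JJ_def[symmetric] mem_Collect_eq by (elim conjE bexE) blast
    then have "u \<in> S' y \<xi> v J \<iota>" by (simp add: S'_def S_def)
    with u show "u \<in> ?U" by blast
  qed
  moreover have "finite ?U"
  proof (intro finite_UN_I finV finJJ finite_grid)
    fix J \<iota> y \<xi> v assume "J \<in> JJ"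
    then have "finite J" unfolding JJ_def using finite_subset[OF _ finite_words] by blast
    then show "finite (J \<rightarrow>\<^sub>E {1..m})" by (intro finite_PiE) auto
    show "finite (S' y \<xi> v J \<iota>)"
      by (rule finite_subset[of _ "{1..m} \<rightarrow>\<^sub>E grid 1 \<delta>"]) (auto simp: S'_def S_def finite_PiE)
  qed
  ultimately have "card (bad_cells l A m f g k D B c \<delta> n) \<le> card ?U" by (intro card_mono)
  also have "card ?U \<le> card (grid 2 \<delta>) * (card (grid B \<delta>) * (card V * (card JJ * (m ^ k *
      (card (grid 1 \<delta>) ^ (m - k) * (2 * nat \<lceil>2 * c / D\<rceil> + 1) ^ k)))))"
  proof (intro card_UN_le_mult finV finJJ finite_grid)
    fix y \<xi> v J assume J: "J \<in> JJ"
    then have finJ: "finite J" "card J = k"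
      unfolding JJ_def using finite_subset[OF _ finite_words] by blast+
    have "card (J \<rightarrow>\<^sub>E {1..m}) = m ^ k" using finJ by (simp add: card_PiE)
    moreover have "card (\<Union>\<iota>\<in>J \<rightarrow>\<^sub>E {1..m}. S' y \<xi> v J \<iota>) \<le> card (J \<rightarrow>\<^sub>E {1..m}) *
        (card (grid 1 \<delta>) ^ (m - k) * (2 * nat \<lceil>2 * c / D\<rceil> + 1) ^ k)"
    proof (rule card_UN_le_mult)
      show "finite (J \<rightarrow>\<^sub>E {1..m})" using finJ by (intro finite_PiE) auto
      fix \<iota> assume \<iota>: "\<iota> \<in> J \<rightarrow>\<^sub>E {1..m}"
      show "card (S' y \<xi> v J \<iota>) \<le> card (grid 1 \<delta>) ^ (m - k) * (2 * nat \<lceil>2 * c / D\<rceil> + 1) ^ k"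
      proof (cases "transversal l A g k D (\<delta> * real_of_int y) (\<chi> i. \<delta> * real_of_int (v i)) J \<iota>")
        case True
        have "\<iota> \<in> J \<rightarrow> {1..m}" using \<iota> by auto
        from card_transversal_solutions_le[OF \<delta> D finJ this True]
        show ?thesis using True unfolding S'_def S_def by (simp only: if_True)
      qed (simp add: S'_def)
    qed
    ultimately show "card (\<Union>\<iota>\<in>J \<rightarrow>\<^sub>E {1..m}. S' y \<xi> v J \<iota>) \<le> m ^ k *
        (card (grid 1 \<delta>) ^ (m - k) * (2 * nat \<lceil>2 * c / D\<rceil> + 1) ^ k)" by simp
  qed
  also have "\<dots> \<le> card (grid 2 \<delta>) * (card (grid B \<delta>) * (card V * ((l ^ n) ^ k * (m ^ k *
      (card (grid 1 \<delta>) ^ (m - k) * (2 * nat \<lceil>2 * c / D\<rceil> + 1) ^ k)))))"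
    using cJJ by (intro mult_le_mono order_refl)
  finally show ?thesis by (simp add: cV)
qed

definition cell :: "nat \<Rightarrow> real \<Rightarrow> (nat \<Rightarrow> int) \<Rightarrow> (nat \<Rightarrow> real) set" where
  "cell m \<delta> u = (\<Pi>\<^sub>E i\<in>{1..m}. {\<delta> * real_of_int (u i)..\<delta> * real_of_int (u i) + \<delta>})"

interpretation lborel_product: product_sigma_finite "\<lambda>_ :: nat. lborel :: real measure" ..

lemma cell_sets: "cell m \<delta> u \<in> sets (\<Pi>\<^sub>M i\<in>{1..m}. lborel)"
  unfolding cell_def by (intro sets_PiM_I_finite) auto

lemma emeasure_cell:
  assumes "\<delta> \<ge> 0"
  shows "emeasure (\<Pi>\<^sub>M i\<in>{1..m}. lborel) (cell m \<delta> u) = ennreal (\<delta> ^ m)"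
  unfolding cell_def using assms
  by (subst lborel_product.emeasure_PiM) (auto simp: ennreal_power)

text \<open>
  There are of the order of \<open>\<delta>^(-d-2)\<close> grid points \<open>(y, \<xi>, \<eta>)\<close> and at most \<open>l^(nk)\<close> sets of \<open>k\<close> words, while each
  configuration occupies a proportion \<open>\<delta>\<^sup>k\<close> of the parameters.
\<close>

lemma measure_bad_cells_le:
  fixes A :: "real ^ 'n ^ 'n"
  assumes \<delta>: "0 < \<delta>" "\<delta> \<le> 1" and D: "D > 0" and B: "B \<ge> 0" and k: "k = e + CARD('n) + 2"
  shows "emeasure (\<Pi>\<^sub>M i\<in>{1..m}. lborel) (\<Union>u\<in>bad_cells l A m f g k D B c \<delta> n. cell m \<delta> u)
    \<le> ennreal (7 * (2 * B + 3) * 5 ^ CARD('n) * real m ^ k * 5 ^ m * (2 * real (nat \<lceil>2 * c / D\<rceil>) + 1) ^ k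
        * (\<delta> ^ e * real (l ^ n) ^ k))"
proof -
  let ?M = "\<Pi>\<^sub>M i\<in>{1..m}. (lborel :: real measure)"
  define bad where "bad = bad_cells l A m f g k D B c \<delta> n"
  define w where "w = 2 * real (nat \<lceil>2 * c / D\<rceil>) + 1"
  have finb: "finite bad"
    unfolding bad_def bad_cells_def by (rule finite_subset[of _ "{1..m} \<rightarrow>\<^sub>E grid 1 \<delta>"]) (auto intro: finite_PiE)
  have "emeasure ?M (\<Union>u\<in>bad. cell m \<delta> u) \<le> (\<Sum>u\<in>bad. emeasure ?M (cell m \<delta> u))"
    by (intro emeasure_subadditive_finite[OF finb] image_subsetI cell_sets)
  also have "\<dots> = (\<Sum>u\<in>bad. ennreal (\<delta> ^ m))" using \<delta> by (simp only: emeasure_cell less_imp_le)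
  also have "\<dots> = ennreal (real (card bad) * \<delta> ^ m)"
    using \<delta> by (simp add: ennreal_mult ennreal_of_nat_eq_real_of_nat)
  also have "\<dots> \<le> ennreal (7 * (2 * B + 3) * 5 ^ CARD('n) * real m ^ k * 5 ^ m * w ^ k * (\<delta> ^ e * real (l ^ n) ^ k))"
  proof (intro ennreal_leI)
    show "real (card bad) * \<delta> ^ m \<le> 7 * (2 * B + 3) * 5 ^ CARD('n) * real m ^ k * 5 ^ m * w ^ k * (\<delta> ^ e * real (l ^ n) ^ k)"
    proof (cases "bad = {}")
      case True
      then show ?thesis using \<delta> B by (simp add: w_def)
    next
      case False
      have "k \<le> m"
      proof -
        from False obtain J \<iota> y \<eta> where J: "J \<subseteq> words l n" "card J = k" "\<iota> \<in> J \<rightarrow>\<^sub>E {1..m}" "transversal l A g k D y \<eta> J \<iota>"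
          unfolding bad_def bad_cells_def by blast
        have "card J \<le> card {1..m}"
          using J transversal_inj[OF J(4) D] by (intro card_inj_on_le[of \<iota>]) auto
        then show ?thesis using J by simp
      qed
      have dm: "\<delta> ^ m = \<delta> ^ (m - k) * (\<delta> ^ e * \<delta> ^ CARD('n) * \<delta> * \<delta>)"
      proof -
        have "\<delta> ^ m = \<delta> ^ (m - k) * \<delta> ^ k" using \<open>k \<le> m\<close> by (simp add: power_add[symmetric])
        then show ?thesis by (simp add: k power_add power2_eq_square mult.assoc)
      qed
      define G1 where "G1 = real (card (grid 1 \<delta>))"
      have G1: "G1 \<le> 5 / \<delta>" "0 \<le> G1" using card_grid_le[of \<delta> 1] \<delta> by (auto simp: G1_def)
      have "real (card bad) \<le> real (card (grid 2 \<delta>) * (card (grid B \<delta>) * (card (grid 1 \<delta>) ^ CARD('n) * ((l ^ n) ^ k * (m ^ k *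
        (card (grid 1 \<delta>) ^ (m - k) * (2 * nat \<lceil>2 * c / D\<rceil> + 1) ^ k))))))"
        unfolding bad_def by (intro of_nat_mono card_bad_cells_le \<delta> D)
      also have "\<dots> = real (card (grid 2 \<delta>)) * (real (card (grid B \<delta>)) * (G1 ^ CARD('n) * (real (l ^ n) ^ k * (real m ^ k *
        (G1 ^ (m - k) * w ^ k)))))"
        by (simp add: G1_def w_def add.commute)
      also have "\<dots> \<le> (7 / \<delta>) * (((2 * B + 3) / \<delta>) * ((5 / \<delta>) ^ CARD('n) * (real (l ^ n) ^ k * (real m ^ k *
        ((5 / \<delta>) ^ (m - k) * w ^ k)))))"
        using card_grid_le[OF \<delta>, of 2] card_grid_le[OF \<delta> B] G1 \<delta> B
        by (intro mult_mono power_mono order_refl mult_nonneg_nonneg zero_le_power) (auto simp: w_def)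
      finally have "real (card bad) * \<delta> ^ m \<le> (7 / \<delta>) * (((2 * B + 3) / \<delta>) * ((5 / \<delta>) ^ CARD('n) * (real (l ^ n) ^ k * (real m ^ k *
        ((5 / \<delta>) ^ (m - k) * w ^ k))))) * \<delta> ^ m"
        using \<delta> by (intro mult_right_mono) auto
      also have "\<dots> = 7 * (2 * B + 3) * 5 ^ CARD('n) * real m ^ k * 5 ^ (m - k) * w ^ k * (\<delta> ^ e * real (l ^ n) ^ k)"
        unfolding dm using \<delta> by (simp add: power_divide field_simps)
      also have "\<dots> \<le> 7 * (2 * B + 3) * 5 ^ CARD('n) * real m ^ k * 5 ^ m * w ^ k * (\<delta> ^ e * real (l ^ n) ^ k)"
        using B \<delta> by (intro mult_right_mono mult_left_mono power_increasing) (auto simp: w_def)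
      finally show ?thesis .
    qed
  qed
  finally show ?thesis unfolding bad_def w_def .
qed

text \<open>
  Normalise \<open>\<eta>\<close>, after which \<open>\<xi>\<close> is bounded and the concentration is of size \<open>(\<rho>/l)\<^sup>n = \<delta>\<close>, the mesh of the grid. Hence
  rounding \<open>y\<close>, \<open>\<xi>\<close>, \<open>\<eta>\<close> and \<open>t\<close> to the grid costs only a constant factor, collected in \<open>c\<close>. The transversal
  words are selected after the rounding, at the grid point.
\<close>

lemma bad_parameter_in_bad_cell:
  fixes A :: "real ^ 'n ^ 'n" and m :: nat
  defines "d \<equiv> real CARD('n)"
  assumes l: "l \<ge> 2" and C: "C \<ge> 1" and \<rho>: "0 < \<rho>" "\<rho> < 1"
    and decay: "\<And>n v. norm (matpow A n *v v) \<le> C * \<rho> ^ n * norm v"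
    and F: "F = perturb m f g t"
    and bnd: "\<And>x. norm (F x) \<le> \<kappa>" and lip: "\<And>x y. norm (F x - F y) \<le> \<kappa> * \<bar>x - y\<bar>"
    and \<Gamma>: "\<Gamma> \<ge> 0" "\<And>i x. norm (g i x) \<le> \<Gamma>"
    and t: "t \<in> {1..m} \<rightarrow>\<^sub>E {-1..1}"
    and \<delta>: "\<delta> = (\<rho> / real l) ^ n" "\<delta> * d \<le> 1 / 2"
    and trans: "\<And>y \<eta> V. 1 / 2 \<le> norm \<eta> \<Longrightarrow> norm \<eta> \<le> 2 \<Longrightarrow> V \<subseteq> words l n \<Longrightarrow> inj_on (take N) V \<Longrightarrow>
      K \<le> card V \<Longrightarrow> \<exists>J \<iota>. J \<subseteq> V \<and> card J = k \<and> \<iota> \<in> J \<rightarrow>\<^sub>E {1..m} \<and> transversal l A g k D y \<eta> J \<iota>"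
    and y: "y \<in> {-1..2}" and K: "1 \<le> K" "K \<le> card (take N ` near_words l A F C1 n y \<xi> \<eta>)"
    and C1: "C1 \<ge> 0"
    and B: "B = C * \<kappa> + C1 * C" and c: "c = C1 * C + 1 + d * (C * \<kappa>) + 2 * (C * \<kappa>) + 2 * (real m * (C * \<Gamma>))"
  shows "\<exists>u\<in>bad_cells l A m f g k D B c \<delta> n. t \<in> cell m \<delta> u"
proof -
  have \<kappa>: "\<kappa> \<ge> 0" using order_trans[OF norm_ge_zero bnd] .
  have l1: "real l \<ge> 1" using l by simp
  have \<delta>0: "0 < \<delta>" "\<delta> \<le> 1"
  proof -
    have "\<rho> / real l \<le> 1" using \<rho> l1 by (simp add: field_simps)
    then show "0 < \<delta>" "\<delta> \<le> 1" using \<rho> l unfolding \<delta>(1) by (auto intro!: power_le_one)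
  qed
  have dec: "norm (matpow A n *v v) \<le> C * norm v" for n v
  proof -
    have "C * \<rho> ^ n * norm v \<le> C * 1 * norm v"
      using \<rho> C by (intro mult_right_mono mult_left_mono power_le_one) auto
    with decay[of n v] show ?thesis by simp
  qed
  define W where "W = near_words l A F C1 n y \<xi> \<eta>"
  have "take N ` W \<noteq> {}" using K unfolding W_def by (metis card.empty not_one_le_zero order_trans)
  then obtain b0 where b0: "b0 \<in> W" by blast
  have \<eta>0: "norm \<eta> > 0" using b0 by (auto simp: W_def near_words_def)
  define \<eta>1 where "\<eta>1 = (1 / norm \<eta>) *\<^sub>R \<eta>"
  define \<xi>1 where "\<xi>1 = \<xi> / norm \<eta>"
  have \<eta>1: "norm \<eta>1 = 1" using \<eta>0 by (simp add: \<eta>1_def)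
  have scaled: "\<bar>\<xi>1 + \<eta>1 \<bullet> dS l A F b y\<bar> \<le> C1 * C * \<delta>" if b: "b \<in> W" for b
  proof -
    have "\<xi>1 + \<eta>1 \<bullet> dS l A F b y = (\<xi> + \<eta> \<bullet> dS l A F b y) / norm \<eta>"
      by (simp add: \<xi>1_def \<eta>1_def add_divide_distrib)
    then have "\<bar>\<xi>1 + \<eta>1 \<bullet> dS l A F b y\<bar> = \<bar>\<xi> + \<eta> \<bullet> dS l A F b y\<bar> / norm \<eta>"
      by (simp add: abs_divide)
    also have "\<dots> \<le> (C1 / real l ^ n * norm (transpose (matpow A n) *v \<eta>)) / norm \<eta>"
      using b by (intro divide_right_mono) (auto simp: W_def near_words_def)
    also have "\<dots> \<le> (C1 / real l ^ n * (C * \<rho> ^ n * norm \<eta>)) / norm \<eta>"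
      using transpose_matpow_decay[of A n "C * \<rho> ^ n" \<eta>] decay C1 l
      by (intro divide_right_mono mult_left_mono) auto
    also have "\<dots> = C1 * C * \<delta>" using \<eta>0 by (simp add: \<delta> power_divide)
    finally show ?thesis .
  qed
  have dSb: "norm (dS l A F b z) \<le> C * \<kappa>" for b z
    using norm_dS_le[OF l dec _ \<kappa>] bnd C by simp
  have \<xi>B: "\<bar>\<xi>1\<bar> \<le> B"
  proof -
    have "\<bar>\<eta>1 \<bullet> dS l A F b0 y\<bar> \<le> C * \<kappa>"
      using Cauchy_Schwarz_ineq2[of \<eta>1 "dS l A F b0 y"] dSb[of b0 y] \<eta>1 by simp
    moreover have "C1 * C * \<delta> \<le> C1 * C * 1" using C C1 \<delta>0 by (intro mult_left_mono) auto
    ultimately show ?thesis using scaled[OF b0] unfolding B by linarith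
  qed
  define yi \<xi>i where "yi = \<lfloor>y / \<delta>\<rfloor>" and "\<xi>i = \<lfloor>\<xi>1 / \<delta>\<rfloor>"
  define v where "v = (\<lambda>i. \<lfloor>(\<eta>1 $ i) / \<delta>\<rfloor>)"
  define u where "u = restrict (\<lambda>i. \<lfloor>t i / \<delta>\<rfloor>) {1..m}"
  define y2 \<xi>2 where "y2 = \<delta> * real_of_int yi" and "\<xi>2 = \<delta> * real_of_int \<xi>i"
  define \<eta>2 where "\<eta>2 = (\<chi> i. \<delta> * real_of_int (v i))"
  define t2 where "t2 = (\<lambda>i. \<delta> * real_of_int (u i))"
  have gy: "yi \<in> grid 2 \<delta>" unfolding yi_def using y \<delta>0 by (intro floor_in_grid) auto
  have g\<xi>: "\<xi>i \<in> grid B \<delta>" unfolding \<xi>i_def using \<xi>B \<delta>0 by (intro floor_in_grid)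
  have gv: "v \<in> UNIV \<rightarrow>\<^sub>E grid 1 \<delta>"
    unfolding v_def using component_le_norm_cart[of \<eta>1] \<eta>1 \<delta>0 by (auto intro!: floor_in_grid)
  have t1: "\<bar>t i\<bar> \<le> 1" if "i \<in> {1..m}" for i
    using t that by (auto simp: abs_le_iff PiE_iff)
  have gu: "u \<in> {1..m} \<rightarrow>\<^sub>E grid 1 \<delta>"
    unfolding u_def using t1 \<delta>0 by (auto intro!: floor_in_grid)
  have ey: "\<bar>y2 - y\<bar> \<le> \<delta>" using floor_grid_error(1)[OF \<delta>0(1), of y] by (simp add: y2_def yi_def abs_minus_commute)
  have e\<xi>: "\<bar>\<xi>2 - \<xi>1\<bar> \<le> \<delta>" using floor_grid_error(1)[OF \<delta>0(1), of \<xi>1] by (simp add: \<xi>2_def \<xi>i_def abs_minus_commute)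
  have e\<eta>: "norm (\<eta>2 - \<eta>1) \<le> d * \<delta>"
  proof -
    have "norm (\<eta>2 - \<eta>1) \<le> (\<Sum>i\<in>UNIV. \<bar>(\<eta>2 - \<eta>1) $ i\<bar>)" by (rule norm_le_l1_cart)
    also have "\<dots> \<le> (\<Sum>i\<in>(UNIV::'n set). \<delta>)"
      using floor_grid_error(1)[OF \<delta>0(1)] by (intro sum_mono) (simp add: \<eta>2_def v_def abs_minus_commute)
    finally show ?thesis by (simp add: d_def)
  qed
  have n\<eta>: "1 / 2 \<le> norm \<eta>2" "norm \<eta>2 \<le> 2"
    using e\<eta> \<delta>(2) \<eta>1 norm_triangle_ineq2[of \<eta>1 \<eta>2] norm_triangle_ineq2[of \<eta>2 \<eta>1] norm_minus_commute[of \<eta>1 \<eta>2]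
    by (simp_all add: mult.commute)
  have et: "\<bar>t2 i - t i\<bar> \<le> \<delta>" if "i \<in> {1..m}" for i
    using floor_grid_error(1)[OF \<delta>0(1), of "t i"] that by (simp add: t2_def u_def abs_minus_commute)
  have approx: "\<bar>\<xi>2 + \<eta>2 \<bullet> dS l A (perturb m f g t2) b y2\<bar> \<le> c * \<delta>" if b: "b \<in> W" for b
  proof -
    have 1: "\<bar>(\<eta>2 - \<eta>1) \<bullet> dS l A F b y\<bar> \<le> d * \<delta> * (C * \<kappa>)"
      using Cauchy_Schwarz_ineq2 e\<eta> dSb[of b y] \<delta>0 d_def
      by (intro order_trans[OF Cauchy_Schwarz_ineq2] mult_mono) auto
    have "norm (dS l A F b y2 - dS l A F b y) \<le> C * \<kappa> * \<bar>y2 - y\<bar>"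
      using C by (intro dS_lipschitz l dec \<kappa> lip) auto
    also have "\<dots> \<le> C * \<kappa> * \<delta>" using ey C \<kappa> by (intro mult_left_mono) auto
    finally have 2: "\<bar>\<eta>2 \<bullet> (dS l A F b y2 - dS l A F b y)\<bar> \<le> 2 * (C * \<kappa> * \<delta>)"
      using n\<eta> by (intro order_trans[OF Cauchy_Schwarz_ineq2] mult_mono) auto
    have "dS l A (perturb m f g t2) b y2 - dS l A F b y2 = (\<Sum>i = 1..m. (t2 i - t i) *\<^sub>R dS l A (g i) b y2)"
      unfolding F dS_affine by (simp add: sum_subtractf[symmetric] scaleR_diff_left)
    also have "norm \<dots> \<le> (\<Sum>i = 1..m. \<delta> * (C * \<Gamma>))"
    proof (intro sum_norm_le)
      fix i assume i: "i \<in> {1..m}"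
      have "norm (dS l A (g i) b y2) \<le> C * \<Gamma>" using norm_dS_le[OF l dec _ \<Gamma>(1)] \<Gamma>(2) C by simp
      then show "norm ((t2 i - t i) *\<^sub>R dS l A (g i) b y2) \<le> \<delta> * (C * \<Gamma>)"
        using et[OF i] \<delta>0 by (simp add: mult_mono)
    qed
    also have "\<dots> = real m * (C * \<Gamma>) * \<delta>" by simp
    finally have 3: "\<bar>\<eta>2 \<bullet> (dS l A (perturb m f g t2) b y2 - dS l A F b y2)\<bar> \<le> 2 * (real m * (C * \<Gamma>) * \<delta>)"
      using n\<eta> by (intro order_trans[OF Cauchy_Schwarz_ineq2] mult_mono) auto
    have "\<xi>2 + \<eta>2 \<bullet> dS l A (perturb m f g t2) b y2 =
        (\<xi>1 + \<eta>1 \<bullet> dS l A F b y) + (\<xi>2 - \<xi>1) + (\<eta>2 - \<eta>1) \<bullet> dS l A F b y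
        + \<eta>2 \<bullet> (dS l A F b y2 - dS l A F b y) + \<eta>2 \<bullet> (dS l A (perturb m f g t2) b y2 - dS l A F b y2)"
      by (simp add: inner_diff_left inner_diff_right)
    then have "\<bar>\<xi>2 + \<eta>2 \<bullet> dS l A (perturb m f g t2) b y2\<bar> \<le>
        C1 * C * \<delta> + \<delta> + d * \<delta> * (C * \<kappa>) + 2 * (C * \<kappa> * \<delta>) + 2 * (real m * (C * \<Gamma>) * \<delta>)"
      using scaled[OF b] e\<xi> 1 2 3 by linarith
    also have "\<dots> = c * \<delta>" by (simp add: c algebra_simps)
    finally show ?thesis .
  qed
  \<comment> \<open>one word for each prefix of length \<open>N\<close>\<close>
  obtain V where V: "V \<subseteq> W" "inj_on (take N) V" "take N ` W = take N ` V"
    using subset_image_inj[of "take N ` W" "take N" W] by auto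
  have "K \<le> card V" using K(2) V card_image[OF V(2)] by (simp add: W_def)
  moreover have "V \<subseteq> words l n" using V(1) by (auto simp: W_def near_words_def)
  ultimately obtain J \<iota> where J: "J \<subseteq> V" "card J = k" "\<iota> \<in> J \<rightarrow>\<^sub>E {1..m}" "transversal l A g k D y2 \<eta>2 J \<iota>"
    using trans[OF n\<eta> _ V(2), of y2] by blast
  have JW: "J \<subseteq> words l n" using J(1) \<open>V \<subseteq> words l n\<close> by blast
  have "u \<in> bad_cells l A m f g k D B c \<delta> n"
    unfolding bad_cells_def mem_Collect_eq
  proof (intro conjI gu bexI[OF _ gy] bexI[OF _ g\<xi>] bexI[OF _ gv] bexI[of _ J] bexI[OF _ J(3)])
    show "transversal l A g k D (\<delta> * real_of_int yi) (\<chi> i. \<delta> * real_of_int (v i)) J \<iota>"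
      using J(4) unfolding y2_def \<eta>2_def .
    show "\<forall>b\<in>J. \<bar>\<delta> * real_of_int \<xi>i + (\<chi> i. \<delta> * real_of_int (v i)) \<bullet>
        dS l A (perturb m f g (\<lambda>i. \<delta> * real_of_int (u i))) b (\<delta> * real_of_int yi)\<bar> \<le> c * \<delta>"
    proof
      fix b assume "b \<in> J"
      then have "b \<in> W" using J(1) V(1) by blast
      from approx[OF this] show "\<bar>\<delta> * real_of_int \<xi>i + (\<chi> i. \<delta> * real_of_int (v i)) \<bullet>
        dS l A (perturb m f g (\<lambda>i. \<delta> * real_of_int (u i))) b (\<delta> * real_of_int yi)\<bar> \<le> c * \<delta>"
        unfolding y2_def \<xi>2_def \<eta>2_def t2_def .
    qed
    show "J \<in> {J. J \<subseteq> words l n \<and> card J = k}" using JW J(2) by simp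
  qed
  moreover have "t \<in> cell m \<delta> u"
    unfolding cell_def
  proof (rule PiE_I)
    fix i assume "i \<in> {1..m}"
    then show "t i \<in> {\<delta> * real_of_int (u i)..\<delta> * real_of_int (u i) + \<delta>}"
      using floor_grid_error(2,3)[OF \<delta>0(1), of "t i"] by (simp add: u_def)
  next
    fix i assume "i \<notin> {1..m}"
    then show "t i = undefined" using t by (rule PiE_arb[rotated])
  qed
  ultimately show ?thesis by blast
qed

section \<open>From separated subtrees to the multiplicity\<close>

text \<open>
  The set of suffixes of concentrated words with a common prefix \<open>v\<close> is again a set of concentrated words, for
  the base point, \<open>\<xi>\<close> and \<open>\<eta>\<close> transported along \<open>v\<close>, and with exactly the same constant. So the tree of concentrated
  words branches at most \<open>K\<close>-fold in \<open>N\<close> steps, until fewer than \<open>Q\<close> letters remain.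
\<close>

lemma card_near_words_le:
  fixes A :: "real ^ 'n ^ 'n"
  assumes l: "l \<ge> 2" and N: "1 \<le> N" "N \<le> Q" and K: "1 \<le> K"
    and good: "\<And>n y \<xi> \<eta>. Q \<le> n \<Longrightarrow> y \<in> {-1..2} \<Longrightarrow> card (take N ` near_words l A F C n y \<xi> \<eta>) \<le> K"
    and y: "y \<in> {-1..2}"
  shows "card (near_words l A F C n y \<xi> \<eta>) \<le> l ^ Q * K ^ (n div N)"
  using y
proof (induction n arbitrary: y \<xi> \<eta> rule: less_induct)
  case (less n)
  have sub: "near_words l A F C n y \<xi> \<eta> \<subseteq> words l n" by (auto simp: near_words_def)
  show ?case
  proof (cases "n < Q")
    case True
    have "card (near_words l A F C n y \<xi> \<eta>) \<le> l ^ n"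
      using card_mono[OF finite_words sub] by (simp add: card_words)
    also have "\<dots> \<le> l ^ Q" using True l by (intro power_increasing) auto
    also have "\<dots> \<le> l ^ Q * K ^ (n div N)" using K by simp
    finally show ?thesis .
  next
    case False
    then have n: "N \<le> n" "Q \<le> n" using N by auto
    define P where "P = take N ` near_words l A F C n y \<xi> \<eta>"
    define tl where "tl = (\<lambda>v. near_words l A F C (n - N) (branch l v y) (\<xi> + \<eta> \<bullet> dS l A F v y)
      ((1 / real l ^ N) *\<^sub>R (transpose (matpow A N) *v \<eta>)))"
    have finP: "finite P" unfolding P_def using finite_subset[OF sub] by simp
    have "near_words l A F C n y \<xi> \<eta> \<subseteq> (\<Union>v\<in>P. (\<lambda>b. v @ b) ` tl v)"
    proof
      fix a assume a: "a \<in> near_words l A F C n y \<xi> \<eta>"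
      define v b where "v = take N a" and "b = drop N a"
      have ab: "a = v @ b" by (simp add: v_def b_def)
      have aw: "a \<in> words l n" using a sub by blast
      then have vl: "length v = N" and bw: "b \<in> words l (n - N)"
        using n words_drop[OF aw, of N] by (auto simp: v_def b_def words_def)
      have pow: "matpow A n = matpow A N ** matpow A (n - N)" using n by (simp add: matpow_add[symmetric])
      define \<eta>' where "\<eta>' = (1 / real l ^ N) *\<^sub>R (transpose (matpow A N) *v \<eta>)"
      have val_eq: "\<xi> + \<eta> \<bullet> dS l A F a y = \<xi> + \<eta> \<bullet> dS l A F v y + \<eta>' \<bullet> dS l A F b (branch l v y)"
        unfolding ab dS_append inner_add_right inner_scaleR_right inner_scaleR_left \<eta>'_def
          inner_matrix_vector_transpose vl by simp
      have "transpose (matpow A (n - N)) *v \<eta>' = (1 / real l ^ N) *\<^sub>R (transpose (matpow A n) *v \<eta>)"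
        unfolding pow matrix_transpose_mul matrix_vector_mul_assoc[symmetric] matrix_vector_mult_scaleR \<eta>'_def ..
      then have "C / real l ^ (n - N) * norm (transpose (matpow A (n - N)) *v \<eta>')
        = C / (real l ^ (n - N) * real l ^ N) * norm (transpose (matpow A n) *v \<eta>)"
        by simp
      also have "real l ^ (n - N) * real l ^ N = real l ^ n" using n by (simp add: power_add[symmetric])
      finally have size: "C / real l ^ (n - N) * norm (transpose (matpow A (n - N)) *v \<eta>')
        = C / real l ^ n * norm (transpose (matpow A n) *v \<eta>)" .
      have "\<bar>\<xi> + \<eta> \<bullet> dS l A F a y\<bar> < C / real l ^ n * norm (transpose (matpow A n) *v \<eta>)"
        using a unfolding near_words_def by blast
      then have "\<bar>\<xi> + \<eta> \<bullet> dS l A F v y + \<eta>' \<bullet> dS l A F b (branch l v y)\<bar>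
          < C / real l ^ (n - N) * norm (transpose (matpow A (n - N)) *v \<eta>')"
        by (simp only: val_eq size)
      then have "b \<in> near_words l A F C (n - N) (branch l v y) (\<xi> + \<eta> \<bullet> dS l A F v y) \<eta>'"
        unfolding near_words_def mem_Collect_eq by (rule conjI[OF bw])
      then have btl: "b \<in> tl v" by (simp only: tl_def \<eta>'_def)
      have "v \<in> P" using a unfolding P_def v_def by (rule imageI)
      then show "a \<in> (\<Union>v\<in>P. (\<lambda>b. v @ b) ` tl v)" by (rule UN_I) (rule image_eqI[where f = "\<lambda>b. v @ b", OF ab btl])
    qed
    moreover have fintl: "finite (tl v)" for v
      by (rule finite_subset[OF _ finite_words[of l "n - N"]]) (auto simp: tl_def near_words_def)
    ultimately have "card (near_words l A F C n y \<xi> \<eta>) \<le> card (\<Union>v\<in>P. (\<lambda>b. v @ b) ` tl v)"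
      using finP by (intro card_mono) auto
    also have "\<dots> \<le> card P * (l ^ Q * K ^ ((n - N) div N))"
    proof (rule card_UN_le_mult[OF finP])
      fix v assume "v \<in> P"
      then have "v \<in> words l N" using sub n words_take by (force simp: P_def)
      then have "branch l v y \<in> {-1..2}" by (rule branch_in_interval[OF l _ less.prems])
      then have "card (tl v) \<le> l ^ Q * K ^ ((n - N) div N)"
        unfolding tl_def using n N by (intro less.IH) auto
      then show "card ((\<lambda>b. v @ b) ` tl v) \<le> l ^ Q * K ^ ((n - N) div N)"
        using card_image_le[OF fintl] order_trans by blast
    qed
    also have "\<dots> \<le> K * (l ^ Q * K ^ ((n - N) div N))"
      using good[OF n(2) less.prems] unfolding P_def by (intro mult_right_mono) auto
    also have "\<dots> = l ^ Q * K ^ (n div N)"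
    proof -
      have "n div N = Suc ((n - N) div N)" using n N by (simp add: le_div_geq)
      then show ?thesis by simp
    qed
    finally show ?thesis .
  qed
qed

text \<open>
  For fixed \<open>q\<close> the generation \<open>p\<close> may be as large as needed. The base points of different words then lie so
  close together that replacing them by a single point \<open>x0\<close> changes the sums by at most
  \<open>\<sigma>\<^sup>q / l\<^sup>q\<close> times the norm of \<open>\<eta>\<close>, which increases the constant \<open>2 \<alpha>\<close> by at most 1.
\<close>

lemma conc_mult_le:
  fixes A :: "real ^ 'n ^ 'n"
  assumes l: "l \<ge> 2" and C: "C \<ge> 1" and \<sigma>: "0 < \<sigma>"
    and decay: "\<And>n v. norm (matpow A n *v v) \<le> C * norm v"
    and lower: "\<And>n \<eta>. \<sigma> ^ n * norm \<eta> \<le> norm (transpose (matpow A n) *v \<eta>)"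
    and \<phi>: "\<And>x. (\<phi> has_vector_derivative F x) (at x)"
    and \<kappa>: "\<kappa> \<ge> 0" and lip: "\<And>x y. norm (F x - F y) \<le> \<kappa> * \<bar>x - y\<bar>"
    and M: "\<And>y \<xi> \<eta>. y \<in> {-1..2} \<Longrightarrow>
      card (near_words l A F (2 * \<bar>alpha \<kappa>' A\<bar> + 1) q y \<xi> \<eta>) \<le> M"
  shows "conc_mult l \<kappa>' A \<phi> q \<le> M"
proof -
  have lq: "real l ^ q > 0" using l by simp
  have pos: "0 < 2 * C * \<kappa> + 1" using C \<kappa> by (simp add: add_nonneg_pos)
  obtain p0 where "(1 / real l) ^ p0 < \<sigma> ^ q / real l ^ q / (2 * C * \<kappa> + 1)"
    using real_arch_pow_inv[of "\<sigma> ^ q / real l ^ q / (2 * C * \<kappa> + 1)" "1 / real l"] \<sigma> lq pos l by auto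
  moreover have "(1 / real l) ^ Suc p0 \<le> (1 / real l) ^ p0"
    using l by (intro power_decreasing) auto
  ultimately obtain p where p: "p \<ge> 1" "1 / real l ^ p < \<sigma> ^ q / real l ^ q / (2 * C * \<kappa> + 1)"
    by (metis le_less_trans power_one_over le_add1 plus_1_eq_Suc)
  have p2: "2 * C * \<kappa> * (1 / real l ^ p) \<le> \<sigma> ^ q / real l ^ q"
  proof -
    have "1 / real l ^ p * (2 * C * \<kappa> + 1) < \<sigma> ^ q / real l ^ q"
      using p(2) pos by (simp only: pos_less_divide_eq)
    then have "(2 * C * \<kappa> + 1) * (1 / real l ^ p) \<le> \<sigma> ^ q / real l ^ q"
      by (subst mult.commute) (rule less_imp_le)
    moreover have "0 \<le> 1 / real l ^ p" by simp
    ultimately show ?thesis unfolding distrib_right by linarith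
  qed
  have "conc_mult l \<kappa>' A \<phi> q \<le> conc_mult2 l \<kappa>' A \<phi> p q"
    unfolding conc_mult_def using p by (intro cINF_lower) auto
  also have "\<dots> \<le> M"
  proof -
    have "(SUP (\<xi>, \<eta>). card (conc_words l \<kappa>' A \<phi> c q \<xi> \<eta>)) \<le> M" if c: "c \<in> words l p" for c
    proof (rule cSUP_least)
      fix w :: "int \<times> (real ^ 'n)"
      obtain \<xi> \<eta> where w: "w = (\<xi>, \<eta>)" by (cases w)
      define x0 where "x0 = branch l c 0"
      have x0: "x0 \<in> {-1..2}" unfolding x0_def by (rule branch_in_interval[OF l c]) simp
      have "conc_words l \<kappa>' A \<phi> c q \<xi> \<eta> \<subseteq> near_words l A F (2 * \<bar>alpha \<kappa>' A\<bar> + 1) q x0 (real_of_int \<xi>) \<eta>"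
      proof
        fix a assume "a \<in> conc_words l \<kappa>' A \<phi> c q \<xi> \<eta>"
        then obtain x where a: "a \<in> words l q" and x: "x \<in> cylinder_star l c"
          and h: "\<bar>real_of_int \<xi> + \<eta> \<bullet> dS l A F a x\<bar> < 2 * alpha \<kappa>' A / real l ^ q * norm (transpose (matpow A q) *v \<eta>)"
          unfolding conc_words_def using vector_derivative_S_ext[OF l _ c \<phi>] by auto
        define w where "w = norm (transpose (matpow A q) *v \<eta>)"
        have "norm (dS l A F a x0 - dS l A F a x) \<le> C * \<kappa> * \<bar>x0 - x\<bar>"
          using C by (intro dS_lipschitz l decay \<kappa> lip) auto
        also have "\<dots> \<le> C * \<kappa> * (2 / real l ^ p)"
          using cylinder_star_bounds(2)[OF l c x] C \<kappa> by (intro mult_left_mono) (auto simp: x0_def abs_minus_commute)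
        also have "\<dots> \<le> \<sigma> ^ q / real l ^ q" using p2 by (simp add: mult_ac)
        finally have "\<bar>\<eta> \<bullet> (dS l A F a x0 - dS l A F a x)\<bar> \<le> norm \<eta> * (\<sigma> ^ q / real l ^ q)"
          by (intro order_trans[OF Cauchy_Schwarz_ineq2] mult_left_mono) auto
        also have "\<dots> \<le> w / real l ^ q"
          using divide_right_mono[OF lower[of q \<eta>], of "real l ^ q"] by (simp add: w_def mult.commute)
        finally have e: "\<bar>\<eta> \<bullet> (dS l A F a x0 - dS l A F a x)\<bar> \<le> w / real l ^ q" .
        have "2 * alpha \<kappa>' A / real l ^ q * w \<le> 2 * \<bar>alpha \<kappa>' A\<bar> / real l ^ q * w"
          by (intro mult_right_mono divide_right_mono) (auto simp: w_def)
        with h have "\<bar>real_of_int \<xi> + \<eta> \<bullet> dS l A F a x\<bar> < 2 * \<bar>alpha \<kappa>' A\<bar> / real l ^ q * w"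
          unfolding w_def[symmetric] by linarith
        with e have "\<bar>real_of_int \<xi> + \<eta> \<bullet> dS l A F a x0\<bar> < 2 * \<bar>alpha \<kappa>' A\<bar> / real l ^ q * w + w / real l ^ q"
          unfolding inner_diff_right by linarith
        also have "\<dots> = (2 * \<bar>alpha \<kappa>' A\<bar> + 1) / real l ^ q * w" by (simp add: add_divide_distrib distrib_right)
        finally show "a \<in> near_words l A F (2 * \<bar>alpha \<kappa>' A\<bar> + 1) q x0 (real_of_int \<xi>) \<eta>"
          using a by (simp add: near_words_def w_def)
      qed
      moreover have "finite (near_words l A F (2 * \<bar>alpha \<kappa>' A\<bar> + 1) q x0 (real_of_int \<xi>) \<eta>)"
        by (rule finite_subset[OF _ finite_words[of l q]]) (auto simp: near_words_def)
      ultimately have "card (conc_words l \<kappa>' A \<phi> c q \<xi> \<eta>) \<le> M"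
        by (intro order_trans[OF card_mono M[OF x0]])
      then show "(case w of (\<xi>, \<eta>) \<Rightarrow> card (conc_words l \<kappa>' A \<phi> c q \<xi> \<eta>)) \<le> M" by (simp add: w)
    qed simp
    then show ?thesis unfolding conc_mult2_def using words_ne[of l p] l
      by (intro Max.boundedI) auto
  qed
  finally show ?thesis .
qed

lemma limsup_log_growth_le:
  assumes N: "N \<ge> 1" and K: "K \<ge> 1" and l: "l \<ge> 1"
    and M: "\<And>q. M q \<le> l ^ Q * K ^ (q div N)"
  shows "limsup (\<lambda>q. ereal (1 / real q * ln (real (M q)))) \<le> ereal (ln (real K) / real N)"
proof -
  have le: "1 / real q * ln (real (M q)) \<le> real Q * ln (real l) / real q + ln (real K) / real N" if q: "q \<ge> 1" for q
  proof -
    have lK: "0 \<le> ln (real K)" "0 \<le> ln (real l)" using K l by simp_all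
    have "ln (real (M q)) \<le> ln (real (l ^ Q * K ^ (q div N)))"
    proof (cases "M q = 0")
      case True
      have "1 \<le> l ^ Q * K ^ (q div N)" using l K by simp
      then have "1 \<le> real (l ^ Q * K ^ (q div N))" by linarith
      then show ?thesis using True by simp
    next
      case False
      moreover have "real (M q) \<le> real (l ^ Q * K ^ (q div N))" by (intro of_nat_mono M)
      ultimately show ?thesis by (intro ln_mono) auto
    qed
    also have "\<dots> = real Q * ln (real l) + real (q div N) * ln (real K)"
      using l K by (simp add: ln_mult ln_realpow)
    also have "\<dots> \<le> real Q * ln (real l) + (real q / real N) * ln (real K)"
      using lK of_nat_div_le_of_nat[of q N, where ?'a = real] by (intro add_left_mono mult_right_mono) auto
    finally have "1 / real q * ln (real (M q)) \<le> 1 / real q * (real Q * ln (real l) + (real q / real N) * ln (real K))"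
      by (intro mult_left_mono) auto
    also have "\<dots> = real Q * ln (real l) / real q + ln (real K) / real N"
      using q by (simp add: distrib_left)
    finally show ?thesis .
  qed
  have "limsup (\<lambda>q. ereal (1 / real q * ln (real (M q)))) \<le>
      limsup (\<lambda>q. ereal (real Q * ln (real l) / real q + ln (real K) / real N))"
    using le by (intro Limsup_mono) (auto simp: eventually_sequentially intro!: exI[of _ 1])
  also have "\<dots> = ereal (ln (real K) / real N)"
  proof (rule lim_imp_Limsup)
    have "(\<lambda>q. real Q * ln (real l) / real q + ln (real K) / real N) \<longlonglongrightarrow> 0 + ln (real K) / real N"
      by (intro tendsto_add tendsto_const lim_const_over_n)
    then show "(\<lambda>q. ereal (real Q * ln (real l) / real q + ln (real K) / real N)) \<longlonglongrightarrow> ereal (ln (real K) / real N)"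
      by simp
  qed simp
  finally show ?thesis .
qed

section \<open>Bounds for the derivatives of functions in the ball\<close>

text \<open>
  A periodic continuous function is bounded, so the suprema in the norm are genuine upper bounds. The
  Lipschitz bound comes from the second derivative, whence \<open>r \<ge> 2\<close>.
\<close>

lemma Ukappa_derivative_bounds:
  assumes \<phi>: "\<phi> \<in> Ukappa r \<kappa>" and r: "r \<ge> 2"
  shows "(\<phi> has_vector_derivative nth_vderiv 1 \<phi> x) (at x)"
    and "norm (nth_vderiv 1 \<phi> x) \<le> \<kappa>"
    and "norm (nth_vderiv 1 \<phi> x - nth_vderiv 1 \<phi> y) \<le> \<kappa> * \<bar>x - y\<bar>"
proof -
  have C: "\<phi> \<in> Cr_circle r" and N: "Cr_norm r \<phi> \<le> \<kappa>" using \<phi> by (auto simp: Ukappa_def)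
  have deriv: "(nth_vderiv k \<phi> has_vector_derivative nth_vderiv (Suc k) \<phi> x) (at x)" if "k < r" for k x
    using C that by (simp add: Cr_circle_def nth_vderiv_Suc vector_derivative_works[symmetric])
  have per: "nth_vderiv k \<phi> (x + 1) = nth_vderiv k \<phi> x" if "k \<le> r" for k x
    using that
  proof (induction k arbitrary: x)
    case 0
    then show ?case using C by (simp add: Cr_circle_def)
  next
    case (Suc k)
    have "((\<lambda>x. x + 1) has_vector_derivative 1) (at x)"
      by (auto intro!: derivative_eq_intros)
    from vector_diff_chain_at[OF this deriv[of k "x + 1"]] Suc
    have "(nth_vderiv k \<phi> has_vector_derivative nth_vderiv (Suc k) \<phi> (x + 1)) (at x)"
      by (simp add: o_def)
    then show ?case using deriv[of k x] Suc.prems vector_derivative_unique_at by force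
  qed
  have bound: "norm (nth_vderiv k \<phi> x) \<le> \<kappa>" if k: "k \<le> r" for k x
  proof -
    define h where "h = nth_vderiv k \<phi>"
    interpret h: periodic_fun_simple' h
      by unfold_locales (simp add: h_def per k)
    have "continuous_on {0..1} h" using C k by (auto simp: Cr_circle_def h_def intro: continuous_on_subset)
    then have "bounded (h ` {0..1})" by (intro compact_imp_bounded compact_continuous_image) auto
    then obtain B where B: "\<And>x. x \<in> {0..1} \<Longrightarrow> norm (h x) \<le> B"
      unfolding bounded_iff by blast
    have "norm (h x) \<le> B" for x
    proof -
      have "h x = h (frac x + of_int \<lfloor>x\<rfloor>)" by (simp add: frac_def)
      also have "\<dots> = h (frac x)" by (rule h.plus_of_int)
      finally show ?thesis using B[of "frac x"] by (simp add: less_imp_le frac_lt_1)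
    qed
    then have "bdd_above (range (\<lambda>x. norm (h x)))" by (auto simp: bdd_above_def)
    then have "norm (h x) \<le> (SUP x. norm (h x))" by (intro cSUP_upper) auto
    also have "\<dots> \<le> Cr_norm r \<phi>"
      unfolding Cr_norm_def h_def using k by (intro Max_ge) auto
    finally show ?thesis using N by (simp add: h_def)
  qed
  show "(\<phi> has_vector_derivative nth_vderiv 1 \<phi> x) (at x)" using deriv[of 0 x] r by simp
  show "norm (nth_vderiv 1 \<phi> x) \<le> \<kappa>" using bound r by simp
  have "norm (nth_vderiv 1 \<phi> x - nth_vderiv 1 \<phi> y) \<le> \<kappa> * norm (x - y)"
  proof (rule differentiable_bound[of UNIV])
    show "(nth_vderiv 1 \<phi> has_derivative (\<lambda>h. h *\<^sub>R nth_vderiv 2 \<phi> x)) (at x within UNIV)" for x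
      using deriv[of 1 x] r by (simp add: has_vector_derivative_def numeral_2_eq_2)
    show "onorm (\<lambda>h. h *\<^sub>R nth_vderiv 2 \<phi> x) \<le> \<kappa>" for x
      using bound[of 2 x] r by (intro onorm_le) (simp add: mult.commute[of \<kappa>] mult_left_mono)
  qed auto
  then show "norm (nth_vderiv 1 \<phi> x - nth_vderiv 1 \<phi> y) \<le> \<kappa> * \<bar>x - y\<bar>" by simp
qed

section \<open>Choice of the constants and conclusion\<close>

text \<open>
  Since both sides of the condition on \<open>T\<close> are exponential in \<open>N\<close>, a \<open>T\<close> that is linear in \<open>N\<close> satisfies it. The number
  of words needed for the selection is then linear in \<open>N\<close> as well, and its logarithm is negligible against
  \<open>\<beta> N\<close>.
\<close>

lemma exists_parameters:
  fixes \<beta> \<sigma> \<rho> C0 c0 :: real and k l :: nat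
  assumes "\<beta> > 0" "0 < \<sigma>" "\<sigma> \<le> 1" "0 < \<rho>" "\<rho> < 1" "l \<ge> 1" "C0 \<ge> 0" "c0 > 0"
  shows "\<exists>N T. 1 \<le> N \<and> N \<le> T \<and> C0 * \<rho> ^ T \<le> \<sigma> ^ (N - 1) / (c0 * real l ^ N) \<and>
    ln (real (T + k * (2 * T + 1))) / real N < \<beta>"
proof -
  obtain a where a: "\<rho> ^ a < \<sigma> / real l" using real_arch_pow_inv[of "\<sigma> / real l" \<rho>] assms by auto
  obtain b where b: "\<rho> ^ b < 1 / (c0 * (C0 + 1))" using real_arch_pow_inv[of "1 / (c0 * (C0 + 1))" \<rho>] assms by auto
  define p s where "p = (a + 1) * (1 + 2 * k)" and "s = b * (1 + 2 * k) + k"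
  have K: "((a + 1) * N + b) + k * (2 * ((a + 1) * N + b) + 1) = p * N + s" for N
    by (simp add: p_def s_def algebra_simps)
  \<comment> \<open>\<open>(p N + s) e^(-\<beta>N)\<close> tends to 0\<close>
  define x where "x = exp (- \<beta>)"
  have x: "norm x < 1" using assms by (simp add: x_def)
  have "(\<lambda>N. real p * (of_nat N * x ^ N) + real s * x ^ N) \<longlonglongrightarrow> real p * 0 + real s * 0"
    using x by (intro tendsto_add tendsto_mult tendsto_const LIMSEQ_power_zero powser_times_n_limit_0)
  then have "eventually (\<lambda>N. real p * (of_nat N * x ^ N) + real s * x ^ N < 1) sequentially"
    by (intro order_tendstoD) auto
  then obtain N0 where N0: "\<And>N. N \<ge> N0 \<Longrightarrow> real p * (of_nat N * x ^ N) + real s * x ^ N < 1"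
    by (auto simp: eventually_sequentially)
  define N where "N = max 1 N0"
  define T where "T = (a + 1) * N + b"
  have N: "1 \<le> N" "N0 \<le> N" by (auto simp: N_def)
  have "real (p * N + s) * x ^ N < 1" using N0[OF N(2)] by (simp add: algebra_simps)
  moreover have "x ^ N = exp (- (\<beta> * real N))" by (simp add: x_def exp_of_nat_mult[symmetric] mult.commute)
  ultimately have "real (p * N + s) < exp (\<beta> * real N)" by (simp add: exp_minus field_simps)
  moreover have "p * N + s > 0" using N by (simp add: p_def)
  ultimately have "ln (real (p * N + s)) < \<beta> * real N" by (metis ln_exp ln_less_cancel_iff exp_gt_zero of_nat_0_less_iff)
  then have 1: "ln (real (T + k * (2 * T + 1))) / real N < \<beta>"
    using N unfolding T_def K by (simp add: pos_divide_less_eq)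
  have "C0 * \<rho> ^ T \<le> C0 * ((\<rho> ^ a) ^ N * \<rho> ^ b)"
  proof -
    have "\<rho> ^ T = (\<rho> ^ a) ^ N * \<rho> ^ b * \<rho> ^ N"
      by (simp add: T_def power_add power_mult[symmetric] algebra_simps)
    also have "\<dots> \<le> (\<rho> ^ a) ^ N * \<rho> ^ b * 1" using assms by (intro mult_left_mono power_le_one) auto
    finally show ?thesis using assms by (intro mult_left_mono) auto
  qed
  also have "\<dots> \<le> C0 * ((\<sigma> / real l) ^ N * (1 / (c0 * (C0 + 1))))"
    using a b assms by (intro mult_left_mono mult_mono power_mono) auto
  also have "\<dots> = (C0 / (C0 + 1)) * (\<sigma> ^ N / (c0 * real l ^ N))" by (simp add: power_divide)
  also have "\<dots> \<le> 1 * (\<sigma> ^ (N - 1) / (c0 * real l ^ N))"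
    using assms by (intro mult_mono divide_right_mono power_decreasing) auto
  finally have "C0 * \<rho> ^ T \<le> \<sigma> ^ (N - 1) / (c0 * real l ^ N)" by simp
  with 1 N show ?thesis by (intro exI[of _ N] exI[of _ T]) (auto simp: T_def)
qed

theorem theorem2:
  fixes A :: "real ^ 'n ^ 'n" and r l :: nat and \<beta> :: real
  assumes "r \<ge> 2" and "\<beta> > 0" and "l \<ge> 2"
    and "invertible A" and "spectral_radius A < 1"
  shows "\<exists>(m :: nat) (\<psi> :: nat \<Rightarrow> real \<Rightarrow> real ^ 'n) (D\<^sub>0 :: real).
    m \<ge> 1 \<and> (\<forall>i\<in>{1..m}. \<psi> i \<in> Cinf_circle) \<and> D\<^sub>0 > 0 \<and>
    (\<forall>\<kappa> > D\<^sub>0. \<forall>\<phi> \<in> Ukappa r (\<kappa> - D\<^sub>0).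
       {t \<in> {1..m} \<rightarrow>\<^sub>E {-1..1}.
          (\<lambda>x. \<phi> x + (\<Sum>i = 1..m. t i *\<^sub>R \<psi> i x)) \<in> exceptional r l \<beta> \<kappa> A}
       \<in> null_sets (completion (\<Pi>\<^sub>M i\<in>{1..m}. lborel)))"
proof -
  obtain C \<rho> where C: "C \<ge> 1" and \<rho>: "0 < \<rho>" "\<rho> < 1"
    and decay: "\<And>n v. norm (matpow A n *v v) \<le> C * \<rho> ^ n * norm v"
    using matpow_exponential_decay[OF assms(5)] by blast
  obtain \<sigma> where \<sigma>: "0 < \<sigma>" "\<sigma> \<le> 1"
    and lower: "\<And>n \<eta>. \<sigma> ^ n * norm \<eta> \<le> norm (transpose (matpow A n) *v \<eta>)"
    using transpose_matpow_lower_bound[OF assms(4)] by blast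
  have dec: "norm (matpow A n *v v) \<le> C * norm v" for n v
  proof -
    have "C * \<rho> ^ n * norm v \<le> C * 1 * norm v"
      using \<rho> C by (intro mult_right_mono mult_left_mono power_le_one) auto
    with decay[of n v] show ?thesis by simp
  qed
  define d where "d = CARD('n)"
  have l: "l \<ge> 2" "real l > 0" using assms by auto
  \<comment> \<open>the number of words is chosen so that \<open>\<delta>\<^sup>e l^(nk)\<close> with \<open>\<delta> = (\<rho>/l)\<^sup>n\<close> is summable: the loss \<open>l^(d+2)\<close> per step is beaten by the gain \<open>\<rho>\<^sup>e\<close>\<close>
  obtain e where e: "\<rho> ^ e < 1 / real l ^ (d + 2)"
    using real_arch_pow_inv[of "1 / real l ^ (d + 2)" \<rho>] \<rho> l by auto
  define k where "k = e + d + 2"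
  define \<theta> where "\<theta> = \<rho> ^ e * real l ^ (d + 2)"
  have \<theta>: "0 \<le> \<theta>" "\<theta> < 1" using e \<rho> l by (auto simp: \<theta>_def pos_less_divide_eq)
  obtain N T where N: "1 \<le> N" "N \<le> T"
    and T: "24 * pi * C * (real k + 1) * \<rho> ^ T \<le> \<sigma> ^ (N - 1) / (2 * real CARD('n) * real l ^ N)"
    and growth: "ln (real (T + k * (2 * T + 1))) / real N < \<beta>"
    using exists_parameters[OF assms(2) \<sigma> \<rho>, of l "24 * pi * C * (real k + 1)" "2 * real CARD('n)" k] l C by auto
  define K where "K = T + k * (2 * T + 1)"
  have K: "K \<ge> 1" using N by (simp add: K_def)
  define D where "D = \<sigma> ^ (N - 1) / (2 * real CARD('n) * real l ^ N)"
  have D: "D > 0" using \<sigma> l by (simp add: D_def)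
  have T': "24 * pi * C * \<rho> ^ T * (real k + 1) \<le> D" using T by (simp add: D_def mult_ac)
  obtain L R where R: "R > 0" and bumps:
    "\<And>y \<eta> n V. 1 / 2 \<le> norm \<eta> \<Longrightarrow> norm \<eta> \<le> 2 \<Longrightarrow> T \<le> n \<Longrightarrow> V \<subseteq> words l n \<Longrightarrow>
    inj_on (take N) V \<Longrightarrow> K \<le> card V \<Longrightarrow>
    (\<exists>J c \<zeta>. J \<subseteq> V \<and> card J = k \<and> (\<forall>j\<in>J. \<zeta> j < R) \<and>
      (\<forall>i\<in>J. 2 * D \<le> \<bar>\<eta> \<bullet> dS l A (bump_field L c (real (\<zeta> i) / real R)) i y\<bar>) \<and>
      (\<forall>i\<in>J. \<forall>j\<in>J. i \<noteq> j \<longrightarrow>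
        (real k + 1) * \<bar>\<eta> \<bullet> dS l A (bump_field L c (real (\<zeta> j) / real R)) i y\<bar> \<le> D))"
    using transversal_bump_family[OF l(1) C \<rho> \<sigma>(1) decay lower N D_def T'] unfolding K_def by metis
  define I where "I = (UNIV :: 'n set) \<times> {..<R}"
  define m where "m = card I"
  have "finite I" by (simp add: I_def)
  then obtain h where h: "bij_betw h {1..m} I" unfolding m_def using ex_bij_betw_nat_finite_1 by blast
  define \<psi> where "\<psi> = (\<lambda>i x. bump L (real (snd (h i)) / real R) x *\<^sub>R (axis (fst (h i)) 1 :: real ^ 'n))"
  define g where "g = (\<lambda>i. bump_field L (fst (h i)) (real (snd (h i)) / real R))"
  have \<psi>_deriv: "(\<psi> i has_vector_derivative g i x) (at x)" for i x
    unfolding \<psi>_def g_def bump_field_def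
    by (intro bounded_linear.has_vector_derivative[OF bounded_linear_scaleR_left]
        bump_has_derivative[unfolded has_real_derivative_iff_has_vector_derivative])
  have g_bound: "norm (g i x) \<le> 6 * pi" for i x
    using abs_bump'_le by (simp add: g_def bump_field_def norm_axis_1)
  have trans: "\<exists>J \<iota>. J \<subseteq> V \<and> card J = k \<and> \<iota> \<in> J \<rightarrow>\<^sub>E {1..m} \<and> transversal l A g k D y \<eta> J \<iota>"
    if V: "T \<le> n" "1 / 2 \<le> norm \<eta>" "norm \<eta> \<le> 2" "V \<subseteq> words l n" "inj_on (take N) V" "K \<le> card V" for n y \<eta> V
  proof -
    obtain J c \<zeta> where J: "J \<subseteq> V" "card J = k" "\<forall>j\<in>J. \<zeta> j < R"
      "\<forall>i\<in>J. 2 * D \<le> \<bar>\<eta> \<bullet> dS l A (bump_field L c (real (\<zeta> i) / real R)) i y\<bar>"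
      "\<forall>i\<in>J. \<forall>j\<in>J. i \<noteq> j \<longrightarrow>
        (real k + 1) * \<bar>\<eta> \<bullet> dS l A (bump_field L c (real (\<zeta> j) / real R)) i y\<bar> \<le> D"
      using bumps[OF V(2,3,1,4-6), of y] by (elim exE conjE)
    define \<iota> where "\<iota> = restrict (\<lambda>j. inv_into {1..m} h (c, \<zeta> j)) J"
    have hi: "\<iota> j \<in> {1..m}" "h (\<iota> j) = (c, \<zeta> j)" if "j \<in> J" for j
    proof -
      have "(c, \<zeta> j) \<in> h ` {1..m}" using J(3) that h by (simp add: I_def bij_betw_def)
      then show "\<iota> j \<in> {1..m}" "h (\<iota> j) = (c, \<zeta> j)"
        using that by (simp_all only: \<iota>_def restrict_apply' inv_into_into f_inv_into_f)
    qed
    have "g (\<iota> j) = bump_field L c (real (\<zeta> j) / real R)" if "j \<in> J" for j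
      using hi[OF that] by (simp add: g_def)
    then have "transversal l A g k D y \<eta> J \<iota>" using J(4,5) unfolding transversal_def by simp
    moreover have "\<iota> \<in> J \<rightarrow>\<^sub>E {1..m}" using hi by (auto simp: \<iota>_def)
    ultimately show ?thesis using J(1,2) by blast
  qed
  have "m \<ge> 1" using R by (simp add: m_def I_def card_gt_0_iff Suc_leI)
  moreover have "\<psi> i \<in> Cinf_circle" for i
    unfolding \<psi>_def by (rule trig_alg_scaleR_in_Cinf[OF bump_in_trig_alg])
  moreover have "{t \<in> {1..m} \<rightarrow>\<^sub>E {-1..1}.
          (\<lambda>x. \<phi> x + (\<Sum>i = 1..m. t i *\<^sub>R \<psi> i x)) \<in> exceptional r l \<beta> \<kappa> A}
       \<in> null_sets (completion (\<Pi>\<^sub>M i\<in>{1..m}. lborel))" (is "?E \<in> _")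
    if \<kappa>: "\<kappa> > 1" and \<phi>: "\<phi> \<in> Ukappa r (\<kappa> - 1)" for \<kappa> \<phi>
  proof -
    define f where "f = nth_vderiv 1 \<phi>"
    define C1 where "C1 = 2 * \<bar>alpha \<kappa> A\<bar> + 1"
    define B where "B = C * \<kappa> + C1 * C"
    define c where "c = C1 * C + 1 + real CARD('n) * (C * \<kappa>) + 2 * (C * \<kappa>) + 2 * (real m * (C * (6 * pi)))"
    define \<delta> where "\<delta> = (\<lambda>n. (\<rho> / real l) ^ n)"
    define U where "U = (\<lambda>n. \<Union>u\<in>bad_cells l A m f g k D B c (\<delta> n) n. cell m (\<delta> n) u)"
    let ?M = "\<Pi>\<^sub>M i\<in>{1..m}. (lborel :: real measure)"
    have B: "B \<ge> 0" using C \<kappa> by (simp add: B_def C1_def)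
    have \<rho>l: "0 < \<rho> / real l" "\<rho> / real l < 1" using \<rho> l by (auto simp: pos_divide_less_eq)
    have \<delta>: "0 < \<delta> n" "\<delta> n \<le> 1" for n using \<rho>l by (auto simp: \<delta>_def intro!: power_le_one)
    define cst where "cst = 7 * (2 * B + 3) * 5 ^ CARD('n) * real m ^ k * 5 ^ m * (2 * real (nat \<lceil>2 * c / D\<rceil>) + 1) ^ k"
    have cst: "cst \<ge> 0" using B by (simp add: cst_def)
    have em: "emeasure ?M (U n) \<le> ennreal (cst * \<theta> ^ n)" for n
    proof -
      have "\<delta> n ^ e * real (l ^ n) ^ k = ((\<rho> / real l) ^ e * real l ^ k) ^ n"
        by (simp add: \<delta>_def power_mult_distrib power_mult[symmetric] mult.commute)
      also have "(\<rho> / real l) ^ e * real l ^ k = \<theta>"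
        using l by (simp add: \<theta>_def k_def power_add power_divide)
      finally show ?thesis
        using measure_bad_cells_le[OF \<delta>[of n] D B, where k = k and e = e and m = m and l = l and A = A and f = f and g = g and c = c and n = n] unfolding U_def cst_def d_def[symmetric] k_def
        by simp
    qed
    have finb: "finite (bad_cells l A m f g k D B c (\<delta> n) n)" for n
      unfolding bad_cells_def by (rule finite_subset[of _ "{1..m} \<rightarrow>\<^sub>E grid 1 (\<delta> n)"]) (auto intro: finite_PiE)
    have "limsup U \<in> null_sets ?M"
    proof (rule borel_cantelli_limsup1)
      show "U n \<in> sets ?M" for n unfolding U_def by (intro sets.finite_UN finb cell_sets)
      show "emeasure ?M (U n) < \<infinity>" for n using em[of n] by (simp add: le_less_trans)
      show "summable (\<lambda>n. measure ?M (U n))"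
      proof (rule summable_comparison_test')
        show "summable (\<lambda>n. cst * \<theta> ^ n)" using \<theta> by (intro summable_mult summable_geometric) auto
        show "norm (measure ?M (U n)) \<le> cst * \<theta> ^ n" for n
          using em[of n] cst \<theta> by (simp add: measure_def enn2real_leI)
      qed
    qed
    then have null: "limsup U \<in> null_sets (completion ?M)" by (rule null_sets_completionI)
    moreover have "?E \<subseteq> limsup U"
    proof
      fix t assume tE: "t \<in> ?E"
      then have t: "t \<in> {1..m} \<rightarrow>\<^sub>E {-1..1}" by blast
      define \<phi>t where "\<phi>t = (\<lambda>x. \<phi> x + (\<Sum>i = 1..m. t i *\<^sub>R \<psi> i x))"
      define F where "F = perturb m f g t"
      have ex: "\<phi>t \<in> Ukappa r \<kappa>" "limsup (\<lambda>q. ereal (1 / real q * ln (real (conc_mult l \<kappa> A \<phi>t q)))) \<ge> ereal \<beta>"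
        using tE by (auto simp: exceptional_def \<phi>t_def)
      have \<phi>t: "(\<phi>t has_vector_derivative F x) (at x)" for x
        unfolding \<phi>t_def F_def f_def
        by (intro has_vector_derivative_add has_vector_derivative_sum
            bounded_linear.has_vector_derivative[OF bounded_linear_scaleR_right] \<psi>_deriv
            Ukappa_derivative_bounds(1)[OF \<phi> assms(1)])
      have F': "nth_vderiv 1 \<phi>t = F"
        using vector_derivative_unique_at[OF Ukappa_derivative_bounds(1)[OF ex(1) assms(1)] \<phi>t] by blast
      have bnd: "norm (F x) \<le> \<kappa>" and lip: "norm (F x - F y) \<le> \<kappa> * \<bar>x - y\<bar>" for x y
        using Ukappa_derivative_bounds(2,3)[OF ex(1) assms(1)] unfolding F' by blast+
      have "\<exists>n\<ge>Q0. t \<in> U n" for Q0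
      proof (rule ccontr)
        assume "\<not> ?thesis"
        then have notU: "t \<notin> U n" if "Q0 \<le> n" for n using that by blast
        obtain n1 where n1: "(\<rho> / real l) ^ n1 < 1 / (2 * real CARD('n))"
          using real_arch_pow_inv[of "1 / (2 * real CARD('n))" "\<rho> / real l"] \<rho>l by auto
        define Q where "Q = Q0 + n1 + T"
        have good: "card (take N ` near_words l A F C1 n y \<xi> \<eta>) \<le> K" if n: "Q \<le> n" and y: "y \<in> {-1..2}" for n y \<xi> \<eta>
        proof (rule ccontr)
          assume "\<not> ?thesis"
          then have Kc: "K \<le> card (take N ` near_words l A F C1 n y \<xi> \<eta>)" by simp
          have "\<delta> n \<le> (\<rho> / real l) ^ n1"
            unfolding \<delta>_def using \<rho>l n by (intro power_decreasing) (auto simp: Q_def)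
          then have "\<delta> n * real CARD('n) \<le> 1 / (2 * real CARD('n)) * real CARD('n)"
            using n1 by (intro mult_right_mono) auto
          then have small: "\<delta> n * real CARD('n) \<le> 1 / 2" by simp
          have Tn: "T \<le> n" using n by (simp add: Q_def)
          have "\<exists>u\<in>bad_cells l A m f g k D B c (\<delta> n) n. t \<in> cell m (\<delta> n) u"
            by (rule bad_parameter_in_bad_cell[OF l(1) C \<rho> decay F_def bnd lip _ g_bound t _ small
                  trans[OF Tn] y K Kc _ B_def c_def]) (auto simp: \<delta>_def C1_def)
          then have "t \<in> U n" by (auto simp: U_def)
          then show False using notU[of n] n by (simp add: Q_def)
        qed
        have "conc_mult l \<kappa> A \<phi>t q \<le> l ^ Q * K ^ (q div N)" for q
        proof (rule conc_mult_le[OF l(1) C \<sigma>(1) dec lower \<phi>t _ lip])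
          show "card (near_words l A F (2 * \<bar>alpha \<kappa> A\<bar> + 1) q y \<xi> \<eta>) \<le> l ^ Q * K ^ (q div N)"
            if "y \<in> {-1..2}" for y \<xi> \<eta>
            unfolding C1_def[symmetric] using N by (intro card_near_words_le[OF l(1) N(1) _ K good that]) (auto simp: Q_def)
        qed (use \<kappa> in simp)
        then have "limsup (\<lambda>q. ereal (1 / real q * ln (real (conc_mult l \<kappa> A \<phi>t q)))) \<le> ereal (ln (real K) / real N)"
          using N(1) K l by (intro limsup_log_growth_le[where Q = Q and l = l]) auto
        also have "\<dots> < ereal \<beta>" using growth by (simp add: K_def)
        finally show False using ex(2) by simp
      qed
      then show "t \<in> limsup U" by (auto simp: limsup_INF_SUP)
    qed
    ultimately show ?thesis using null_sets_completion_subset by blast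
  qed
  ultimately show ?thesis
    by (intro exI[of _ m] exI[of _ \<psi>] exI[of _ 1]) auto
qed

end
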